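(* Let $s\in(-\infty,1)$. There is a positive constant $C_n$ depending only on $n$ such that, for any nonzero function $f\in B^{s}_{\infty,\infty}(\mathbb R^n)$ with $\nabla f\in H^1(\mathbb R^n)$ and any $q\in\left(2,2+\frac{2}{1-s}\right)$, $$\|\nabla f\|_q\le C_{n,q,s}\,\|f\|_{B^s_{\infty,\infty}}^{1-\frac2q}\,\|\nabla f\|_2^{\frac2q-(1-s)(1-\frac2q)}\,\|\nabla f\|_{H^1}^{(1-s)(1-\frac2q)},$$ where $$C_{n,q,s}=C_n\max\left\{\frac{1}{2^{(1-s)(1-\frac2q)}-1},\ \frac{1}{1-2^{-[\frac2q-(1-s)(1-\frac2q)]}}\right\}.$$
   Context: $\|\cdot\|_q$ denotes the norm of $L^q(\mathbb R^n)$. Besov spaces: fix nonnegative radial Schwartz functions $\chi,\phi$ on $\mathbb R^n$ supported in $\{|\xi|\le\frac43\}$ and $\{\frac34\le|\xi|\le\frac83\}$ respectively, with $\chi(\xi)+\sum_{j\ge0}\phi(2^{-j}\xi)=1$ for all $\xi\in\mathbb R^n$. Define the Fourier multipliers $\Delta_{-1}f=\chi(D)f$ and $\Delta_jf=\phi(2^{-j}D)f$ for $j\ge0$. For $\sigma\in\mathbb R$, the inhomogeneous Besov norm of a tempered distribution $f$ is $\|f\|_{B^\sigma_{\infty,\infty}}=\sup_{j\ge-1}2^{j\sigma}\|\Delta_jf\|_{L^\infty}$. The functions $\chi,\phi$ are fixed once and for all. *)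

theory Defs
  imports "HOL-Probability.Essential_Supremum"
begin

section \<open>Schwartz functions\<close>

definition partial :: "'n::finite \<Rightarrow> (real^'n \<Rightarrow> 'b::real_normed_vector) \<Rightarrow> real^'n \<Rightarrow> 'b" where
  "partial i f x = frechet_derivative f (at x) (axis i 1)"

text \<open>A multi-index is given as the list of coordinate directions in which one differentiates.\<close>

definition partials :: "'n::finite list \<Rightarrow> (real^'n \<Rightarrow> 'b::real_normed_vector) \<Rightarrow> real^'n \<Rightarrow> 'b" where
  "partials is f = foldr partial is f"

text \<open>If all iterated partial derivatives are differentiable everywhere, they are all continuous,
  so the first conjunct says that the function is infinitely differentiable.\<close>

definition schwartz :: "(real^'n::finite \<Rightarrow> 'b::real_normed_vector) \<Rightarrow> bool" where
  "schwartz f \<longleftrightarrow>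
     (\<forall>is x. partials is f differentiable (at x)) \<and>
     (\<forall>is k. \<exists>B. \<forall>x. (1 + norm x) ^ k * norm (partials is f x) \<le> B)"

definition schwartz_norm :: "nat \<Rightarrow> (real^'n::finite \<Rightarrow> 'b::real_normed_vector) \<Rightarrow> real" where
  "schwartz_norm N f =
     (\<Sum>is | length is \<le> N. SUP x. (1 + norm x) ^ N * norm (partials is f x))"

text \<open>Convention: the Fourier transform of \<open>f\<close> is
  \<open>\<xi> \<mapsto> \<integral> exp (- \<i> x \<bullet> \<xi>) f x dx\<close>.\<close>

definition fourier :: "(real^'n::finite \<Rightarrow> complex) \<Rightarrow> real^'n \<Rightarrow> complex" where
  "fourier f \<xi> = (LINT x|lborel. cis (- (x \<bullet> \<xi>)) * f x)"

definition inverse_fourier :: "(real^'n::finite \<Rightarrow> complex) \<Rightarrow> real^'n \<Rightarrow> complex" where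
  "inverse_fourier f x = (LINT \<xi>|lborel. cis (x \<bullet> \<xi>) * f \<xi>) / of_real ((2 * pi) ^ CARD('n))"


section \<open>Tempered distributions\<close>

text \<open>Distributions are represented by functionals on all functions; only the
  values on Schwartz functions are meaningful.\<close>

type_synonym 'n distribution = "(real^'n \<Rightarrow> complex) \<Rightarrow> complex"

definition tempered_distribution :: "'n::finite distribution \<Rightarrow> bool" where
  "tempered_distribution T \<longleftrightarrow>
     (\<forall>\<psi> \<eta>. schwartz \<psi> \<longrightarrow> schwartz \<eta> \<longrightarrow> T (\<lambda>x. \<psi> x + \<eta> x) = T \<psi> + T \<eta>) \<and>
     (\<forall>c \<psi>. schwartz \<psi> \<longrightarrow> T (\<lambda>x. c * \<psi> x) = c * T \<psi>) \<and>
     (\<exists>C N. \<forall>\<psi>. schwartz \<psi> \<longrightarrow> norm (T \<psi>) \<le> C * schwartz_norm N \<psi>)"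

definition nonzero_distribution :: "'n::finite distribution \<Rightarrow> bool" where
  "nonzero_distribution T \<longleftrightarrow> (\<exists>\<psi>. schwartz \<psi> \<and> T \<psi> \<noteq> 0)"

definition regular_distribution :: "(real^'n::finite \<Rightarrow> complex) \<Rightarrow> 'n distribution" where
  "regular_distribution h \<psi> = (LINT x|lborel. h x * \<psi> x)"

definition represents :: "(real^'n::finite \<Rightarrow> complex) \<Rightarrow> 'n distribution \<Rightarrow> bool" where
  "represents h T \<longleftrightarrow>
     h \<in> borel_measurable lborel \<and>
     (\<forall>\<psi>. schwartz \<psi> \<longrightarrow>
        integrable lborel (\<lambda>x. h x * \<psi> x) \<and> T \<psi> = regular_distribution h \<psi>)"

definition dist_partial :: "'n::finite \<Rightarrow> 'n distribution \<Rightarrow> 'n distribution" where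
  "dist_partial i T \<psi> = - T (partial i \<psi>)"

definition dist_fourier :: "'n::finite distribution \<Rightarrow> 'n distribution" where
  "dist_fourier T \<psi> = T (fourier \<psi>)"

definition dist_inverse_fourier :: "'n::finite distribution \<Rightarrow> 'n distribution" where
  "dist_inverse_fourier T \<psi> = T (inverse_fourier \<psi>)"

definition dist_mult :: "(real^'n::finite \<Rightarrow> real) \<Rightarrow> 'n distribution \<Rightarrow> 'n distribution" where
  "dist_mult m T \<psi> = T (\<lambda>x. of_real (m x) * \<psi> x)"

text \<open>The operator \<open>m(D)\<close>, for a Schwartz symbol \<open>m\<close>.\<close>

definition fourier_multiplier :: "(real^'n::finite \<Rightarrow> real) \<Rightarrow> 'n distribution \<Rightarrow> 'n distribution" where
  "fourier_multiplier m T = dist_inverse_fourier (dist_mult m (dist_fourier T))"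


section \<open>Lebesgue and Sobolev norms\<close>

text \<open>The real-valued norms \<open>Lp_norm\<close> and \<open>H1_norm\<close> are meaningful only
  for members of the corresponding spaces \<open>in_Lp\<close> and \<open>in_H1\<close>.\<close>

definition in_Lp :: "real \<Rightarrow> (real^'n::finite \<Rightarrow> 'b::real_normed_vector) \<Rightarrow> bool" where
  "in_Lp p g \<longleftrightarrow>
     g \<in> borel_measurable lborel \<and> integrable lborel (\<lambda>x. norm (g x) powr p)"

definition Lp_norm :: "real \<Rightarrow> (real^'n::finite \<Rightarrow> 'b::real_normed_vector) \<Rightarrow> real" where
  "Lp_norm p g = (LINT x|lborel. norm (g x) powr p) powr (1 / p)"

text \<open>The \<open>L\<^sup>\<infinity>\<close> norm of a distribution; it is infinite if the distribution
  is not given by a function. All functions representing a distribution agree almost everywhere, so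
  the infimum is over a single value.\<close>

definition Linf_norm :: "'n::finite distribution \<Rightarrow> ennreal" where
  "Linf_norm T = (INF h\<in>{h. represents h T}. esssup lborel (\<lambda>x. ennreal (norm (h x))))"

definition is_L2_weak_partial ::
    "'n::finite \<Rightarrow> (real^'n \<Rightarrow> complex) \<Rightarrow> (real^'n \<Rightarrow> complex) \<Rightarrow> bool" where
  "is_L2_weak_partial i u v \<longleftrightarrow>
     in_Lp 2 v \<and> represents v (dist_partial i (regular_distribution u))"

text \<open>Unique up to almost everywhere equality whenever it exists.\<close>

definition weak_partial :: "'n::finite \<Rightarrow> (real^'n \<Rightarrow> complex) \<Rightarrow> real^'n \<Rightarrow> complex" where
  "weak_partial i u = (SOME v. is_L2_weak_partial i u v)"

definition in_H1 :: "(real^'n::finite \<Rightarrow> complex^'m::finite) \<Rightarrow> bool" where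
  "in_H1 g \<longleftrightarrow>
     in_Lp 2 g \<and> (\<forall>i k. \<exists>v. is_L2_weak_partial i (\<lambda>x. g x $ k) v)"

definition H1_norm :: "(real^'n::finite \<Rightarrow> complex^'m::finite) \<Rightarrow> real" where
  "H1_norm g =
     sqrt ((Lp_norm 2 g)\<^sup>2 + (\<Sum>i\<in>UNIV. \<Sum>k\<in>UNIV. (Lp_norm 2 (weak_partial i (\<lambda>x. g x $ k)))\<^sup>2))"

text \<open>The distributional gradient of \<open>T\<close> is the vector-valued function \<open>g\<close>.\<close>

definition has_dist_gradient :: "'n::finite distribution \<Rightarrow> (real^'n \<Rightarrow> complex^'n) \<Rightarrow> bool" where
  "has_dist_gradient T g \<longleftrightarrow> (\<forall>i. represents (\<lambda>x. g x $ i) (dist_partial i T))"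


section \<open>Besov spaces\<close>

definition dyadic_partition :: "(real^'n::finite \<Rightarrow> real) \<Rightarrow> (real^'n \<Rightarrow> real) \<Rightarrow> bool" where
  "dyadic_partition chi phi \<longleftrightarrow>
     schwartz chi \<and> schwartz phi \<and>
     (\<forall>\<xi>. chi \<xi> \<ge> 0) \<and> (\<forall>\<xi>. phi \<xi> \<ge> 0) \<and>
     (\<forall>\<xi> \<eta>. norm \<xi> = norm \<eta> \<longrightarrow> chi \<xi> = chi \<eta> \<and> phi \<xi> = phi \<eta>) \<and>
     (\<forall>\<xi>. chi \<xi> \<noteq> 0 \<longrightarrow> norm \<xi> \<le> 4/3) \<and>
     (\<forall>\<xi>. phi \<xi> \<noteq> 0 \<longrightarrow> 3/4 \<le> norm \<xi> \<and> norm \<xi> \<le> 8/3) \<and>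
     (\<forall>\<xi>. summable (\<lambda>j::nat. phi ((2 powi (- int j)) *\<^sub>R \<xi>)) \<and>
          chi \<xi> + (\<Sum>j. phi ((2 powi (- int j)) *\<^sub>R \<xi>)) = 1)"

definition dyadic_block ::
    "(real^'n::finite \<Rightarrow> real) \<Rightarrow> (real^'n \<Rightarrow> real) \<Rightarrow> int \<Rightarrow> 'n distribution \<Rightarrow> 'n distribution" where
  "dyadic_block chi phi j T =
     fourier_multiplier (if j = -1 then chi else (\<lambda>\<xi>. phi ((2 powi (- j)) *\<^sub>R \<xi>))) T"

definition besov_ennorm ::
    "(real^'n::finite \<Rightarrow> real) \<Rightarrow> (real^'n \<Rightarrow> real) \<Rightarrow> real \<Rightarrow> 'n distribution \<Rightarrow> ennreal" where
  "besov_ennorm chi phi \<sigma> T =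
     (SUP j\<in>{-1..}. ennreal (2 powr (of_int j * \<sigma>)) * Linf_norm (dyadic_block chi phi j T))"

definition in_besov ::
    "(real^'n::finite \<Rightarrow> real) \<Rightarrow> (real^'n \<Rightarrow> real) \<Rightarrow> real \<Rightarrow> 'n distribution \<Rightarrow> bool" where
  "in_besov chi phi \<sigma> T \<longleftrightarrow> tempered_distribution T \<and> besov_ennorm chi phi \<sigma> T < \<infinity>"

definition besov_norm ::
    "(real^'n::finite \<Rightarrow> real) \<Rightarrow> (real^'n \<Rightarrow> real) \<Rightarrow> real \<Rightarrow> 'n distribution \<Rightarrow> real" where
  "besov_norm chi phi \<sigma> T = enn2real (besov_ennorm chi phi \<sigma> T)"

end

theory Submission
  imports Defs "HOL-Probability.Characteristic_Functions" "HOL-Probability.Sinc_Integral"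
begin

text \<open>
The inequality interpolates each Littlewood--Paley piece of the gradient between \<open>L\<^sup>\<infinity>\<close> and \<open>L\<^sup>2\<close> and
then sums a geometric series on either side of a critical frequency.

Let \<open>u\<close> be a component of \<open>\<nabla>f\<close>, let \<open>j \<ge> -1\<close>, and put \<open>\<theta> = 1 - 2/q\<close> and \<open>a = (1 - s) \<theta>\<close>. Three
estimates hold for \<open>\<Delta>\<^sub>j u\<close>. By Bernstein's inequality its supremum is at most a constant times
\<open>2^(j (1 - s))\<close> times the Besov norm of \<open>f\<close> (\<open>block_sup_bound\<close>). By Young's inequality its \<open>L\<^sup>2\<close> norm
is at most a constant times \<open>\<parallel>\<nabla>f\<parallel>\<^sub>2\<close> (\<open>block_L2_bound\<close>). For \<open>j \<ge> 0\<close> the symbol vanishes near the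
origin, so it is a divergence \<open>\<Sum>\<^sub>l \<xi>\<^sub>l p\<^sub>l\<close> of Schwartz symbols; moving the derivatives to \<open>u\<close> bounds
the \<open>L\<^sup>2\<close> norm by a constant times \<open>2^(-j)\<close> times the \<open>H\<^sup>1\<close> norm of \<open>\<nabla>f\<close> (\<open>block_L2_bound_high\<close>).
Since \<open>\<parallel>w\<parallel>\<^sub>q\<close> is at most \<open>\<parallel>w\<parallel>\<^sub>\<infinity>\<^sup>\<theta>\<close> times the power \<open>2/q\<close> of \<open>\<parallel>w\<parallel>\<^sub>2\<close>, the pieces grow like
\<open>2^(j a)\<close> at low frequencies and decay like \<open>2^(-j (2/q - a))\<close> at high ones; both \<open>a\<close> and \<open>2/q - a\<close>
are positive for the given \<open>s\<close> and \<open>q\<close>. Splitting where \<open>2^j\<close> passes the ratio of the \<open>H\<^sup>1\<close> norm to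
the \<open>L\<^sup>2\<close> norm of \<open>\<nabla>f\<close> yields two geometric series, whose sums form the maximum in the constant
(\<open>dyadic_two_sided_sum\<close>).

Everything is arranged so that a distribution is only ever tested against explicit Schwartz
functions. The value \<open>m(D)u(x)\<close> is the pairing of \<open>u\<close> with the Schwartz function
\<open>y \<mapsto> k(x - y)\<close>, \<open>k\<close> the inverse Fourier transform of \<open>m\<close>; hence the defining relation of the
distributional gradient applies pointwise in \<open>x\<close> and gives \<open>\<Delta>\<^sub>j u(x)\<close> directly as a pairing with
\<open>\<Delta>\<^sub>j f\<close> (\<open>multiplier_op_eq_block\<close>). What this takes from Fourier analysis is that the Fourier
transform preserves Schwartz functions (\<open>schwartz_fourier\<close>) and is inverted by \<open>inverse_fourier\<close>
(\<open>fourier_inversion\<close>).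

It remains to see that the pieces sum to \<open>u\<close> almost everywhere (\<open>littlewood_paley_AE\<close>). Their
\<open>L\<^sup>2\<close> norms are summable because \<open>u\<close> lies in \<open>H\<^sup>1\<close>, so the series converges almost everywhere under
an \<open>L\<^sup>2\<close> majorant; its sum is \<open>u\<close> because the partial sums, being convolutions with an
approximate identity, converge weakly to \<open>u\<close> on weighted indicators of boxes
(\<open>multiplier_op_limit_unique\<close>).
\<close>

section \<open>Closure properties of Schwartz functions\<close>

text \<open>Counting derivatives by their number, instead of listing their directions, makes every
closure property an induction on \<open>n\<close> in which \<open>f\<close> is replaced by its first partial derivatives.\<close>
fun schwartz_upto :: "nat \<Rightarrow> (real^'n::finite \<Rightarrow> 'b::real_normed_vector) \<Rightarrow> bool" where
  "schwartz_upto 0 f \<longleftrightarrow> (\<forall>x. f differentiable (at x)) \<and> (\<forall>k. \<exists>B. \<forall>x. (1 + norm x) ^ k * norm (f x) \<le> B)"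
| "schwartz_upto (Suc n) f \<longleftrightarrow> schwartz_upto 0 f \<and> (\<forall>i. schwartz_upto n (partial i f))"

lemma schwartz_upto_iff:
  "schwartz_upto n f \<longleftrightarrow> (\<forall>is. length is \<le> n \<longrightarrow> schwartz_upto 0 (partials is f))"
proof (induction n arbitrary: f)
  case 0
  then show ?case by (simp add: partials_def)
next
  case (Suc n)
  have snoc: "partials (is @ [i]) f = partials is (partial i f)" for i "is"
    by (simp add: partials_def)
  have nil: "partials [] f = f"
    by (simp add: partials_def)
  show ?case
  proof
    assume L: "schwartz_upto (Suc n) f"
    show "\<forall>is. length is \<le> Suc n \<longrightarrow> schwartz_upto 0 (partials is f)"
    proof (intro allI impI)
      fix "is" :: "'a list" assume len: "length is \<le> Suc n"
      show "schwartz_upto 0 (partials is f)"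
      proof (cases "is" rule: rev_cases)
        case Nil
        then show ?thesis using L nil by simp
      next
        case (snoc js i)
        then have "schwartz_upto 0 (partials js (partial i f))"
          using L len Suc.IH[of "partial i f"] by simp
        then show ?thesis using snoc by (simp add: partials_def)
      qed
    qed
  next
    assume R: "\<forall>is. length is \<le> Suc n \<longrightarrow> schwartz_upto 0 (partials is f)"
    have "schwartz_upto 0 f" using R[rule_format, of "[]"] nil by simp
    moreover have "schwartz_upto n (partial i f)" for i
      unfolding Suc.IH using R snoc[of _ i] by (metis Suc_le_mono length_append_singleton)
    ultimately show "schwartz_upto (Suc n) f" by simp
  qed
qed

lemma schwartz_iff_upto: "schwartz f \<longleftrightarrow> (\<forall>n. schwartz_upto n f)"
proof -
  have "(\<forall>n. schwartz_upto n f) \<longleftrightarrow> (\<forall>is. schwartz_upto 0 (partials is f))"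
    unfolding schwartz_upto_iff[of _ f] by blast
  then show ?thesis unfolding schwartz_def by auto
qed

lemma schwartz_upto_0: "schwartz_upto n f \<Longrightarrow> schwartz_upto 0 f"
  by (cases n) auto

lemma schwartz_upto_Suc_imp: "schwartz_upto (Suc n) f \<Longrightarrow> schwartz_upto n f"
  unfolding schwartz_upto_iff[of "Suc n" f] schwartz_upto_iff[of n f] by (meson le_SucI)

lemma partial_eqI: "(f has_derivative D) (at x) \<Longrightarrow> partial i f x = D (axis i 1)"
  unfolding partial_def by (simp add: frechet_derivative_at[symmetric])

lemma schwartz_upto_0_derivative:
  "schwartz_upto 0 f \<Longrightarrow> (f has_derivative frechet_derivative f (at x)) (at x)"
  by (simp add: frechet_derivative_works)

lemma schwartz_upto_0_decay:
  fixes f :: "real^'n::finite \<Rightarrow> 'b::real_normed_vector"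
  assumes "schwartz_upto 0 f"
  obtains B where "B \<ge> 0" "\<And>x. (1 + norm x) ^ k * norm (f x) \<le> B"
proof -
  obtain B where B: "\<And>x. (1 + norm x) ^ k * norm (f x) \<le> B" using assms by (simp only: schwartz_upto.simps) blast
  have "0 \<le> (1 + norm (0::real^'n)) ^ k * norm (f 0)" by simp
  with B[of 0] have "B \<ge> 0" by linarith
  with B show ?thesis by (rule_tac that)
qed

lemma schwartz_upto_SucI:
  assumes "schwartz_upto 0 f" "\<And>i. partial i f = f' i" "\<And>i. schwartz_upto n (f' i)"
  shows "schwartz_upto (Suc n) f"
  using assms by simp

lemma schwartz_upto_0_dominated:
  fixes f :: "real^'n::finite \<Rightarrow> 'b::real_normed_vector" and g :: "real^'n \<Rightarrow> 'c::real_normed_vector"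
  assumes g: "schwartz_upto 0 g" and d: "\<And>x. f differentiable (at x)"
    and le: "\<And>x. norm (f x) \<le> C * (1 + norm x) ^ l * norm (g x)" and C: "C \<ge> 0"
  shows "schwartz_upto 0 f"
proof -
  have "\<exists>B. \<forall>x. (1 + norm x) ^ k * norm (f x) \<le> B" for k
  proof -
    obtain B where B: "\<And>x. (1 + norm x) ^ (k + l) * norm (g x) \<le> B"
      using g by (simp only: schwartz_upto.simps) blast
    have "(1 + norm x) ^ k * norm (f x) \<le> C * B" for x
    proof -
      have "(1 + norm x) ^ k * norm (f x) \<le> (1 + norm x) ^ k * (C * (1 + norm x) ^ l * norm (g x))"
        using le[of x] by (intro mult_left_mono) auto
      also have "\<dots> = C * ((1 + norm x) ^ (k + l) * norm (g x))" by (simp add: power_add)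
      also have "\<dots> \<le> C * B" using B[of x] C by (intro mult_left_mono) auto
      finally show ?thesis .
    qed
    then show ?thesis by blast
  qed
  then show ?thesis using d by simp
qed

lemma schwartz_upto_add:
  "schwartz_upto n f \<Longrightarrow> schwartz_upto n g \<Longrightarrow> schwartz_upto n (\<lambda>x. f x + g x)"
proof (induction n arbitrary: f g)
  case 0
  have "\<exists>B. \<forall>x. (1 + norm x) ^ k * norm (f x + g x) \<le> B" for k
  proof -
    obtain B C where BC: "\<And>x. (1 + norm x) ^ k * norm (f x) \<le> B"
      "\<And>x. (1 + norm x) ^ k * norm (g x) \<le> C"
      using schwartz_upto_0_decay[OF 0(1)] schwartz_upto_0_decay[OF 0(2)] by metis
    have "(1 + norm x) ^ k * norm (f x + g x) \<le> B + C" for x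
    proof -
      have "(1 + norm x) ^ k * norm (f x + g x) \<le> (1 + norm x) ^ k * (norm (f x) + norm (g x))"
        by (intro mult_left_mono norm_triangle_ineq) auto
      then show ?thesis using BC[of x] by (simp add: algebra_simps)
    qed
    then show ?thesis by blast
  qed
  then show ?case using 0 by simp
next
  case (Suc n)
  have 0: "schwartz_upto 0 f" "schwartz_upto 0 g" using Suc.prems by simp_all
  show ?case
  proof (rule schwartz_upto_SucI)
    show "schwartz_upto 0 (\<lambda>x. f x + g x)"
    proof -
      have "schwartz_upto n f" "schwartz_upto n g"
        by (rule schwartz_upto_Suc_imp[OF Suc.prems(1)], rule schwartz_upto_Suc_imp[OF Suc.prems(2)])
      from Suc.IH[OF this] show ?thesis by (rule schwartz_upto_0)
    qed
    show "partial i (\<lambda>x. f x + g x) = (\<lambda>x. partial i f x + partial i g x)" for i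
      by (rule ext, subst partial_eqI[OF has_derivative_add[OF schwartz_upto_0_derivative[OF 0(1)]
              schwartz_upto_0_derivative[OF 0(2)]]]) (simp add: partial_def)
    show "schwartz_upto n (\<lambda>x. partial i f x + partial i g x)" for i
      using Suc by simp
  qed
qed

lemma schwartz_upto_cmult:
  fixes f :: "real^'n::finite \<Rightarrow> complex"
  shows "schwartz_upto n f \<Longrightarrow> schwartz_upto n (\<lambda>x. c * f x)"
proof (induction n arbitrary: f)
  case 0
  have d: "(\<lambda>x. c * f x) differentiable (at x)" for x
    by (rule differentiableI[OF has_derivative_mult_right[OF schwartz_upto_0_derivative[OF 0]]])
  show ?case
    by (rule schwartz_upto_0_dominated[OF 0 d, where C="norm c" and l=0]) (auto simp: norm_mult)
next
  case (Suc n)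
  have 0: "schwartz_upto 0 f" using Suc.prems by simp
  show ?case
  proof (rule schwartz_upto_SucI)
    show "schwartz_upto 0 (\<lambda>x. c * f x)"
      by (rule schwartz_upto_0[OF Suc.IH[OF schwartz_upto_Suc_imp[OF Suc.prems(1)]]])
    show "partial i (\<lambda>x. c * f x) = (\<lambda>x. c * partial i f x)" for i
      by (rule ext, subst partial_eqI[OF has_derivative_mult_right[OF schwartz_upto_0_derivative[OF 0]]])
         (simp add: partial_def)
    show "schwartz_upto n (\<lambda>x. c * partial i f x)" for i
      using Suc by simp
  qed
qed

lemma partial_coord_mult:
  fixes f :: "real^'n::finite \<Rightarrow> complex"
  assumes "schwartz_upto 0 f"
  shows "partial l (\<lambda>x. of_real (x $ i) * f x) =
    (\<lambda>x. (if l = i then f x else 0) + of_real (x $ i) * partial l f x)"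
proof
  fix x
  have "((\<lambda>x. of_real (x $ i) * f x) has_derivative
     (\<lambda>h. of_real (x $ i) * frechet_derivative f (at x) h + of_real (h $ i) * f x)) (at x)"
    by (intro has_derivative_mult schwartz_upto_0_derivative[OF assms] has_derivative_of_real
        bounded_linear.has_derivative[OF bounded_linear_vec_nth] has_derivative_ident)
  from partial_eqI[OF this, of l] show "partial l (\<lambda>x. of_real (x $ i) * f x) x =
     (if l = i then f x else 0) + of_real (x $ i) * partial l f x"
    by (simp add: partial_def axis_def)
qed

lemma schwartz_upto_coord_mult:
  fixes f :: "real^'n::finite \<Rightarrow> complex"
  shows "schwartz_upto n f \<Longrightarrow> schwartz_upto n (\<lambda>x. of_real (x $ i) * f x)"
proof (induction n arbitrary: f)
  case 0
  have d: "(\<lambda>x. of_real (x $ i) * f x) differentiable (at x)" for x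
    by (rule differentiableI[OF has_derivative_mult[OF has_derivative_of_real[OF bounded_linear_imp_has_derivative[OF bounded_linear_vec_nth]]
        schwartz_upto_0_derivative[OF 0]]])
  have "norm (x $ i) * norm (f x) \<le> (1 + norm x) * norm (f x)" for x
    by (intro mult_right_mono) (use component_le_norm_cart[of x i] in auto)
  then show ?case
    by (intro schwartz_upto_0_dominated[OF 0 d, where C=1 and l=1]) (auto simp: norm_mult)
next
  case (Suc n)
  have 0: "schwartz_upto 0 f" using Suc.prems(1) by simp
  have n: "schwartz_upto n f" by (rule schwartz_upto_Suc_imp[OF Suc.prems(1)])
  show ?case
  proof (rule schwartz_upto_SucI)
    show "schwartz_upto 0 (\<lambda>x. of_real (x $ i) * f x)"
      by (rule schwartz_upto_0[OF Suc.IH[OF n]])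
    show "partial l (\<lambda>x. of_real (x $ i) * f x) =
        (\<lambda>x. (if l = i then 1 else 0) * f x + of_real (x $ i) * partial l f x)" for l
      unfolding partial_coord_mult[OF 0] by auto
    show "schwartz_upto n (\<lambda>x. (if l = i then 1 else 0) * f x + of_real (x $ i) * partial l f x)" for l
      by (intro schwartz_upto_add schwartz_upto_cmult n Suc.IH) (use Suc.prems in simp)
  qed
qed

lemma has_derivative_cis_inner:
  "((\<lambda>x. cis (a \<bullet> x)) has_derivative (\<lambda>h. \<i> * of_real (a \<bullet> h) * cis (a \<bullet> x))) (at x)"
proof -
  have "((\<lambda>x. exp (\<i> * of_real (a \<bullet> x))) has_derivative
      (\<lambda>h. (\<i> * of_real (a \<bullet> h)) * exp (\<i> * of_real (a \<bullet> x)))) (at x)"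
  proof -
    have "((\<lambda>x. \<i> * complex_of_real (a \<bullet> x)) has_derivative (\<lambda>h. \<i> * of_real (a \<bullet> h))) (at x)"
      by (intro has_derivative_mult_right has_derivative_of_real
          bounded_linear_imp_has_derivative bounded_linear_inner_right)
    from diff_chain_at[OF this DERIV_exp[THEN has_field_derivative_imp_has_derivative]]
    show ?thesis by (simp add: o_def mult.commute)
  qed
  then show ?thesis by (simp add: cis_conv_exp)
qed

lemma schwartz_upto_cis_mult:
  fixes f :: "real^'n::finite \<Rightarrow> complex"
  shows "schwartz_upto n f \<Longrightarrow> schwartz_upto n (\<lambda>x. cis (a \<bullet> x) * f x)"
proof (induction n arbitrary: f)
  case 0
  have d: "(\<lambda>x. cis (a \<bullet> x) * f x) differentiable (at x)" for x
    by (rule differentiableI[OF has_derivative_mult[OF has_derivative_cis_inner schwartz_upto_0_derivative[OF 0]]])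
  then show ?case
    by (intro schwartz_upto_0_dominated[OF 0 d, where C=1 and l=0]) (auto simp: norm_mult)
next
  case (Suc n)
  have 0: "schwartz_upto 0 f" using Suc.prems(1) by simp
  have n: "schwartz_upto n f" by (rule schwartz_upto_Suc_imp[OF Suc.prems(1)])
  show ?case
  proof (rule schwartz_upto_SucI)
    show "schwartz_upto 0 (\<lambda>x. cis (a \<bullet> x) * f x)"
      by (rule schwartz_upto_0[OF Suc.IH[OF n]])
    show "partial l (\<lambda>x. cis (a \<bullet> x) * f x) =
        (\<lambda>x. cis (a \<bullet> x) * (\<i> * of_real (a $ l) * f x + partial l f x))" for l
      by (rule ext, subst partial_eqI[OF has_derivative_mult[OF has_derivative_cis_inner
            schwartz_upto_0_derivative[OF 0]]]) (simp add: partial_def inner_axis algebra_simps)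
    show "schwartz_upto n (\<lambda>x. cis (a \<bullet> x) * (\<i> * of_real (a $ l) * f x + partial l f x))" for l
      by (intro Suc.IH schwartz_upto_add schwartz_upto_cmult n) (use Suc.prems in simp)
  qed
qed

lemma schwartz_upto_of_real:
  fixes f :: "real^'n::finite \<Rightarrow> real"
  shows "schwartz_upto n f \<Longrightarrow> schwartz_upto n (\<lambda>x. complex_of_real (f x))"
proof (induction n arbitrary: f)
  case 0
  have d: "(\<lambda>x. complex_of_real (f x)) differentiable (at x)" for x
    by (rule differentiableI[OF has_derivative_of_real[OF schwartz_upto_0_derivative[OF 0]]])
  then show ?case
    by (intro schwartz_upto_0_dominated[OF 0 d, where C=1 and l=0]) (auto)
next
  case (Suc n)
  have 0: "schwartz_upto 0 f" using Suc.prems(1) by simp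
  have n: "schwartz_upto n f" by (rule schwartz_upto_Suc_imp[OF Suc.prems(1)])
  show ?case
  proof (rule schwartz_upto_SucI)
    show "schwartz_upto 0 (\<lambda>x. complex_of_real (f x))"
      by (rule schwartz_upto_0[OF Suc.IH[OF n]])
    show "partial l (\<lambda>x. complex_of_real (f x)) = (\<lambda>x. of_real (partial l f x))" for l
      by (rule ext, subst partial_eqI[OF has_derivative_of_real[OF schwartz_upto_0_derivative[OF 0]]])
        (simp add: partial_def)
    show "schwartz_upto n (\<lambda>x. complex_of_real (partial l f x))" for l
      by (intro Suc.IH) (use Suc.prems in simp)
  qed
qed

lemma has_derivative_dilation:
  assumes "schwartz_upto 0 f"
  shows "((\<lambda>x. f (r *\<^sub>R x)) has_derivative (\<lambda>h. r *\<^sub>R frechet_derivative f (at (r *\<^sub>R x)) h)) (at x)"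
proof -
  have "((\<lambda>x. r *\<^sub>R x) has_derivative (\<lambda>h. r *\<^sub>R h)) (at x)"
    by (intro derivative_eq_intros) auto
  from diff_chain_at[OF this schwartz_upto_0_derivative[OF assms]]
  have "((\<lambda>x. f (r *\<^sub>R x)) has_derivative (\<lambda>h. frechet_derivative f (at (r *\<^sub>R x)) (r *\<^sub>R h))) (at x)"
    by (simp add: o_def)
  moreover have "linear (frechet_derivative f (at (r *\<^sub>R x)))"
    using schwartz_upto_0_derivative[OF assms] has_derivative_linear by blast
  ultimately show ?thesis by (simp add: linear_scale)
qed

lemma schwartz_upto_dilation:
  fixes f :: "real^'n::finite \<Rightarrow> complex"
  assumes r: "r \<noteq> 0"
  shows "schwartz_upto n f \<Longrightarrow> schwartz_upto n (\<lambda>x. f (r *\<^sub>R x))"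
proof (induction n arbitrary: f)
  case 0
  have "\<exists>B. \<forall>x. (1 + norm x) ^ k * norm (f (r *\<^sub>R x)) \<le> B" for k
  proof -
    obtain B where B: "B \<ge> 0" "\<And>x. (1 + norm x) ^ k * norm (f x) \<le> B"
      using schwartz_upto_0_decay[OF 0] by metis
    define c where "c = max 1 (1 / \<bar>r\<bar>)"
    have c: "1 + norm x \<le> c * (1 + norm (r *\<^sub>R x))" for x :: "real^'n"
    proof -
      have "norm x = (1 / \<bar>r\<bar>) * norm (r *\<^sub>R x)" using r by simp
      also have "\<dots> \<le> c * norm (r *\<^sub>R x)" by (intro mult_right_mono) (auto simp: c_def)
      finally show ?thesis by (simp add: distrib_left) (simp add: c_def)
    qed
    have "(1 + norm x) ^ k * norm (f (r *\<^sub>R x)) \<le> c ^ k * B" for x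
    proof -
      have "(1 + norm x) ^ k * norm (f (r *\<^sub>R x)) \<le> (c * (1 + norm (r *\<^sub>R x))) ^ k * norm (f (r *\<^sub>R x))"
        by (intro mult_right_mono power_mono c) auto
      also have "\<dots> = c ^ k * ((1 + norm (r *\<^sub>R x)) ^ k * norm (f (r *\<^sub>R x)))"
        by (simp add: power_mult_distrib)
      also have "\<dots> \<le> c ^ k * B" by (intro mult_left_mono B(2)) (simp add: c_def)
      finally show ?thesis .
    qed
    then show ?thesis by blast
  qed
  moreover have "(\<lambda>x. f (r *\<^sub>R x)) differentiable (at x)" for x
    by (rule differentiableI[OF has_derivative_dilation[OF 0]])
  ultimately show ?case by simp
next
  case (Suc n)
  have 0: "schwartz_upto 0 f" using Suc.prems(1) by simp
  have n: "schwartz_upto n f" by (rule schwartz_upto_Suc_imp[OF Suc.prems(1)])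
  show ?case
  proof (rule schwartz_upto_SucI)
    show "schwartz_upto 0 (\<lambda>x. f (r *\<^sub>R x))"
      by (rule schwartz_upto_0[OF Suc.IH[OF n]])
    show "partial l (\<lambda>x. f (r *\<^sub>R x)) = (\<lambda>x. of_real r * partial l f (r *\<^sub>R x))" for l
      by (rule ext, subst partial_eqI[OF has_derivative_dilation[OF 0]])
        (simp add: partial_def scaleR_conv_of_real)
    show "schwartz_upto n (\<lambda>x. of_real r * partial l f (r *\<^sub>R x))" for l
      by (intro Suc.IH schwartz_upto_cmult) (use Suc.prems in simp)
  qed
qed

text \<open>The singularity at the origin is invisible to a function vanishing near it. By the quotient
rule the derivatives of \<open>f / |x|\<^sup>2\<close> consist of further such quotients, of \<open>\<partial>f\<close> and, twice over, of
\<open>x\<^sub>l f\<close>; all of them vanish near the origin, so the induction closes.\<close>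
lemma schwartz_upto_div_norm_sq:
  fixes f :: "real^'n::finite \<Rightarrow> complex"
  assumes e: "e > 0"
  shows "schwartz_upto n f \<Longrightarrow> (\<And>x. norm x < e \<Longrightarrow> f x = 0) \<Longrightarrow>
    schwartz_upto n (\<lambda>x. of_real (1 / (norm x)\<^sup>2) * f x)"
proof (induction n arbitrary: f)
  case 0
  have near0: "((\<lambda>x. of_real (1 / (norm x)\<^sup>2) * f x) has_derivative (\<lambda>h. 0)) (at 0)"
  proof (rule has_derivative_transform_within_open[of "\<lambda>x. 0" _ _ _ "ball 0 e"])
    show "0 = of_real (1 / (norm x)\<^sup>2) * f x" if "x \<in> ball 0 e" for x
      using that 0(2)[of x] by simp
  qed (use e in auto)
  have d: "(\<lambda>x. of_real (1 / (norm x)\<^sup>2) * f x) differentiable (at x)" for x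
  proof (cases "x = 0")
    case True
    then show ?thesis using near0 differentiableI by blast
  next
    case False
    have "((\<lambda>x. 1 / (x \<bullet> x)) has_derivative (\<lambda>h. - 2 * (x \<bullet> h) / (x \<bullet> x)\<^sup>2)) (at x)"
      using False by (auto intro!: derivative_eq_intros
          simp: fun_eq_iff inner_commute power2_eq_square field_simps)
    from differentiableI[OF has_derivative_mult[OF has_derivative_of_real[OF this]
          schwartz_upto_0_derivative[OF 0(1)]]]
    have "(\<lambda>x. complex_of_real (1 / (x \<bullet> x)) * f x) differentiable (at x)" .
    then show ?thesis by (simp add: power2_norm_eq_inner)
  qed
  have le: "norm (of_real (1 / (norm x)\<^sup>2) * f x) \<le> (1 / e\<^sup>2) * (1 + norm x) ^ 0 * norm (f x)" for x
  proof (cases "norm x < e")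
    case True
    then show ?thesis using 0(2) by simp
  next
    case False
    then have "0 < norm x" using e by linarith
    then have "1 / (norm x)\<^sup>2 \<le> 1 / e\<^sup>2" using e False
      by (intro divide_left_mono power_mono mult_pos_pos zero_less_power) auto
    then have "(1 / (norm x)\<^sup>2) * norm (f x) \<le> (1 / e\<^sup>2) * norm (f x)"
      by (rule mult_right_mono) simp
    moreover have "norm (of_real (1 / (norm x)\<^sup>2) * f x) = (1 / (norm x)\<^sup>2) * norm (f x)"
      unfolding norm_mult norm_of_real by simp
    ultimately show ?thesis by simp
  qed
  show ?case by (rule schwartz_upto_0_dominated[OF 0(1) d le]) simp
next
  case (Suc n)
  have 0: "schwartz_upto 0 f" using Suc.prems(1) by simp
  have n: "schwartz_upto n f" by (rule schwartz_upto_Suc_imp[OF Suc.prems(1)])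
  have p0: "partial l f x = 0" if "norm x < e" for x l
  proof -
    have "(f has_derivative (\<lambda>h. 0)) (at x)"
      by (rule has_derivative_transform_within_open[of "\<lambda>x. 0" _ _ _ "ball 0 e"])
        (use that Suc.prems(2) in auto)
    then show ?thesis by (simp add: partial_eqI)
  qed
  let ?q = "\<lambda>f x. of_real (1 / (norm x)\<^sup>2) * (f x :: complex)"
  show ?case
  proof (rule schwartz_upto_SucI)
    show "schwartz_upto 0 (?q f)"
      by (rule schwartz_upto_0[OF Suc.IH[OF n Suc.prems(2)]])
    show "partial l (?q f) =
        (\<lambda>x. ?q (partial l f) x + ?q (?q (\<lambda>x. (-2) * (of_real (x $ l) * f x))) x)" for l
    proof
      fix x :: "real^'n"
      show "partial l (?q f) x = ?q (partial l f) x + ?q (?q (\<lambda>x. (-2) * (of_real (x $ l) * f x))) x"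
      proof (cases "norm x < e")
        case True
        have "(?q f has_derivative (\<lambda>h. 0)) (at x)"
          by (rule has_derivative_transform_within_open[of "\<lambda>x. 0" _ _ _ "ball 0 e"])
            (use True Suc.prems(2) in auto)
        then show ?thesis using True Suc.prems(2) p0 by (simp add: partial_eqI)
      next
        case False
        then have x: "x \<bullet> x \<noteq> 0" using e by auto
        have "((\<lambda>x. 1 / (x \<bullet> x)) has_derivative (\<lambda>h. - 2 * (x \<bullet> h) / (x \<bullet> x)\<^sup>2)) (at x)"
          using x by (auto intro!: derivative_eq_intros simp: fun_eq_iff inner_commute power2_eq_square field_simps)
        from has_derivative_mult[OF has_derivative_of_real[OF this] schwartz_upto_0_derivative[OF 0]]
        have "partial l (\<lambda>x. complex_of_real (1 / (x \<bullet> x)) * f x) x =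
           of_real (1 / (x \<bullet> x)) * partial l f x + of_real (- 2 * (x $ l) / (x \<bullet> x)\<^sup>2) * f x"
          by (subst partial_eqI, assumption) (simp add: partial_def inner_axis)
        moreover have "of_real (1 / d) * p + of_real (- 2 * c / d\<^sup>2) * F =
            of_real (1 / d) * p + of_real (1 / d) * (of_real (1 / d) * ((-2) * (of_real c * F)))"
          for d c :: real and p F :: complex
          by (simp add: power2_eq_square)
        ultimately show ?thesis unfolding power2_norm_eq_inner by simp
      qed
    qed
    show "schwartz_upto n (\<lambda>x. ?q (partial l f) x + ?q (?q (\<lambda>x. (-2) * (of_real (x $ l) * f x))) x)" for l
      by (intro schwartz_upto_add Suc.IH schwartz_upto_cmult schwartz_upto_coord_mult n)
        (use Suc.prems p0 in simp_all)
  qed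
qed

section \<open>Integrability under polynomial decay\<close>

text \<open>Lebesgue measure on \<open>real^'n\<close> is the image of a product measure indexed by the standard basis;
reindexing by coordinates gives Fubini for functions with separated variables.\<close>
lemma lborel_vec_prod:
  fixes f :: "'n::finite \<Rightarrow> real \<Rightarrow> complex"
  assumes f: "\<And>i. integrable lborel (f i)"
  shows "integrable lborel (\<lambda>x::real^'n. \<Prod>i\<in>UNIV. f i (x $ i))" (is ?A)
    and "integral\<^sup>L lborel (\<lambda>x::real^'n. \<Prod>i\<in>UNIV. f i (x $ i)) = (\<Prod>i\<in>UNIV. integral\<^sup>L lborel (f i))" (is ?B)
proof -
  let ?b = "\<lambda>i::'n. axis i (1::real)"
  define idx where "idx = inv ?b"
  have inj: "inj ?b" by (auto simp: inj_def axis_eq_axis)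
  have Basis: "(Basis :: (real^'n) set) = range ?b" by (auto simp: Basis_vec_def)
  have bij: "bij_betw ?b UNIV Basis" using inj by (simp add: bij_betw_def Basis)
  have idx: "idx (?b i) = i" for i unfolding idx_def by (rule inv_f_f[OF inj])
  let ?M = "\<Pi>\<^sub>M b\<in>(Basis :: (real^'n) set). (lborel :: real measure)"
  let ?s = "\<lambda>g :: real^'n \<Rightarrow> real. \<Sum>b\<in>Basis. g b *\<^sub>R b"
  interpret product_sigma_finite "\<lambda>_::real^'n. lborel :: real measure"
    by standard
  have [measurable]: "f i \<in> borel_measurable borel" for i
    using borel_measurable_integrable[OF f] by simp
  have meas: "(\<lambda>x::real^'n. \<Prod>i\<in>UNIV. f i (x $ i)) \<in> borel_measurable borel"
    by measurable
  have smeas: "?s \<in> measurable ?M borel" by measurable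
  have eq: "(\<Prod>i\<in>UNIV. f i (?s g $ i)) = (\<Prod>b\<in>Basis. f (idx b) (g b))" for g :: "real^'n \<Rightarrow> real"
  proof -
    have "?s g $ i = g (?b i)" for i
    proof -
      have "?s g $ i = (\<Sum>b\<in>Basis. g b *\<^sub>R b) \<bullet> ?b i" by (simp add: inner_axis)
      also have "\<dots> = g (?b i)" using Basis by (subst inner_sum_left_Basis) auto
      finally show ?thesis .
    qed
    then have "(\<Prod>i\<in>UNIV. f i (?s g $ i)) = (\<Prod>i\<in>UNIV. f (idx (?b i)) (g (?b i)))"
      by (simp add: idx)
    also have "\<dots> = (\<Prod>b\<in>Basis. f (idx b) (g b))"
      by (rule prod.reindex_bij_betw[OF bij])
    finally show ?thesis .
  qed
  have int: "integrable ?M (\<lambda>g. \<Prod>b\<in>Basis. f (idx b) (g b))"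
    by (rule product_integrable_prod) (use f in auto)
  show ?A unfolding lborel_eq[where 'a="real^'n"]
    by (subst integrable_distr_eq[OF smeas meas]) (simp only: eq int)
  have "integral\<^sup>L lborel (\<lambda>x::real^'n. \<Prod>i\<in>UNIV. f i (x $ i)) = (LINT g|?M. (\<Prod>i\<in>UNIV. f i (?s g $ i)))"
    unfolding lborel_eq[where 'a="real^'n"] by (rule integral_distr[OF smeas meas])
  also have "\<dots> = (\<Prod>b\<in>Basis. integral\<^sup>L lborel (f (idx b)))"
    unfolding eq by (rule product_integral_prod) (use f in auto)
  also have "\<dots> = (\<Prod>i\<in>UNIV. integral\<^sup>L lborel (f (idx (?b i))))"
    by (rule prod.reindex_bij_betw[OF bij, symmetric])
  finally show ?B by (simp add: idx)
qed

text \<open>As \<open>1 + x\<^sub>i\<^sup>2 \<le> (1 + |x|)\<^sup>2\<close> in each coordinate, the weight is dominated by a product of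
one-dimensional Cauchy densities.\<close>
lemma integrable_polynomial_decay:
  "integrable lborel (\<lambda>x::real^'n::finite. 1 / (1 + norm x) ^ (2 * CARD('n)))"
proof -
  have 1: "integrable lborel (\<lambda>t::real. complex_of_real (inverse (1 + t\<^sup>2)))"
    by (rule integrable_of_real)
      (use integrable_inverse_1_plus_square in \<open>simp add: set_integrable_def\<close>)
  have 2: "integrable lborel (\<lambda>x::real^'n. \<Prod>i\<in>UNIV. complex_of_real (inverse (1 + (x $ i)\<^sup>2)))"
    by (rule lborel_vec_prod(1)[OF 1])
  show ?thesis
  proof (rule Bochner_Integration.integrable_bound[OF 2], measurable, rule AE_I2)
    fix x :: "real^'n"
    have "(\<Prod>i\<in>UNIV. 1 + (x $ i)\<^sup>2) \<le> (\<Prod>i\<in>(UNIV::'n set). (1 + norm x)\<^sup>2)"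
    proof (intro prod_mono conjI)
      fix i
      have "(x $ i)\<^sup>2 \<le> (norm x)\<^sup>2"
        using component_le_norm_cart[of x i] by (intro abs_le_square_iff[THEN iffD1]) simp
      also have "1 + (norm x)\<^sup>2 \<le> (1 + norm x)\<^sup>2" by (simp add: power2_eq_square algebra_simps)
      finally show "1 + (x $ i)\<^sup>2 \<le> (1 + norm x)\<^sup>2" by linarith
    qed simp
    also have "\<dots> = (1 + norm x) ^ (2 * CARD('n))" by (simp add: power_mult)
    finally have le: "(\<Prod>i\<in>UNIV. 1 + (x $ i)\<^sup>2) \<le> (1 + norm x) ^ (2 * CARD('n))" .
    have pos: "(\<Prod>i\<in>UNIV. 1 + (x $ i)\<^sup>2) > 0"
      by (intro prod_pos) (auto intro: add_pos_nonneg)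
    have "1 / (1 + norm x) ^ (2 * CARD('n)) \<le> 1 / (\<Prod>i\<in>UNIV. 1 + (x $ i)\<^sup>2)"
      using le pos by (intro divide_left_mono mult_pos_pos) (auto intro: add_pos_nonneg)
    also have "\<dots> = norm (\<Prod>i\<in>UNIV. complex_of_real (inverse (1 + (x $ i)\<^sup>2)))"
      by (simp add: prod_norm[symmetric] norm_inverse prod_inversef[symmetric] divide_inverse
          del: of_real_add of_real_inverse of_real_power)
    finally show "norm (1 / (1 + norm x) ^ (2 * CARD('n)))
        \<le> norm (\<Prod>i\<in>UNIV. complex_of_real (inverse (1 + (x $ i)\<^sup>2)))" by simp
  qed
qed

lemma schwartz_upto_0_measurable:
  fixes f :: "real^'n::finite \<Rightarrow> complex"
  assumes "schwartz_upto 0 f" shows "f \<in> borel_measurable borel"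
  using assms by (intro borel_measurable_continuous_onI)
    (auto simp: continuous_on_eq_continuous_at intro: differentiable_imp_continuous_within)

lemma integrable_of_decay:
  fixes f :: "real^'n::finite \<Rightarrow> 'b::{banach,second_countable_topology}"
  assumes m: "f \<in> borel_measurable lborel"
    and B: "\<And>x. (1 + norm x) ^ (2 * CARD('n)) * norm (f x) \<le> B"
  shows "integrable lborel f"
proof (rule Bochner_Integration.integrable_bound[OF _ m])
  show "integrable lborel (\<lambda>x::real^'n. B * (1 / (1 + norm x) ^ (2 * CARD('n))))"
    by (intro integrable_mult_right integrable_polynomial_decay)
  show "AE x in lborel. norm (f x) \<le> norm (B * (1 / (1 + norm x) ^ (2 * CARD('n))))"
  proof (rule AE_I2)
    fix x :: "real^'n"
    have p: "(1 + norm x) ^ (2 * CARD('n)) > 0" by (intro zero_less_power add_pos_nonneg) auto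
    have "norm (f x) \<le> B / (1 + norm x) ^ (2 * CARD('n))"
      using B[of x] p by (simp add: field_simps)
    also have "\<dots> \<le> \<bar>B\<bar> / (1 + norm x) ^ (2 * CARD('n))"
      using p by (intro divide_right_mono) auto
    also have "\<dots> = norm (B * (1 / (1 + norm x) ^ (2 * CARD('n))))" using p by (simp add: abs_mult)
    finally show "norm (f x) \<le> norm (B * (1 / (1 + norm x) ^ (2 * CARD('n))))" .
  qed
qed

lemma schwartz_upto_0_weighted_integrable:
  fixes f :: "real^'n::finite \<Rightarrow> complex"
  assumes "schwartz_upto 0 f"
  shows "integrable lborel (\<lambda>x. (1 + norm x) ^ l * norm (f x))"
proof -
  have [measurable]: "f \<in> borel_measurable borel" by (rule schwartz_upto_0_measurable[OF assms])
  obtain B where "\<And>x. (1 + norm x) ^ (2 * CARD('n) + l) * norm (f x) \<le> B"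
    using schwartz_upto_0_decay[OF assms] by metis
  then show ?thesis
    by (intro integrable_of_decay[where B=B]) (auto simp: power_add mult.assoc)
qed

lemma schwartz_upto_0_integrable:
  fixes f :: "real^'n::finite \<Rightarrow> complex"
  assumes "schwartz_upto 0 f"
  shows "integrable lborel f"
proof -
  have "f \<in> borel_measurable lborel" using schwartz_upto_0_measurable[OF assms] by simp
  moreover obtain B where "\<And>x. (1 + norm x) ^ (2 * CARD('n)) * norm (f x) \<le> B"
    using schwartz_upto_0_decay[OF assms] by metis
  ultimately show ?thesis by (rule integrable_of_decay)
qed

section \<open>The Fourier transform of a Schwartz function\<close>

lemma cis_measurable [measurable]: "cis \<in> borel_measurable borel"
  by (intro borel_measurable_continuous_onI continuous_intros)

lemma integrable_cis_mult:
  fixes f :: "real^'n::finite \<Rightarrow> complex"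
  assumes "integrable lborel f" "g \<in> borel_measurable borel"
  shows "integrable lborel (\<lambda>x. cis (g x) * f x)"
  by (rule Bochner_Integration.integrable_bound[OF assms(1)])
    (use assms(2) borel_measurable_integrable[OF assms(1)] in \<open>auto simp: norm_mult\<close>)

lemma integrable_fourier_integrand:
  fixes f :: "real^'n::finite \<Rightarrow> complex"
  assumes "integrable lborel f"
  shows "integrable lborel (\<lambda>x. cis (- (x \<bullet> \<xi>)) * f x)"
  by (rule integrable_cis_mult[OF assms]) simp

lemma cis_taylor_2: "norm (cis (b + t) - cis b - \<i> * of_real t * cis b) \<le> t\<^sup>2"
proof -
  have "norm (iexp t - (\<Sum>k\<le>1. (\<i> * t)^k / fact k)) \<le> \<bar>t\<bar>^(Suc 1) / fact (Suc 1)"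
    by (rule iexp_approx1)
  then have "norm (cis t - (1 + \<i> * t)) \<le> t\<^sup>2 / 2"
    by (simp add: cis_conv_exp numeral_2_eq_2[symmetric])
  moreover have "cis (b + t) - cis b - \<i> * of_real t * cis b = cis b * (cis t - (1 + \<i> * t))"
    by (simp add: cis_mult[symmetric] algebra_simps)
  ultimately have "norm (cis (b + t) - cis b - \<i> * of_real t * cis b) \<le> t\<^sup>2 / 2"
    by (simp add: norm_mult)
  also have "\<dots> \<le> t\<^sup>2" by simp
  finally show ?thesis .
qed

text \<open>The second order Taylor remainder of the character is at most \<open>|h|\<^sup>2 |x|\<^sup>2\<close>, and second moments
of \<open>f\<close> are finite.\<close>
lemma fourier_has_derivative:
  fixes f :: "real^'n::finite \<Rightarrow> complex"
  assumes f: "schwartz_upto 0 f"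
  shows "(fourier f has_derivative
     (\<lambda>h. \<Sum>i\<in>UNIV. of_real (h $ i) * fourier (\<lambda>x. - \<i> * (of_real (x $ i) * f x)) \<xi>)) (at \<xi>)"
    (is "(_ has_derivative ?D) _")
proof -
  have fi: "integrable lborel f" by (rule schwartz_upto_0_integrable[OF f])
  have ci: "integrable lborel (\<lambda>x. - \<i> * (of_real (x $ i) * f x))" for i
    by (intro schwartz_upto_0_integrable schwartz_upto_cmult schwartz_upto_coord_mult f)
  have D: "?D h = (LINT x|lborel. cis (- (x \<bullet> \<xi>)) * (- \<i> * of_real (x \<bullet> h) * f x))"
    and Di: "integrable lborel (\<lambda>x. cis (- (x \<bullet> \<xi>)) * (- \<i> * of_real (x \<bullet> h) * f x))" for h
  proof -
    have eq: "cis (- (x \<bullet> \<xi>)) * (- \<i> * of_real (x \<bullet> h) * f x) =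
        (\<Sum>i\<in>UNIV. of_real (h $ i) * (cis (- (x \<bullet> \<xi>)) * (- \<i> * (of_real (x $ i) * f x))))" for x
      by (simp add: inner_vec_def sum_distrib_left sum_distrib_right mult_ac)
    have i: "integrable lborel (\<lambda>x. of_real (h $ i) * (cis (- (x \<bullet> \<xi>)) * (- \<i> * (of_real (x $ i) * f x))))" for i
      by (intro integrable_mult_right integrable_fourier_integrand ci)
    show "?D h = (LINT x|lborel. cis (- (x \<bullet> \<xi>)) * (- \<i> * of_real (x \<bullet> h) * f x))"
      unfolding eq fourier_def
      by (subst Bochner_Integration.integral_sum[OF i]) (simp only: integral_mult_right_zero)
    show "integrable lborel (\<lambda>x. cis (- (x \<bullet> \<xi>)) * (- \<i> * of_real (x \<bullet> h) * f x))"
      unfolding eq by (intro Bochner_Integration.integrable_sum i)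
  qed
  define C where "C = (LINT x|lborel. (1 + norm x) ^ 2 * norm (f x))"
  have wi: "integrable lborel (\<lambda>x. (1 + norm x) ^ 2 * norm (f x))"
    by (rule schwartz_upto_0_weighted_integrable[OF f])
  show ?thesis
  proof (rule has_derivativeI_sandwich[of 1])
    show "bounded_linear ?D"
      by (intro bounded_linear_sum bounded_linear_compose[OF bounded_linear_mult_left]
          bounded_linear_compose[OF bounded_linear_of_real bounded_linear_vec_nth])
    show "((\<lambda>y. C * norm (y - \<xi>)) \<longlongrightarrow> 0) (at \<xi>)"
      by (auto intro!: tendsto_eq_intros)
    fix y :: "real^'n" assume "y \<noteq> \<xi>"
    define h where "h = y - \<xi>"
    have y: "y = \<xi> + h" by (simp add: h_def)
    have "fourier f y - fourier f \<xi> - ?D h =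
      (LINT x|lborel. (cis (- (x \<bullet> y)) * f x - cis (- (x \<bullet> \<xi>)) * f x) - cis (- (x \<bullet> \<xi>)) * (- \<i> * of_real (x \<bullet> h) * f x))"
      unfolding D unfolding fourier_def
      by (simp only: Bochner_Integration.integral_diff Bochner_Integration.integrable_diff
          integrable_fourier_integrand[OF fi] Di)
    also have "norm \<dots> \<le> (LINT x|lborel. (norm h)\<^sup>2 * ((1 + norm x) ^ 2 * norm (f x)))"
    proof (rule Bochner_Integration.integral_norm_bound_integral)
      show "integrable lborel (\<lambda>x. (norm h)\<^sup>2 * ((1 + norm x) ^ 2 * norm (f x)))"
        by (intro integrable_mult_right wi)
      show "integrable lborel (\<lambda>x. (cis (- (x \<bullet> y)) * f x - cis (- (x \<bullet> \<xi>)) * f x) - cis (- (x \<bullet> \<xi>)) * (- \<i> * of_real (x \<bullet> h) * f x))"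
        by (intro Bochner_Integration.integrable_diff integrable_fourier_integrand fi Di)
      fix x :: "real^'n"
      have "(cis (- (x \<bullet> y)) * f x - cis (- (x \<bullet> \<xi>)) * f x) - cis (- (x \<bullet> \<xi>)) * (- \<i> * of_real (x \<bullet> h) * f x)
         = (cis (- (x \<bullet> \<xi>) + (- (x \<bullet> h))) - cis (- (x \<bullet> \<xi>)) - \<i> * of_real (- (x \<bullet> h)) * cis (- (x \<bullet> \<xi>))) * f x"
        by (simp add: y inner_add_right algebra_simps)
      also have "norm \<dots> \<le> (- (x \<bullet> h))\<^sup>2 * norm (f x)"
        unfolding norm_mult by (intro mult_right_mono cis_taylor_2) simp
      also have "(- (x \<bullet> h))\<^sup>2 \<le> (norm h)\<^sup>2 * (1 + norm x)\<^sup>2"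
      proof -
        have "\<bar>x \<bullet> h\<bar> \<le> norm x * norm h" by (rule Cauchy_Schwarz_ineq2)
        also have "\<dots> \<le> norm h * (1 + norm x)" by (simp add: algebra_simps)
        finally have "\<bar>x \<bullet> h\<bar> ^ 2 \<le> (norm h * (1 + norm x))\<^sup>2" by (intro power_mono) auto
        then show ?thesis by (simp add: power_mult_distrib)
      qed
      finally show "norm ((cis (- (x \<bullet> y)) * f x - cis (- (x \<bullet> \<xi>)) * f x) - cis (- (x \<bullet> \<xi>)) * (- \<i> * of_real (x \<bullet> h) * f x))
          \<le> (norm h)\<^sup>2 * ((1 + norm x) ^ 2 * norm (f x))"
        by (simp add: mult_right_mono mult.assoc)
    qed
    also have "\<dots> = (norm h)\<^sup>2 * C" by (simp add: C_def)
    finally have "norm (fourier f y - fourier f \<xi> - ?D h) \<le> (norm h)\<^sup>2 * C" .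
    then show "norm (fourier f y - fourier f \<xi> - ?D (y - \<xi>)) / norm (y - \<xi>) \<le> C * norm (y - \<xi>)"
      using \<open>y \<noteq> \<xi>\<close> by (simp add: h_def[symmetric] divide_le_eq power2_eq_square mult_ac)
  qed simp
qed

lemma partial_fourier:
  fixes f :: "real^'n::finite \<Rightarrow> complex"
  assumes f: "schwartz_upto 0 f"
  shows "partial l (fourier f) = fourier (\<lambda>x. - \<i> * (of_real (x $ l) * f x))"
proof
  fix \<xi> :: "real^'n"
  show "partial l (fourier f) \<xi> = fourier (\<lambda>x. - \<i> * (of_real (x $ l) * f x)) \<xi>"
    by (subst partial_eqI[OF fourier_has_derivative[OF f]])
      (simp add: axis_def if_distrib[of "\<lambda>c. complex_of_real c * _"] cong: if_cong)
qed

lemma lborel_translate: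
  fixes f :: "'a::euclidean_space \<Rightarrow> 'b::{banach,second_countable_topology}"
  assumes "f \<in> borel_measurable borel"
  shows "integrable lborel (\<lambda>x. f (a + x)) \<longleftrightarrow> integrable lborel f"
    and "(LINT x|lborel. f (a + x)) = integral\<^sup>L lborel f"
proof -
  have m: "(\<lambda>x. a + x) \<in> measurable lborel borel" by measurable
  show "integrable lborel (\<lambda>x. f (a + x)) \<longleftrightarrow> integrable lborel f"
    using integrable_distr_eq[OF m assms] by (simp add: lborel_distr_plus)
  show "(LINT x|lborel. f (a + x)) = integral\<^sup>L lborel f"
    using integral_distr[OF m assms] by (simp add: lborel_distr_plus)
qed

text \<open>Every difference quotient of \<open>f\<close> has integral \<open>0\<close> by translation invariance, and the quotients
converge to the partial derivative under an integrable bound from the mean value theorem.\<close>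
lemma integral_partial_eq_0:
  fixes f :: "real^'n::finite \<Rightarrow> complex"
  assumes f: "schwartz_upto (Suc 0) f"
  shows "(LINT x|lborel. partial l f x) = 0"
proof -
  have f0: "schwartz_upto 0 f" and p0: "schwartz_upto 0 (partial l f)" using f by auto
  have [measurable]: "f \<in> borel_measurable borel" "partial l f \<in> borel_measurable borel"
    using schwartz_upto_0_measurable f0 p0 by auto
  define e where "e = axis l (1::real)"
  have ne: "norm e = 1" by (simp add: e_def)
  let ?k = "2 * CARD('n)"
  obtain B where B: "B \<ge> 0" "\<And>x. (1 + norm x) ^ ?k * norm (partial l f x) \<le> B"
    using schwartz_upto_0_decay[OF p0] by metis
  have D: "((\<lambda>t. f (x + t *\<^sub>R e)) has_vector_derivative partial l f (x + t *\<^sub>R e)) (at t within S)" for x t S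
  proof -
    have "((\<lambda>t. x + t *\<^sub>R e) has_derivative (\<lambda>h. h *\<^sub>R e)) (at t)"
      by (auto intro!: derivative_eq_intros)
    from diff_chain_at[OF this schwartz_upto_0_derivative[OF f0]]
    have "((\<lambda>t. f (x + t *\<^sub>R e)) has_derivative (\<lambda>h. frechet_derivative f (at (x + t *\<^sub>R e)) (h *\<^sub>R e))) (at t)"
      by (simp add: o_def)
    moreover have "linear (frechet_derivative f (at (x + t *\<^sub>R e)))"
      using schwartz_upto_0_derivative[OF f0] has_derivative_linear by blast
    ultimately have "((\<lambda>t. f (x + t *\<^sub>R e)) has_vector_derivative partial l f (x + t *\<^sub>R e)) (at t)"
      by (simp add: has_vector_derivative_def linear_scale partial_def e_def)
    then show ?thesis by (rule has_vector_derivative_at_within)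
  qed
  define h where "h m = 1 / real (Suc m)" for m
  have h: "0 < h m" "h m \<le> 1" for m by (auto simp: h_def)
  have h0: "h \<longlonglongrightarrow> 0" unfolding h_def by (rule LIMSEQ_Suc[OF lim_1_over_n])
  define d where "d m x = (f (x + h m *\<^sub>R e) - f x) /\<^sub>R h m" for m x
  have [measurable]: "d m \<in> borel_measurable borel" for m unfolding d_def by measurable
  have fi: "integrable lborel f" by (rule schwartz_upto_0_integrable[OF f0])
  have ti: "integrable lborel (\<lambda>x. f (x + h m *\<^sub>R e))" for m
    using lborel_translate(1)[of f "h m *\<^sub>R e"] fi by (simp add: add.commute)
  have d0: "integral\<^sup>L lborel (d m) = 0" for m
    using lborel_translate(2)[of f "h m *\<^sub>R e"] fi ti[of m]
    by (simp add: d_def[abs_def] add.commute)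
  have "(\<lambda>m. integral\<^sup>L lborel (d m)) \<longlonglongrightarrow> (LINT x|lborel. partial l f x)"
  proof (rule integral_dominated_convergence)
    show "integrable lborel (\<lambda>x::real^'n. (2 ^ ?k * B) * (1 / (1 + norm x) ^ ?k))"
      by (intro integrable_mult_right integrable_polynomial_decay)
    show "AE x in lborel. (\<lambda>m. d m x) \<longlonglongrightarrow> partial l f x"
    proof (rule AE_I2)
      fix x
      have "((\<lambda>t. norm (f (x + t *\<^sub>R e) - f x - t *\<^sub>R partial l f x) / norm t) \<longlongrightarrow> 0) (at 0)"
        using D[of x 0 UNIV] unfolding has_vector_derivative_def has_derivative_at by simp
      then have "((\<lambda>t. norm ((f (x + t *\<^sub>R e) - f x) /\<^sub>R t - partial l f x)) \<longlongrightarrow> 0) (at 0)"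
      proof (rule Lim_transform_eventually)
        have "norm (f (x + t *\<^sub>R e) - f x - t *\<^sub>R partial l f x) / norm t =
            norm ((f (x + t *\<^sub>R e) - f x) /\<^sub>R t - partial l f x)" if "t \<noteq> 0" for t
        proof -
          have "(f (x + t *\<^sub>R e) - f x) /\<^sub>R t - partial l f x =
              (f (x + t *\<^sub>R e) - f x - t *\<^sub>R partial l f x) /\<^sub>R t"
            using that by (simp add: scaleR_diff_right)
          then show ?thesis by (simp add: divide_inverse mult.commute)
        qed
        then show "\<forall>\<^sub>F t in at 0. norm (f (x + t *\<^sub>R e) - f x - t *\<^sub>R partial l f x) / norm t =
            norm ((f (x + t *\<^sub>R e) - f x) /\<^sub>R t - partial l f x)"
          by (auto simp: eventually_at_filter)
      qed
      then have lim: "((\<lambda>t. (f (x + t *\<^sub>R e) - f x) /\<^sub>R t) \<longlongrightarrow> partial l f x) (at 0)"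
        by (rule LIM_zero_cancel[OF tendsto_norm_zero_cancel])
      have "filterlim h (at 0) sequentially"
        unfolding filterlim_at using h0 h(1) by (auto intro!: always_eventually less_imp_neq[symmetric])
      from filterlim_compose[OF lim this] show "(\<lambda>m. d m x) \<longlonglongrightarrow> partial l f x"
        by (simp add: d_def)
    qed
    fix m
    show "AE x in lborel. norm (d m x) \<le> (2 ^ ?k * B) * (1 / (1 + norm x) ^ ?k)"
    proof (rule AE_I2)
      fix x :: "real^'n"
      have p: "(1 + norm x) ^ ?k > 0" by (intro zero_less_power add_pos_nonneg) auto
      \<comment> \<open>The step \<open>h m\<close> is at most \<open>1\<close>, so a shift along the segment costs at most a factor \<open>2\<close> in \<open>1 + |x|\<close>.\<close>
      have bd: "norm (partial l f (x + t *\<^sub>R e)) \<le> (2 ^ ?k * B) * (1 / (1 + norm x) ^ ?k)"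
        if "t \<in> {0..h m}" for t
      proof -
        have t: "0 \<le> t" "t \<le> 1" using that h[of m] by auto
        have "norm x \<le> norm (x + t *\<^sub>R e) + norm (t *\<^sub>R e)"
          by (metis add_diff_cancel_right' norm_triangle_ineq4)
        then have "norm x \<le> norm (x + t *\<^sub>R e) + t" using t ne by simp
        moreover have "0 \<le> norm (x + t *\<^sub>R e)" by simp
        ultimately have "1 + norm x \<le> 2 * (1 + norm (x + t *\<^sub>R e))" using t by argo
        then have "(1 + norm x) ^ ?k \<le> (2 * (1 + norm (x + t *\<^sub>R e))) ^ ?k" by (intro power_mono) auto
        then have "(1 + norm x) ^ ?k * norm (partial l f (x + t *\<^sub>R e)) \<le>
            (2 * (1 + norm (x + t *\<^sub>R e))) ^ ?k * norm (partial l f (x + t *\<^sub>R e))"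
          by (rule mult_right_mono) simp
        also have "\<dots> = 2 ^ ?k * ((1 + norm (x + t *\<^sub>R e)) ^ ?k * norm (partial l f (x + t *\<^sub>R e)))"
          by (simp only: power_mult_distrib mult.assoc)
        also have "\<dots> \<le> 2 ^ ?k * B" by (intro mult_left_mono B(2)) auto
        finally show ?thesis using p by (simp add: field_simps)
      qed
      have mvt: "norm (f (x + h m *\<^sub>R e) - f (x + 0 *\<^sub>R e)) \<le> (2 ^ ?k * B) * (1 / (1 + norm x) ^ ?k) * norm (h m - 0)"
      proof (rule differentiable_bound[of "{0..h m}" _ "\<lambda>t s. s *\<^sub>R partial l f (x + t *\<^sub>R e)"])
        show "((\<lambda>t. f (x + t *\<^sub>R e)) has_derivative (\<lambda>s. s *\<^sub>R partial l f (x + t *\<^sub>R e))) (at t within {0..h m})" for t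
          using D unfolding has_vector_derivative_def .
        show "onorm (\<lambda>s. s *\<^sub>R partial l f (x + t *\<^sub>R e)) \<le> (2 ^ ?k * B) * (1 / (1 + norm x) ^ ?k)"
          if "t \<in> {0..h m}" for t
        proof (rule onorm_bound)
          show "norm (s *\<^sub>R partial l f (x + t *\<^sub>R e)) \<le> (2 ^ ?k * B) * (1 / (1 + norm x) ^ ?k) * norm s" for s
            using mult_left_mono[OF bd[OF that], of "norm s"] by (simp add: mult_ac)
        qed (use B p in simp)
      qed (use h[of m] in auto)
      show "norm (d m x) \<le> (2 ^ ?k * B) * (1 / (1 + norm x) ^ ?k)"
      proof -
        have "norm (d m x) = norm (f (x + h m *\<^sub>R e) - f x) / h m"
          using h[of m] by (simp add: d_def divide_inverse mult.commute)
        then show ?thesis using mvt h[of m]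
          by (simp add: pos_divide_le_eq)
      qed
    qed
  qed measurable
  then show ?thesis unfolding d0 by (simp add: LIMSEQ_const_iff)
qed

text \<open>The total derivative of \<open>x \<mapsto> cis (- x \<bullet> \<xi>) f x\<close> integrates to \<open>0\<close>.\<close>
lemma fourier_partial:
  fixes f :: "real^'n::finite \<Rightarrow> complex"
  assumes f: "schwartz_upto (Suc 0) f"
  shows "fourier (partial l f) \<xi> = \<i> * of_real (\<xi> $ l) * fourier f \<xi>"
proof -
  have f0: "schwartz_upto 0 f" and p0: "schwartz_upto 0 (partial l f)" using f by auto
  have eq: "partial l (\<lambda>x. cis ((-\<xi>) \<bullet> x) * f x) x =
     cis (- (x \<bullet> \<xi>)) * partial l f x - \<i> * of_real (\<xi> $ l) * (cis (- (x \<bullet> \<xi>)) * f x)" for x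
    by (subst partial_eqI[OF has_derivative_mult[OF has_derivative_cis_inner
            schwartz_upto_0_derivative[OF f0]]])
      (simp add: partial_def inner_axis algebra_simps inner_commute)
  have i1: "integrable lborel (\<lambda>x. cis (- (x \<bullet> \<xi>)) * partial l f x)"
    by (intro integrable_fourier_integrand schwartz_upto_0_integrable[OF p0])
  have i2: "integrable lborel (\<lambda>x. \<i> * of_real (\<xi> $ l) * (cis (- (x \<bullet> \<xi>)) * f x))"
    by (intro integrable_mult_right integrable_fourier_integrand schwartz_upto_0_integrable[OF f0])
  have "0 = (LINT x|lborel. partial l (\<lambda>x. cis ((-\<xi>) \<bullet> x) * f x) x)"
    by (rule integral_partial_eq_0[OF schwartz_upto_cis_mult[OF f], symmetric])
  also have "\<dots> = fourier (partial l f) \<xi> - \<i> * of_real (\<xi> $ l) * fourier f \<xi>"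
    unfolding eq fourier_def
    by (subst Bochner_Integration.integral_diff[OF i1 i2]) simp
  finally show ?thesis by simp
qed

lemma fourier_bounded:
  fixes f :: "real^'n::finite \<Rightarrow> complex"
  shows "norm (fourier f \<xi>) \<le> (LINT x|lborel. norm (f x))"
  unfolding fourier_def by (rule order_trans[OF integral_norm_bound]) (simp add: norm_mult)

text \<open>A factor \<open>\<xi>\<^sub>i\<close> turns the transform of \<open>f\<close> into that of \<open>\<partial>\<^sub>i f\<close>, so powers of \<open>1 + |\<xi>|\<close> are
absorbed one at a time.\<close>
lemma fourier_decay:
  fixes f :: "real^'n::finite \<Rightarrow> complex"
  assumes "schwartz f"
  shows "\<exists>B. \<forall>\<xi>. (1 + norm \<xi>) ^ k * norm (fourier f \<xi>) \<le> B"
  using assms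
proof (induction k arbitrary: f)
  case 0
  then show ?case using fourier_bounded[of f] by auto
next
  case (Suc k)
  have up: "schwartz_upto n f" for n using Suc.prems schwartz_iff_upto by blast
  have "schwartz (partial i f)" for i
    unfolding schwartz_iff_upto using up[of "Suc _"] by simp
  then have "\<exists>B. \<forall>\<xi>. (1 + norm \<xi>) ^ k * norm (fourier (partial i f) \<xi>) \<le> B" for i
    by (rule Suc.IH)
  then obtain B where B: "\<And>i \<xi>. (1 + norm \<xi>) ^ k * norm (fourier (partial i f) \<xi>) \<le> B i" by metis
  obtain A where A: "\<And>\<xi>. (1 + norm \<xi>) ^ k * norm (fourier f \<xi>) \<le> A" using Suc by metis
  have "(1 + norm \<xi>) ^ Suc k * norm (fourier f \<xi>) \<le> A + (\<Sum>i\<in>UNIV. B i)" for \<xi>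
  proof -
    have "(1 + norm \<xi>) ^ Suc k * norm (fourier f \<xi>) = (1 + norm \<xi>) ^ k * ((1 + norm \<xi>) * norm (fourier f \<xi>))"
      by simp
    also have "\<dots> \<le> (1 + norm \<xi>) ^ k * ((1 + (\<Sum>i\<in>UNIV. \<bar>\<xi> $ i\<bar>)) * norm (fourier f \<xi>))"
      by (intro mult_left_mono mult_right_mono add_left_mono norm_le_l1_cart) auto
    also have "\<dots> = (1 + norm \<xi>) ^ k * (norm (fourier f \<xi>) + (\<Sum>i\<in>UNIV. norm (fourier (partial i f) \<xi>)))"
      by (simp add: fourier_partial[OF up] norm_mult distrib_right sum_distrib_right)
    also have "\<dots> \<le> A + (\<Sum>i\<in>UNIV. B i)"
      unfolding distrib_left sum_distrib_left by (intro add_mono A sum_mono B)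
    finally show ?thesis .
  qed
  then show ?case by blast
qed

text \<open>Derivatives of the transform are transforms of \<open>x\<^sub>l f\<close>, again Schwartz, so the decay estimate
applies to derivatives of all orders.\<close>
theorem schwartz_fourier:
  fixes f :: "real^'n::finite \<Rightarrow> complex"
  assumes "schwartz f"
  shows "schwartz (fourier f)"
proof -
  have "schwartz_upto n (fourier f)" if "schwartz f" for n and f :: "real^'n \<Rightarrow> complex"
    using that
  proof (induction n arbitrary: f)
    case 0
    have up: "schwartz_upto 0 f" using 0 schwartz_iff_upto by blast
    have "fourier f differentiable (at x)" for x
      by (rule differentiableI[OF fourier_has_derivative[OF up]])
    with fourier_decay[OF 0] show ?case by simp
  next
    case (Suc n)
    have up: "schwartz_upto n f" for n using Suc.prems schwartz_iff_upto by blast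
    have "schwartz (\<lambda>x. - \<i> * (of_real (x $ l) * f x))" for l
      unfolding schwartz_iff_upto by (intro allI schwartz_upto_cmult schwartz_upto_coord_mult up)
    then have "schwartz_upto n (partial l (fourier f))" for l
      unfolding partial_fourier[OF up] by (rule Suc.IH)
    moreover have "schwartz_upto 0 (fourier f)"
      by (rule schwartz_upto_0[OF Suc.IH[OF Suc.prems]])
    ultimately show ?case by simp
  qed
  with assms show ?thesis unfolding schwartz_iff_upto[of "fourier f"] by blast
qed

section \<open>Fourier inversion\<close>

lemma lborel_affine_change:
  fixes f :: "'a::euclidean_space \<Rightarrow> 'b::{banach,second_countable_topology}"
  assumes r: "r > 0" and f: "f \<in> borel_measurable borel"
  shows "integrable lborel (\<lambda>x. f (a + r *\<^sub>R x)) \<longleftrightarrow> integrable lborel f" (is ?A)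
    and "integral\<^sup>L lborel f = r ^ DIM('a) *\<^sub>R (LINT x|lborel. f (a + r *\<^sub>R x))" (is ?B)
proof -
  let ?T = "\<lambda>x. a + r *\<^sub>R x"
  have T: "?T \<in> measurable lborel borel" by measurable
  have eq: "lborel = density (distr lborel borel ?T) (\<lambda>_. ennreal (r ^ DIM('a)))"
    using lborel_affine[of r a] r by simp
  have f': "f \<in> borel_measurable (distr lborel borel ?T)" using f by simp
  have m: "(\<lambda>x. r ^ DIM('a)) \<in> borel_measurable (distr lborel borel ?T)" by simp
  have "integrable lborel f \<longleftrightarrow> integrable (distr lborel borel ?T) (\<lambda>x. r ^ DIM('a) *\<^sub>R f x)"
    by (subst eq, subst integrable_density[OF f' m]) (use r in auto)
  also have "\<dots> \<longleftrightarrow> integrable (distr lborel borel ?T) f"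
  proof
    assume "integrable (distr lborel borel ?T) (\<lambda>x. r ^ DIM('a) *\<^sub>R f x)"
    from integrable_scaleR_right[OF this, of "1 / r ^ DIM('a)"]
    show "integrable (distr lborel borel ?T) f" using r by simp
  qed (rule integrable_scaleR_right)
  also have "\<dots> \<longleftrightarrow> integrable lborel (\<lambda>x. f (a + r *\<^sub>R x))"
    by (rule integrable_distr_eq[OF T f])
  finally show ?A by blast
  have "integral\<^sup>L lborel f = integral\<^sup>L (density (distr lborel borel ?T) (\<lambda>_. ennreal (r ^ DIM('a)))) f"
    using eq by simp
  also have "\<dots> = (LINT x|distr lborel borel ?T. r ^ DIM('a) *\<^sub>R f x)"
    by (rule integral_density[OF f' m]) (use r in auto)
  also have "\<dots> = r ^ DIM('a) *\<^sub>R (LINT x|distr lborel borel ?T. f x)"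
    by simp
  also have "(LINT x|distr lborel borel ?T. f x) = (LINT x|lborel. f (a + r *\<^sub>R x))"
    by (rule integral_distr[OF T f])
  finally show ?B .
qed

lemma nn_integral_lborel_affine_change:
  fixes f :: "'a::euclidean_space \<Rightarrow> ennreal"
  assumes r: "r > 0" and f: "f \<in> borel_measurable borel"
  shows "(\<integral>\<^sup>+x. f x \<partial>lborel) = ennreal (r ^ DIM('a)) * (\<integral>\<^sup>+x. f (a + r *\<^sub>R x) \<partial>lborel)"
proof -
  let ?T = "\<lambda>x. a + r *\<^sub>R x"
  have T: "?T \<in> measurable lborel borel" by measurable
  have eq: "lborel = density (distr lborel borel ?T) (\<lambda>_. ennreal (r ^ DIM('a)))"
    using lborel_affine[of r a] r by simp
  have "(\<integral>\<^sup>+x. f x \<partial>lborel) = (\<integral>\<^sup>+x. f x \<partial>density (distr lborel borel ?T) (\<lambda>_. ennreal (r ^ DIM('a))))"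
    using eq by simp
  also have "\<dots> = (\<integral>\<^sup>+x. ennreal (r ^ DIM('a)) * f x \<partial>distr lborel borel ?T)"
    by (subst nn_integral_density) (use f in auto)
  also have "\<dots> = ennreal (r ^ DIM('a)) * (\<integral>\<^sup>+x. f x \<partial>distr lborel borel ?T)"
    by (rule nn_integral_cmult) (use f in auto)
  also have "(\<integral>\<^sup>+x. f x \<partial>distr lborel borel ?T) = (\<integral>\<^sup>+x. f (a + r *\<^sub>R x) \<partial>lborel)"
    by (rule nn_integral_distr) (use f T in auto)
  finally show ?thesis .
qed

lemma schwartz_imp_upto: "schwartz f \<Longrightarrow> schwartz_upto n f"
  by (simp add: schwartz_iff_upto)

lemma integrable_pair_bound:
  fixes f :: "'a::euclidean_space \<Rightarrow> complex" and g :: "'b::euclidean_space \<Rightarrow> complex"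
    and k :: "'a \<times> 'b \<Rightarrow> complex"
  assumes f: "integrable lborel f" and g: "integrable lborel g"
    and k: "k \<in> borel_measurable (lborel \<Otimes>\<^sub>M lborel)"
    and le: "\<And>x y. norm (k (x, y)) \<le> norm (f x) * norm (g y)"
  shows "integrable (lborel \<Otimes>\<^sub>M lborel) k"
proof -
  have [measurable]: "f \<in> borel_measurable borel" "g \<in> borel_measurable borel"
    using f g by (auto dest: borel_measurable_integrable)
  have kx: "integrable lborel (\<lambda>y. k (x, y))" for x
  proof (rule Bochner_Integration.integrable_bound)
    show "integrable lborel (\<lambda>y. norm (f x) * norm (g y))"
      using g by (intro integrable_mult_right integrable_norm)
    show "(\<lambda>y. k (x, y)) \<in> borel_measurable lborel" using k by measurable
  qed (use le in \<open>auto simp: abs_mult\<close>)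
  show ?thesis
  proof (rule lborel_pair.Fubini_integrable[OF k])
    show "AE x in lborel. integrable lborel (\<lambda>y. k (x, y))" using kx by simp
    have "integrable lborel (\<lambda>x. norm (f x) * (LINT y|lborel. norm (g y)))"
      using f by (intro integrable_mult_left integrable_norm)
    then show "integrable lborel (\<lambda>x. LINT y|lborel. norm (k (x, y)))"
    proof (rule Bochner_Integration.integrable_bound)
      show "(\<lambda>x. LINT y|lborel. norm (k (x, y))) \<in> borel_measurable lborel"
        using k by measurable
      have bd: "norm (LINT y|lborel. norm (k (x, y))) \<le> norm (f x) * (LINT y|lborel. norm (g y))" for x
      proof -
        have "(LINT y|lborel. norm (k (x, y))) \<le> (LINT y|lborel. norm (f x) * norm (g y))"
          using kx g le by (intro integral_mono integrable_norm integrable_mult_right) auto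
        then show ?thesis by simp
      qed
      show "AE x in lborel. norm (LINT y|lborel. norm (k (x, y)))
          \<le> norm (norm (f x) * (LINT y|lborel. norm (g y)))"
        by (intro AE_I2 order_trans[OF bd]) simp
    qed
  qed
qed

definition gauss :: "real^'n::finite \<Rightarrow> real" where
  "gauss x = exp (- (norm x)\<^sup>2 / 2)"

lemma gauss_eq_prod: "complex_of_real (gauss x) = (\<Prod>i\<in>UNIV. complex_of_real (exp (- (x $ i)\<^sup>2 / 2)))"
proof -
  have "- (norm x)\<^sup>2 / 2 = (\<Sum>i\<in>UNIV. - (x $ i)\<^sup>2 / 2)"
    unfolding power2_norm_eq_inner inner_vec_def sum_divide_distrib sum_negf[symmetric]
    by (simp add: power2_eq_square)
  then show ?thesis unfolding gauss_def by (simp add: exp_sum)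
qed

lemma gauss_1:
  shows "integrable lborel (\<lambda>x::real. complex_of_real (exp (- x\<^sup>2 / 2)))"
    and "(LINT x|lborel. cis (- (x * t)) * complex_of_real (exp (- x\<^sup>2 / 2))) =
      of_real (sqrt (2 * pi) * exp (- t\<^sup>2 / 2))"
proof -
  have eq: "exp (- x\<^sup>2 / 2) = sqrt (2 * pi) * std_normal_density x" for x :: real
    by (simp add: std_normal_density_def)
  show "integrable lborel (\<lambda>x::real. complex_of_real (exp (- x\<^sup>2 / 2)))"
    unfolding eq by (intro integrable_of_real integrable_mult_right integrable_normal_density) simp
  have "of_real (exp (- (- t)\<^sup>2 / 2)) = char std_normal_distribution (- t)"
    by (simp add: char_std_normal_distribution)
  also have "\<dots> = (LINT x|lborel. std_normal_density x *\<^sub>R iexp (- t * x))"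
    unfolding char_def by (subst integral_density) (auto)
  also have "\<dots> = (LINT x|lborel. of_real (1 / sqrt (2 * pi)) * (cis (- (x * t)) * complex_of_real (exp (- x\<^sup>2 / 2))))"
    by (intro Bochner_Integration.integral_cong)
      (auto simp: std_normal_density_def scaleR_conv_of_real cis_conv_exp mult_ac)
  also have "\<dots> = of_real (1 / sqrt (2 * pi)) * (LINT x|lborel. (cis (- (x * t)) * complex_of_real (exp (- x\<^sup>2 / 2))))"
    by (rule integral_mult_right_zero)
  finally show "(LINT x|lborel. cis (- (x * t)) * complex_of_real (exp (- x\<^sup>2 / 2))) =
      of_real (sqrt (2 * pi) * exp (- t\<^sup>2 / 2))"
    by (simp add: field_simps)
qed

lemma integrable_gauss: "integrable lborel (\<lambda>x::real^'n::finite. complex_of_real (gauss x))"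
  unfolding gauss_eq_prod by (rule lborel_vec_prod(1)[OF gauss_1(1)])

lemma gauss_measurable [measurable]: "gauss \<in> borel_measurable borel"
  unfolding gauss_def[abs_def] by measurable

lemma fourier_gauss:
  "fourier (\<lambda>x::real^'n::finite. complex_of_real (gauss x)) \<xi> = of_real (sqrt (2 * pi) ^ CARD('n) * gauss \<xi>)"
proof -
  have cis: "cis (- (x \<bullet> \<xi>)) = (\<Prod>i\<in>UNIV. cis (- (x $ i * \<xi> $ i)))" for x
    by (simp add: cis_conv_exp inner_vec_def exp_sum[symmetric] sum_negf sum_distrib_left)
  have "integral\<^sup>L lborel (\<lambda>x::real^'n. \<Prod>i\<in>UNIV. cis (- (x $ i * \<xi> $ i)) * of_real (exp (- (x $ i)\<^sup>2 / 2))) =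
     (\<Prod>i\<in>UNIV. LINT t|lborel. cis (- (t * \<xi> $ i)) * of_real (exp (- t\<^sup>2 / 2)))"
  proof (rule lborel_vec_prod(2))
    show "integrable lborel (\<lambda>t. cis (- (t * \<xi> $ i)) * of_real (exp (- t\<^sup>2 / 2)))" for i
      by (rule Bochner_Integration.integrable_bound[OF gauss_1(1)]) (auto simp: norm_mult)
  qed
  moreover have "cis (- (x \<bullet> \<xi>)) * of_real (gauss x) =
      (\<Prod>i\<in>UNIV. cis (- (x $ i * \<xi> $ i)) * of_real (exp (- (x $ i)\<^sup>2 / 2)))" for x
    unfolding cis gauss_eq_prod prod.distrib ..
  moreover have "(\<Prod>i\<in>UNIV. complex_of_real (sqrt (2 * pi) * exp (- (\<xi> $ i)\<^sup>2 / 2))) =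
      of_real (sqrt (2 * pi) ^ CARD('n) * gauss \<xi>)"
    by (simp only: of_real_mult prod.distrib prod_constant gauss_eq_prod of_real_power)
  ultimately show ?thesis unfolding fourier_def gauss_1(2) by simp
qed

lemma integral_gauss:
  "(LINT x|lborel. complex_of_real (gauss (x::real^'n::finite))) = of_real (sqrt (2 * pi) ^ CARD('n))"
  using fourier_gauss[of 0] by (simp add: fourier_def gauss_def)

lemma fourier_gauss_dilated:
  assumes e: "e > 0"
  shows "fourier (\<lambda>\<xi>::real^'n::finite. cis (x \<bullet> \<xi>) * of_real (gauss (e *\<^sub>R \<xi>))) y =
    of_real ((1 / e) ^ CARD('n) * (sqrt (2 * pi) ^ CARD('n) * gauss ((1 / e) *\<^sub>R (y - x))))"
proof -
  let ?f = "\<lambda>\<xi>::real^'n. cis (- (\<xi> \<bullet> y)) * (cis (x \<bullet> \<xi>) * complex_of_real (gauss (e *\<^sub>R \<xi>)))"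
  have "fourier (\<lambda>\<xi>. cis (x \<bullet> \<xi>) * of_real (gauss (e *\<^sub>R \<xi>))) y = integral\<^sup>L lborel ?f"
    by (simp add: fourier_def)
  also have "\<dots> = (1 / e) ^ DIM(real^'n) *\<^sub>R (LINT \<xi>|lborel. ?f (0 + (1 / e) *\<^sub>R \<xi>))"
    by (rule lborel_affine_change(2)) (use e in auto)
  also have "(LINT \<xi>|lborel. ?f (0 + (1 / e) *\<^sub>R \<xi>)) =
      fourier (\<lambda>\<xi>. complex_of_real (gauss \<xi>)) ((1 / e) *\<^sub>R (y - x))"
    unfolding fourier_def using e
    by (intro Bochner_Integration.integral_cong refl)
      (simp add: mult.assoc[symmetric] cis_mult inner_diff_right diff_divide_distrib inner_commute)
  finally show ?thesis unfolding fourier_gauss by (simp add: scaleR_conv_of_real)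
qed

text \<open>Damping the inversion integral by the Gaussian \<open>gauss (h \<xi>)\<close> makes Fubini applicable and turns
it into an average of \<open>f\<close> around \<open>x\<close> against a Gaussian of width \<open>h\<close>. Letting \<open>h\<close> tend to \<open>0\<close> on both
sides gives the inversion formula, the normalisation being the mass \<open>(2 \<pi>)^(n/2)\<close> of the Gaussian,
which enters once through its transform and once through its integral.\<close>
theorem fourier_inversion:
  fixes f :: "real^'n::finite \<Rightarrow> complex"
  assumes f: "schwartz f"
  shows "inverse_fourier (fourier f) x = f x"
proof -
  note up = schwartz_imp_upto[OF f] and Fup = schwartz_imp_upto[OF schwartz_fourier[OF f]]
  note fi = schwartz_upto_0_integrable[OF up] and Fi = schwartz_upto_0_integrable[OF Fup]
  have [measurable]: "f \<in> borel_measurable borel" "fourier f \<in> borel_measurable borel"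
    by (rule schwartz_upto_0_measurable[OF up], rule schwartz_upto_0_measurable[OF Fup])
  define h where "h m = 1 / real (Suc m)" for m
  have h: "0 < h m" for m by (auto simp: h_def)
  have h0: "h \<longlonglongrightarrow> 0" unfolding h_def by (rule LIMSEQ_Suc[OF lim_1_over_n])
  let ?S = "sqrt (2 * pi) ^ CARD('n)"
  define A where "A m = (LINT \<xi>|lborel. of_real (gauss (h m *\<^sub>R \<xi>)) * (cis (x \<bullet> \<xi>) * fourier f \<xi>))" for m
  define G where "G m \<xi> = complex_of_real (gauss (h m *\<^sub>R \<xi>))" for m and \<xi> :: "real^'n"
  have Gi: "integrable lborel (G m)" for m
    using lborel_affine_change(1)[of "h m" "\<lambda>x::real^'n. complex_of_real (gauss x)" 0] h integrable_gauss
    by (simp add: G_def[abs_def])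
  have A: "A m = ?S * (LINT z|lborel. f (x + h m *\<^sub>R z) * of_real (gauss z))" for m
  proof -
    have "A m = (LINT \<xi>|lborel. (LINT y|lborel. G m \<xi> * cis (x \<bullet> \<xi>) * (cis (- (y \<bullet> \<xi>)) * f y)))"
      unfolding A_def by (intro Bochner_Integration.integral_cong refl)
        (simp only: fourier_def integral_mult_right_zero G_def mult.assoc)
    also have "\<dots> = (LINT y|lborel. (LINT \<xi>|lborel. G m \<xi> * cis (x \<bullet> \<xi>) * (cis (- (y \<bullet> \<xi>)) * f y)))"
    proof (rule lborel_pair.Fubini_integral)
      show "integrable (lborel \<Otimes>\<^sub>M lborel) (\<lambda>(y, \<xi>). G m \<xi> * cis (x \<bullet> \<xi>) * (cis (- (y \<bullet> \<xi>)) * f y))"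
        by (rule integrable_pair_bound[OF fi Gi[of m]]) (auto simp: G_def norm_mult)
    qed
    also have "\<dots> = (LINT y|lborel. f y * fourier (\<lambda>\<xi>. cis (x \<bullet> \<xi>) * of_real (gauss (h m *\<^sub>R \<xi>))) y)"
    proof (intro Bochner_Integration.integral_cong refl)
      fix y
      have "(LINT \<xi>|lborel. G m \<xi> * cis (x \<bullet> \<xi>) * (cis (- (y \<bullet> \<xi>)) * f y)) =
          (LINT \<xi>|lborel. f y * (cis (- (\<xi> \<bullet> y)) * (cis (x \<bullet> \<xi>) * of_real (gauss (h m *\<^sub>R \<xi>)))))"
        by (intro Bochner_Integration.integral_cong refl) (simp only: G_def inner_commute[of y] mult_ac)
      then show "(LINT \<xi>|lborel. G m \<xi> * cis (x \<bullet> \<xi>) * (cis (- (y \<bullet> \<xi>)) * f y)) =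
          f y * fourier (\<lambda>\<xi>. cis (x \<bullet> \<xi>) * of_real (gauss (h m *\<^sub>R \<xi>))) y"
        unfolding fourier_def integral_mult_right_zero .
    qed
    also have "\<dots> = (LINT y|lborel. f y * of_real ((1 / h m) ^ CARD('n) * (?S * gauss ((1 / h m) *\<^sub>R (y - x)))))"
      unfolding fourier_gauss_dilated[OF h] ..
    also have "\<dots> = h m ^ DIM(real^'n) *\<^sub>R (LINT z|lborel. f (x + h m *\<^sub>R z) * of_real ((1 / h m) ^ CARD('n) * (?S * gauss ((1 / h m) *\<^sub>R ((x + h m *\<^sub>R z) - x)))))"
      by (rule lborel_affine_change(2)) (use h in auto)
    also have "(\<lambda>z. f (x + h m *\<^sub>R z) * of_real ((1 / h m) ^ CARD('n) * (?S * gauss ((1 / h m) *\<^sub>R ((x + h m *\<^sub>R z) - x))))) =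
        (\<lambda>z. of_real ((1 / h m) ^ CARD('n) * ?S) * (f (x + h m *\<^sub>R z) * of_real (gauss z)))"
      using h[of m] by (simp add: fun_eq_iff)
    also have "h m ^ DIM(real^'n) *\<^sub>R (LINT z|lborel. of_real ((1 / h m) ^ CARD('n) * ?S) * (f (x + h m *\<^sub>R z) * of_real (gauss z))) =
        of_real (h m ^ CARD('n) * ((1 / h m) ^ CARD('n) * ?S)) * (LINT z|lborel. f (x + h m *\<^sub>R z) * of_real (gauss z))"
      unfolding integral_mult_right_zero scaleR_conv_of_real by simp
    also have "h m ^ CARD('n) * ((1 / h m) ^ CARD('n) * ?S) = ?S"
      using h[of m] by (simp add: power_one_over)
    finally show ?thesis .
  qed
  have g0: "gauss (h m *\<^sub>R \<xi>) \<le> 1" "gauss \<xi> \<ge> 0" for m \<xi>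
    by (auto simp: gauss_def)
  have lim1: "A \<longlonglongrightarrow> (LINT \<xi>|lborel. cis (x \<bullet> \<xi>) * fourier f \<xi>)"
    unfolding A_def
  proof (rule integral_dominated_convergence)
    show "integrable lborel (\<lambda>\<xi>. norm (fourier f \<xi>))" using Fi by (rule integrable_norm)
    show "AE \<xi> in lborel. (\<lambda>m. of_real (gauss (h m *\<^sub>R \<xi>)) * (cis (x \<bullet> \<xi>) * fourier f \<xi>)) \<longlonglongrightarrow> cis (x \<bullet> \<xi>) * fourier f \<xi>"
    proof (rule AE_I2)
      fix \<xi> :: "real^'n"
      have "(\<lambda>m. gauss (h m *\<^sub>R \<xi>)) \<longlonglongrightarrow> gauss (0 *\<^sub>R \<xi>)"
        unfolding gauss_def by (intro tendsto_intros h0) simp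
      then have "(\<lambda>m. of_real (gauss (h m *\<^sub>R \<xi>)) * (cis (x \<bullet> \<xi>) * fourier f \<xi>)) \<longlonglongrightarrow> of_real (gauss (0 *\<^sub>R \<xi>)) * (cis (x \<bullet> \<xi>) * fourier f \<xi>)"
        by (intro tendsto_intros)
      then show "(\<lambda>m. of_real (gauss (h m *\<^sub>R \<xi>)) * (cis (x \<bullet> \<xi>) * fourier f \<xi>)) \<longlonglongrightarrow> cis (x \<bullet> \<xi>) * fourier f \<xi>"
        by (simp add: gauss_def)
    qed
    show "AE \<xi> in lborel. norm (of_real (gauss (h m *\<^sub>R \<xi>)) * (cis (x \<bullet> \<xi>) * fourier f \<xi>)) \<le> norm (fourier f \<xi>)" for m
    proof (rule AE_I2)
      fix \<xi> :: "real^'n"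
      have "gauss (h m *\<^sub>R \<xi>) * norm (fourier f \<xi>) \<le> 1 * norm (fourier f \<xi>)"
        by (intro mult_right_mono g0) simp
      then show "norm (of_real (gauss (h m *\<^sub>R \<xi>)) * (cis (x \<bullet> \<xi>) * fourier f \<xi>)) \<le> norm (fourier f \<xi>)"
        using g0(2)[of "h m *\<^sub>R \<xi>"] by (simp add: norm_mult)
    qed
  qed measurable
  obtain B where "\<And>y. (1 + norm y) ^ 0 * norm (f y) \<le> B"
    using schwartz_upto_0_decay[OF up] by metis
  then have B: "norm (f y) \<le> B" for y by simp
  have "(\<lambda>m. LINT z|lborel. f (x + h m *\<^sub>R z) * of_real (gauss z)) \<longlonglongrightarrow> (LINT z|lborel. f x * of_real (gauss (z::real^'n)))"
  proof (rule integral_dominated_convergence)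
    show "integrable lborel (\<lambda>z::real^'n. B * norm (complex_of_real (gauss z)))"
      by (intro integrable_mult_right integrable_norm integrable_gauss)
    show "AE z in lborel. norm (f (x + h m *\<^sub>R z) * of_real (gauss z)) \<le> B * norm (complex_of_real (gauss z))" for m
      using B by (intro AE_I2) (auto simp: norm_mult intro!: mult_right_mono)
    have "f differentiable (at x)" using up[of 0] by simp
    then have "isCont f x" by (rule differentiable_imp_continuous_within)
    then have "(\<lambda>m. f (x + h m *\<^sub>R z)) \<longlonglongrightarrow> f x" for z
      by (rule isCont_tendsto_compose) (use h0 in \<open>auto intro!: tendsto_eq_intros\<close>)
    then show "AE z in lborel. (\<lambda>m. f (x + h m *\<^sub>R z) * of_real (gauss z)) \<longlonglongrightarrow> f x * of_real (gauss z)"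
      by (intro AE_I2 tendsto_intros)
  qed measurable
  then have lim2: "A \<longlonglongrightarrow> ?S * (LINT z|lborel. f x * of_real (gauss (z::real^'n)))"
    unfolding A by (intro tendsto_intros)
  have eq: "?S * (LINT z|lborel. f x * of_real (gauss (z::real^'n))) = f x * of_real ((2 * pi) ^ CARD('n))"
  proof -
    have "sqrt (2 * pi) * sqrt (2 * pi) = 2 * pi" by (rule real_sqrt_mult_self[THEN trans]) simp
    then have "?S * ?S = (2 * pi) ^ CARD('n)" by (simp only: power_mult_distrib[symmetric])
    then have S: "complex_of_real ?S * of_real ?S = of_real ((2 * pi) ^ CARD('n))"
      unfolding of_real_mult[symmetric] by (rule arg_cong)
    show ?thesis
      unfolding integral_mult_right_zero integral_gauss S[symmetric] by (rule mult.left_commute)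
  qed
  have nz: "complex_of_real ((2 * pi) ^ CARD('n)) \<noteq> 0" by simp
  show ?thesis
    unfolding inverse_fourier_def LIMSEQ_unique[OF lim1 lim2[unfolded eq]]
    by (rule nonzero_mult_div_cancel_right[OF nz])
qed

section \<open>Fourier multipliers as integral operators\<close>

lemma schwartz_cmult: "schwartz f \<Longrightarrow> schwartz (\<lambda>x. c * f x)" for f :: "real^'n::finite \<Rightarrow> complex"
  unfolding schwartz_iff_upto by (intro allI schwartz_upto_cmult) simp

lemma schwartz_coord_mult: "schwartz f \<Longrightarrow> schwartz (\<lambda>x. of_real (x $ i) * f x)"
  for f :: "real^'n::finite \<Rightarrow> complex"
  unfolding schwartz_iff_upto by (intro allI schwartz_upto_coord_mult) simp

lemma schwartz_cis_mult: "schwartz f \<Longrightarrow> schwartz (\<lambda>x. cis (a \<bullet> x) * f x)"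
  unfolding schwartz_iff_upto by (intro allI schwartz_upto_cis_mult) simp

lemma schwartz_dilation: "schwartz f \<Longrightarrow> r \<noteq> 0 \<Longrightarrow> schwartz (\<lambda>x. f (r *\<^sub>R x))"
  for f :: "real^'n::finite \<Rightarrow> complex"
  unfolding schwartz_iff_upto by (intro allI schwartz_upto_dilation) simp_all

lemma schwartz_of_real: "schwartz f \<Longrightarrow> schwartz (\<lambda>x. complex_of_real (f x))"
  unfolding schwartz_iff_upto by (intro allI schwartz_upto_of_real) simp

lemma schwartz_div_norm_sq:
  fixes f :: "real^'n::finite \<Rightarrow> complex"
  assumes "e > 0" "schwartz f" "\<And>x. norm x < e \<Longrightarrow> f x = 0"
  shows "schwartz (\<lambda>x. of_real (1 / (norm x)\<^sup>2) * f x)"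
  unfolding schwartz_iff_upto
  by (intro allI schwartz_upto_div_norm_sq[OF assms(1)] schwartz_imp_upto[OF assms(2)] assms(3))

lemma schwartz_partial: "schwartz f \<Longrightarrow> schwartz (partial i f)"
  unfolding schwartz_iff_upto[of "partial i f"] using schwartz_imp_upto[of f "Suc _"] by simp

lemma schwartz_measurable: "schwartz f \<Longrightarrow> f \<in> borel_measurable borel"
  for f :: "real^'n::finite \<Rightarrow> complex"
  by (rule schwartz_upto_0_measurable[OF schwartz_imp_upto])

lemma schwartz_integrable: "schwartz f \<Longrightarrow> integrable lborel f"
  for f :: "real^'n::finite \<Rightarrow> complex"
  by (rule schwartz_upto_0_integrable[OF schwartz_imp_upto])

abbreviation coord_symbol :: "'n::finite \<Rightarrow> (real^'n \<Rightarrow> complex) \<Rightarrow> real^'n \<Rightarrow> complex" where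
  "coord_symbol l m \<equiv> \<lambda>\<xi>. - \<i> * (of_real (\<xi> $ l) * m \<xi>)"

abbreviation dilate :: "real \<Rightarrow> (real^'n::finite \<Rightarrow> complex) \<Rightarrow> real^'n \<Rightarrow> complex" where
  "dilate r m \<equiv> \<lambda>\<xi>. m ((1 / r) *\<^sub>R \<xi>)"

abbreviation L2_sq :: "('a::euclidean_space \<Rightarrow> 'b::real_normed_vector) \<Rightarrow> ennreal" where
  "L2_sq u \<equiv> \<integral>\<^sup>+x. ennreal (norm (u x)) ^ 2 \<partial>lborel"

text \<open>The function \<open>y \<mapsto> k(x - y)\<close>, where \<open>k\<close> is the inverse Fourier transform of \<open>m\<close>. Writing it as a
Fourier transform in \<open>y\<close> of the modulated symbol makes it a Schwartz function of \<open>y\<close>, exhibits its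
inverse transform, and turns derivatives in \<open>y\<close> into multiplications of the symbol by coordinates.\<close>
definition kernel :: "(real^'n::finite \<Rightarrow> complex) \<Rightarrow> real^'n \<Rightarrow> real^'n \<Rightarrow> complex" where
  "kernel m x = fourier (\<lambda>\<xi>. of_real (1 / (2 * pi) ^ CARD('n)) * (cis (x \<bullet> \<xi>) * m \<xi>))"

definition multiplier_op :: "(real^'n::finite \<Rightarrow> complex) \<Rightarrow> (real^'n \<Rightarrow> complex) \<Rightarrow> real^'n \<Rightarrow> complex" where
  "multiplier_op m u x = (LINT y|lborel. u y * kernel m x y)"

definition kernel_L1 :: "(real^'n::finite \<Rightarrow> complex) \<Rightarrow> real" where
  "kernel_L1 m = (LINT z|lborel. norm (kernel m 0 z))"

lemma schwartz_kernel_symbol: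
  "schwartz m \<Longrightarrow> schwartz (\<lambda>\<xi>::real^'n::finite. of_real (1 / (2 * pi) ^ CARD('n)) * (cis (x \<bullet> \<xi>) * m \<xi>))"
  by (intro schwartz_cmult schwartz_cis_mult)

lemma schwartz_kernel: "schwartz m \<Longrightarrow> schwartz (kernel m x)"
  unfolding kernel_def by (intro schwartz_fourier schwartz_kernel_symbol)

lemma kernel_L1_nn:
  assumes "schwartz m"
  shows "(\<integral>\<^sup>+z. ennreal (norm (kernel m 0 z)) \<partial>lborel) = ennreal (kernel_L1 m)"
  unfolding kernel_L1_def
  by (rule nn_integral_eq_integral) (auto intro: integrable_norm schwartz_integrable schwartz_kernel assms)

lemma kernel_L1_nonneg: "kernel_L1 m \<ge> 0"
  unfolding kernel_L1_def by simp

lemma partial_kernel: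
  assumes "schwartz m"
  shows "partial l (kernel m x) = kernel (coord_symbol l m) x"
  unfolding kernel_def partial_fourier[OF schwartz_imp_upto[OF schwartz_kernel_symbol[OF assms]]]
  by (rule arg_cong[where f=fourier]) (simp add: fun_eq_iff)

lemma kernel_cmult: "kernel (\<lambda>\<xi>. c * m \<xi>) x y = c * kernel m x y"
  unfolding kernel_def fourier_def
  by (subst integral_mult_right_zero[symmetric], rule Bochner_Integration.integral_cong) auto

lemma kernel_sum:
  fixes m :: "'i \<Rightarrow> real^'n::finite \<Rightarrow> complex"
  assumes "finite I" "\<And>i. i \<in> I \<Longrightarrow> schwartz (m i)"
  shows "kernel (\<lambda>\<xi>. \<Sum>i\<in>I. m i \<xi>) x y = (\<Sum>i\<in>I. kernel (m i) x y)"
proof -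
  have "(LINT \<xi>|lborel. (\<Sum>i\<in>I. cis (- (\<xi> \<bullet> y)) * (of_real (1 / (2 * pi) ^ CARD('n)) * (cis (x \<bullet> \<xi>) * m i \<xi>)))) =
    (\<Sum>i\<in>I. kernel (m i) x y)"
    unfolding kernel_def fourier_def
    by (rule Bochner_Integration.integral_sum)
      (intro integrable_fourier_integrand schwartz_integrable schwartz_kernel_symbol assms(2))
  then show ?thesis
    unfolding kernel_def[of "\<lambda>\<xi>. \<Sum>i\<in>I. m i \<xi>"] fourier_def sum_distrib_left by simp
qed

lemma kernel_dilation:
  fixes m :: "real^'n::finite \<Rightarrow> complex"
  assumes r: "r > 0" and m: "m \<in> borel_measurable borel"
  shows "kernel (dilate r m) x y = of_real (r ^ CARD('n)) * kernel m 0 (r *\<^sub>R (y - x))"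
proof -
  let ?c = "complex_of_real (1 / (2 * pi) ^ CARD('n))"
  let ?f = "\<lambda>\<xi>. cis (- (\<xi> \<bullet> y)) * (?c * (cis (x \<bullet> \<xi>) * m ((1 / r) *\<^sub>R \<xi>)))"
  have "kernel (dilate r m) x y = integral\<^sup>L lborel ?f"
    by (simp only: kernel_def fourier_def)
  also have "\<dots> = r ^ DIM(real^'n) *\<^sub>R (LINT \<xi>|lborel. ?f (0 + r *\<^sub>R \<xi>))"
    by (rule lborel_affine_change(2)[OF r]) (use m in measurable)
  also have "(LINT \<xi>|lborel. ?f (0 + r *\<^sub>R \<xi>)) = kernel m 0 (r *\<^sub>R (y - x))"
    unfolding kernel_def fourier_def
  proof (intro Bochner_Integration.integral_cong refl)
    fix \<xi> :: "real^'n"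
    have "cis (- (r *\<^sub>R \<xi> \<bullet> y)) * cis (x \<bullet> r *\<^sub>R \<xi>) = cis (- (\<xi> \<bullet> r *\<^sub>R (y - x)))"
      by (simp add: cis_mult inner_diff_right inner_commute algebra_simps)
    moreover have ab: "a * (c * (b * d)) = a * b * (c * d)" for a b c d :: complex
      by (simp only: mult_ac)
    ultimately have "cis (- (r *\<^sub>R \<xi> \<bullet> y)) * (?c * (cis (x \<bullet> r *\<^sub>R \<xi>) * m \<xi>)) =
        cis (- (\<xi> \<bullet> r *\<^sub>R (y - x))) * (?c * m \<xi>)"
      by (simp only: ab)
    then show "?f (0 + r *\<^sub>R \<xi>) = cis (- (\<xi> \<bullet> r *\<^sub>R (y - x))) * (?c * (cis (0 \<bullet> \<xi>) * m \<xi>))"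
      using r by simp
  qed
  finally show ?thesis by (simp add: scaleR_conv_of_real)
qed

text \<open>After rescaling, the kernel of every dilate is an average over one fixed kernel. This is why
the operator bounds below do not depend on the dilation.\<close>
lemma nn_integral_kernel:
  fixes m :: "real^'n::finite \<Rightarrow> complex"
  assumes r: "r > 0" and m: "schwartz m" and f: "f \<in> borel_measurable borel"
  shows "(\<integral>\<^sup>+y. f y * ennreal (norm (kernel (dilate r m) x y)) \<partial>lborel) =
    (\<integral>\<^sup>+z. f (x + (1 / r) *\<^sub>R z) * ennreal (norm (kernel m 0 z)) \<partial>lborel)"
proof -
  have [measurable]: "kernel m 0 \<in> borel_measurable borel"
    by (rule schwartz_measurable[OF schwartz_kernel[OF m]])
  note [measurable] = f
  have "(\<integral>\<^sup>+y. f y * ennreal (norm (kernel (dilate r m) x y)) \<partial>lborel) =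
    (\<integral>\<^sup>+y. f y * ennreal (r ^ CARD('n) * norm (kernel m 0 (r *\<^sub>R (y - x)))) \<partial>lborel)"
    unfolding kernel_dilation[OF r schwartz_measurable[OF m]] norm_mult norm_of_real
    using r by (simp add: abs_of_pos)
  also have "\<dots> = ennreal ((1 / r) ^ DIM(real^'n)) * (\<integral>\<^sup>+z. f (x + (1 / r) *\<^sub>R z) *
      ennreal (r ^ CARD('n) * norm (kernel m 0 (r *\<^sub>R ((x + (1 / r) *\<^sub>R z) - x)))) \<partial>lborel)"
    by (rule nn_integral_lborel_affine_change) (use r in auto)
  also have "\<dots> = (\<integral>\<^sup>+z. ennreal ((1 / r) ^ DIM(real^'n)) * (f (x + (1 / r) *\<^sub>R z) *
      ennreal (r ^ CARD('n) * norm (kernel m 0 (r *\<^sub>R ((x + (1 / r) *\<^sub>R z) - x))))) \<partial>lborel)"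
    by (rule nn_integral_cmult[symmetric]) measurable
  also have "\<dots> = (\<integral>\<^sup>+z. f (x + (1 / r) *\<^sub>R z) * ennreal (norm (kernel m 0 z)) \<partial>lborel)"
  proof (rule nn_integral_cong)
    fix z :: "real^'n"
    let ?k = "norm (kernel m 0 z)"
    have 1: "ennreal (r ^ CARD('n) * ?k) = ennreal (r ^ CARD('n)) * ennreal ?k"
      using r by (intro ennreal_mult) auto
    have 2: "ennreal ((1 / r) ^ CARD('n)) * ennreal (r ^ CARD('n)) = 1"
      using r by (subst ennreal_mult[symmetric]) (auto simp: power_mult_distrib[symmetric])
    have "ennreal ((1 / r) ^ CARD('n)) * (f (x + (1 / r) *\<^sub>R z) * (ennreal (r ^ CARD('n)) * ennreal ?k)) =
      (ennreal ((1 / r) ^ CARD('n)) * ennreal (r ^ CARD('n))) * (f (x + (1 / r) *\<^sub>R z) * ennreal ?k)"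
      by (simp only: mult_ac)
    then show "ennreal ((1 / r) ^ DIM(real^'n)) * (f (x + (1 / r) *\<^sub>R z) *
      ennreal (r ^ CARD('n) * norm (kernel m 0 (r *\<^sub>R ((x + (1 / r) *\<^sub>R z) - x))))) =
      f (x + (1 / r) *\<^sub>R z) * ennreal (norm (kernel m 0 z))"
      unfolding 2 using r 1 by simp
  qed
  finally show ?thesis .
qed

lemma integral_norm_le_nn:
  fixes f :: "'a \<Rightarrow> 'b::{banach,second_countable_topology}"
  shows "ennreal (norm (integral\<^sup>L M f)) \<le> (\<integral>\<^sup>+x. ennreal (norm (f x)) \<partial>M)"
  by (cases "integrable M f") (auto simp: integral_norm_bound_ennreal not_integrable_integral_eq)

lemma multiplier_op_measurable:
  fixes m :: "real^'n::finite \<Rightarrow> complex"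
  assumes r: "r > 0" and m: "schwartz m" and u [measurable]: "u \<in> borel_measurable borel"
  shows "multiplier_op (dilate r m) u \<in> borel_measurable borel"
proof -
  have [measurable]: "kernel m 0 \<in> borel_measurable borel"
    by (rule schwartz_measurable[OF schwartz_kernel[OF m]])
  show ?thesis
    unfolding multiplier_op_def[abs_def] kernel_dilation[OF r schwartz_measurable[OF m]] by measurable
qed

text \<open>Cauchy--Schwarz with respect to the measure \<open>|k(z)| dz\<close>, followed by Tonelli and translation
invariance. The absolute values stand inside the inner integral because this form also justifies
Fubini when the operator is transposed onto a test function.\<close>
lemma young_L2:
  fixes m :: "real^'n::finite \<Rightarrow> complex"
  assumes r: "r > 0" and m: "schwartz m" and u [measurable]: "u \<in> borel_measurable borel"
  shows "(\<integral>\<^sup>+x. (\<integral>\<^sup>+y. ennreal (norm (u y)) * ennreal (norm (kernel (dilate r m) x y)) \<partial>lborel)\<^sup>2 \<partial>lborel)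
    \<le> ennreal ((kernel_L1 m)\<^sup>2) * L2_sq u" (is "?L \<le> _")
proof -
  let ?k = "\<lambda>z. ennreal (norm (kernel m 0 z))"
  let ?v = "\<lambda>x z. ennreal (norm (u (x + (1 / r) *\<^sub>R z)))"
  let ?A = "ennreal (kernel_L1 m)"
  have [measurable]: "kernel m 0 \<in> borel_measurable borel"
    by (rule schwartz_measurable[OF schwartz_kernel[OF m]])
  have pt: "(\<integral>\<^sup>+z. ?v x z * ?k z \<partial>lborel)\<^sup>2 \<le>
      ?A * (\<integral>\<^sup>+z. ?v x z ^ 2 * ?k z \<partial>lborel)" for x
  proof -
    let ?s = "\<lambda>z. ennreal (sqrt (norm (kernel m 0 z)))"
    have ss: "?s z * ?s z = ?k z" for z by (simp add: ennreal_mult[symmetric])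
    have "(\<integral>\<^sup>+z. ?v x z * ?k z \<partial>lborel) =
        (\<integral>\<^sup>+z. ?s z * (?v x z * ?s z) \<partial>lborel)"
      by (intro nn_integral_cong) (simp only: ss[symmetric] mult_ac)
    also have "(\<dots>)\<^sup>2 \<le> (\<integral>\<^sup>+z. ?s z ^ 2 \<partial>lborel) * (\<integral>\<^sup>+z. (?v x z * ?s z) ^ 2 \<partial>lborel)"
      by (rule Cauchy_Schwarz_nn_integral) measurable
    also have "(\<integral>\<^sup>+z. ?s z ^ 2 \<partial>lborel) = ?A"
      unfolding power2_eq_square ss by (rule kernel_L1_nn[OF m])
    also have "(\<integral>\<^sup>+z. (?v x z * ?s z) ^ 2 \<partial>lborel) =
        (\<integral>\<^sup>+z. ?v x z ^ 2 * ?k z \<partial>lborel)"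
      unfolding power_mult_distrib by (simp add: power2_eq_square ss)
    finally show ?thesis .
  qed
  have "?L = (\<integral>\<^sup>+x. (\<integral>\<^sup>+z. ?v x z * ?k z \<partial>lborel)\<^sup>2 \<partial>lborel)"
    by (subst nn_integral_kernel[OF r m]) auto
  also have "\<dots> \<le> (\<integral>\<^sup>+x. ?A * (\<integral>\<^sup>+z. ?v x z ^ 2 * ?k z \<partial>lborel) \<partial>lborel)"
    by (intro nn_integral_mono pt)
  also have "\<dots> = ?A * (\<integral>\<^sup>+x. (\<integral>\<^sup>+z. ?v x z ^ 2 * ?k z \<partial>lborel) \<partial>lborel)"
    by (rule nn_integral_cmult) measurable
  also have "(\<integral>\<^sup>+x. (\<integral>\<^sup>+z. ?v x z ^ 2 * ?k z \<partial>lborel) \<partial>lborel) =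
      (\<integral>\<^sup>+z. (\<integral>\<^sup>+x. ?v x z ^ 2 * ?k z \<partial>lborel) \<partial>lborel)"
    by (rule lborel_pair.Fubini') measurable
  also have "\<dots> = (\<integral>\<^sup>+z. L2_sq u * ?k z \<partial>lborel)"
  proof (rule nn_integral_cong)
    fix z :: "real^'n"
    have "(\<integral>\<^sup>+x. ?v x z ^ 2 * ?k z \<partial>lborel) =
       (\<integral>\<^sup>+x. ?v x z ^ 2 \<partial>lborel) * ?k z"
      by (rule nn_integral_multc) measurable
    also have "(\<integral>\<^sup>+x. ?v x z ^ 2 \<partial>lborel) = L2_sq u"
      using nn_integral_lborel_affine_change[of 1 "\<lambda>x. ennreal (norm (u x)) ^ 2" "(1 / r) *\<^sub>R z"]
      by (simp add: add.commute)
    finally show "(\<integral>\<^sup>+x. ?v x z ^ 2 * ?k z \<partial>lborel) =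
        L2_sq u * ?k z" .
  qed
  also have "\<dots> = L2_sq u * ?A"
    by (subst nn_integral_cmult) (auto simp: kernel_L1_nn[OF m])
  finally show ?thesis
    by (simp add: power2_eq_square ennreal_mult kernel_L1_nonneg mult_ac)
qed

lemma multiplier_op_L2:
  fixes m :: "real^'n::finite \<Rightarrow> complex"
  assumes r: "r > 0" and m: "schwartz m" and u: "u \<in> borel_measurable borel"
  shows "L2_sq (multiplier_op (dilate r m) u)
    \<le> ennreal ((kernel_L1 m)\<^sup>2) * L2_sq u"
proof (rule order_trans[OF nn_integral_mono young_L2[OF assms]])
  fix x
  have "ennreal (norm (multiplier_op (dilate r m) u x)) \<le>
    (\<integral>\<^sup>+y. ennreal (norm (u y * kernel (dilate r m) x y)) \<partial>lborel)"
    unfolding multiplier_op_def by (rule integral_norm_le_nn)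
  also have "\<dots> = (\<integral>\<^sup>+y. ennreal (norm (u y)) * ennreal (norm (kernel (dilate r m) x y)) \<partial>lborel)"
    by (simp add: norm_mult ennreal_mult)
  finally show "ennreal (norm (multiplier_op (dilate r m) u x)) ^ 2 \<le>
    (\<integral>\<^sup>+y. ennreal (norm (u y)) * ennreal (norm (kernel (dilate r m) x y)) \<partial>lborel)\<^sup>2"
    by (intro power_mono) auto
qed

section \<open>Bernstein estimates and integration by parts\<close>

lemma inverse_fourier_kernel:
  assumes "schwartz m"
  shows "inverse_fourier (kernel m x) \<xi> = of_real (1 / (2 * pi) ^ CARD('n::finite)) * (cis (x \<bullet> \<xi>) * m (\<xi>::real^'n))"
  unfolding kernel_def by (rule fourier_inversion[OF schwartz_kernel_symbol[OF assms]])

text \<open>Since \<open>c = 1\<close> on the support of \<open>b\<close>, filtering the kernel of \<open>c\<close> by \<open>b\<close> yields the kernel of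
\<open>b\<close>, and derivatives commute with the filter. The left-hand side is the test function on which
\<open>fourier_multiplier\<close> evaluates the distribution.\<close>
lemma multiplier_partial_kernel:
  fixes b :: "real^'n::finite \<Rightarrow> real"
  assumes b: "schwartz (\<lambda>\<xi>. complex_of_real (b \<xi>))" and c: "schwartz c" and bc: "\<And>\<xi>. of_real (b \<xi>) * c \<xi> = of_real (b \<xi>)"
  shows "fourier (\<lambda>\<xi>. of_real (b \<xi>) * inverse_fourier (partial i (kernel c x)) \<xi>) =
    partial i (kernel (\<lambda>\<xi>. of_real (b \<xi>)) x)"
proof -
  have s: "schwartz (coord_symbol i c)"
    by (intro schwartz_cmult schwartz_coord_mult c)
  have "of_real (b \<xi>) * inverse_fourier (partial i (kernel c x)) \<xi> =
      of_real (1 / (2 * pi) ^ CARD('n)) * (cis (x \<bullet> \<xi>) * (- \<i> * (of_real (\<xi> $ i) * (of_real (b \<xi>) * c \<xi>))))" for \<xi>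
    unfolding partial_kernel[OF c] inverse_fourier_kernel[OF s] by (simp only: mult_ac)
  then have "of_real (b \<xi>) * inverse_fourier (partial i (kernel c x)) \<xi> =
      of_real (1 / (2 * pi) ^ CARD('n)) * (cis (x \<bullet> \<xi>) * (- \<i> * (of_real (\<xi> $ i) * of_real (b \<xi>))))" for \<xi>
    unfolding bc .
  then show ?thesis
    unfolding partial_kernel[OF b] by (simp only: kernel_def)
qed

text \<open>The derivative is moved from the distribution onto the kernel, and the reproducing property of
\<open>c\<close> splits off the block \<open>b(D)T\<close>, leaving a derivative of a smooth kernel as test function.\<close>
lemma multiplier_op_eq_block:
  fixes T :: "'n::finite distribution"
  assumes b: "schwartz (\<lambda>\<xi>. complex_of_real (b \<xi>))" and c: "schwartz c" and bc: "\<And>\<xi>. of_real (b \<xi>) * c \<xi> = of_real (b \<xi>)"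
    and u: "represents u (dist_partial i T)" and h: "represents h (fourier_multiplier b T)"
  shows "multiplier_op (\<lambda>\<xi>. of_real (b \<xi>)) u x = - (LINT y|lborel. h y * partial i (kernel c x) y)"
proof -
  have k: "schwartz (kernel (\<lambda>\<xi>. of_real (b \<xi>)) x)" by (intro schwartz_kernel b)
  have "multiplier_op (\<lambda>\<xi>. of_real (b \<xi>)) u x = dist_partial i T (kernel (\<lambda>\<xi>. of_real (b \<xi>)) x)"
    using u k by (simp add: represents_def multiplier_op_def regular_distribution_def)
  also have "\<dots> = - T (partial i (kernel (\<lambda>\<xi>. of_real (b \<xi>)) x))"
    by (simp add: dist_partial_def)
  also have "T (partial i (kernel (\<lambda>\<xi>. of_real (b \<xi>)) x)) = fourier_multiplier b T (partial i (kernel c x))"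
    unfolding fourier_multiplier_def dist_inverse_fourier_def dist_mult_def dist_fourier_def
      multiplier_partial_kernel[OF b c bc] ..
  also have "\<dots> = (LINT y|lborel. h y * partial i (kernel c x) y)"
    using h schwartz_partial[OF schwartz_kernel[OF c]] by (simp add: represents_def regular_distribution_def)
  finally show ?thesis .
qed

text \<open>One derivative of the kernel of the dilate \<open>c(\<xi> / r)\<close> costs a factor \<open>r\<close>, and its \<open>L\<^sup>1\<close> norm is
otherwise independent of \<open>r\<close>.\<close>
lemma bernstein_bound:
  fixes T :: "'n::finite distribution"
  assumes r: "r > 0" and b: "schwartz (\<lambda>\<xi>. complex_of_real (b \<xi>))" and c: "schwartz c"
    and bc: "\<And>\<xi>. of_real (b \<xi>) * c ((1 / r) *\<^sub>R \<xi>) = of_real (b \<xi>)"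
    and u: "represents u (dist_partial i T)" and h: "represents h (fourier_multiplier b T)"
    and B: "AE y in lborel. norm (h y) \<le> B"
  shows "norm (multiplier_op (\<lambda>\<xi>. of_real (b \<xi>)) u x) \<le>
    B * r * kernel_L1 (coord_symbol i c)"
proof -
  let ?M = "coord_symbol i c"
  have M: "schwartz ?M" by (intro schwartz_cmult schwartz_coord_mult c)
  have cr: "schwartz (\<lambda>\<xi>. c ((1 / r) *\<^sub>R \<xi>))" using schwartz_dilation[OF c] r by simp
  have Mr: "schwartz (\<lambda>\<xi>. ?M ((1 / r) *\<^sub>R \<xi>))" using schwartz_dilation[OF M, of "1 / r"] r by simp
  let ?k = "kernel (\<lambda>\<xi>. ?M ((1 / r) *\<^sub>R \<xi>)) x"
  have "partial i (kernel (\<lambda>\<xi>. c ((1 / r) *\<^sub>R \<xi>)) x) y =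
      kernel (\<lambda>\<xi>. of_real r * ?M ((1 / r) *\<^sub>R \<xi>)) x y" for y
    unfolding partial_kernel[OF cr] using r by simp
  then have pk: "partial i (kernel (\<lambda>\<xi>. c ((1 / r) *\<^sub>R \<xi>)) x) y = of_real r * ?k y" for y
    unfolding kernel_cmult .
  have ki: "integrable lborel ?k" by (intro schwartz_integrable schwartz_kernel Mr)
  have hi: "integrable lborel (\<lambda>y. h y * (of_real r * ?k y))"
    using h schwartz_cmult[OF schwartz_kernel[OF Mr], of "of_real r" x] unfolding represents_def by blast
  have kL: "(LINT y|lborel. norm (?k y)) = kernel_L1 ?M"
  proof -
    have "ennreal (LINT y|lborel. norm (?k y)) = (\<integral>\<^sup>+y. ennreal (norm (?k y)) \<partial>lborel)"
      by (rule nn_integral_eq_integral[symmetric]) (use ki in auto)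
    also have "\<dots> = ennreal (kernel_L1 ?M)"
      using nn_integral_kernel[OF r M, of "\<lambda>_. 1" x] kernel_L1_nn[OF M] by simp
    finally show ?thesis by (simp add: kernel_L1_nonneg)
  qed
  have "norm (multiplier_op (\<lambda>\<xi>. of_real (b \<xi>)) u x) = norm (LINT y|lborel. h y * (of_real r * ?k y))"
    unfolding multiplier_op_eq_block[OF b cr bc u h] pk by simp
  also have "\<dots> \<le> (LINT y|lborel. norm (h y * (of_real r * ?k y)))"
    by (rule integral_norm_bound)
  also have "\<dots> \<le> (LINT y|lborel. B * r * norm (?k y))"
  proof (rule integral_mono_AE)
    show "AE y in lborel. norm (h y * (of_real r * ?k y)) \<le> B * r * norm (?k y)"
      using B
    proof eventually_elim
      case (elim y)
      have "norm (h y) * (r * norm (?k y)) \<le> B * (r * norm (?k y))"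
        by (rule mult_right_mono[OF elim]) (use r in simp)
      then show ?case using r by (simp add: norm_mult mult.assoc)
    qed
  qed (use ki hi in \<open>auto intro: integrable_norm\<close>)
  also have "\<dots> = B * r * kernel_L1 ?M"
    by (simp only: integral_mult_right_zero kL)
  finally show ?thesis .
qed

lemma multiplier_op_sum:
  assumes "finite I" "\<And>k. k \<in> I \<Longrightarrow> schwartz (m k)"
    and u: "\<And>\<psi>. schwartz \<psi> \<Longrightarrow> integrable lborel (\<lambda>x. u x * \<psi> x)"
  shows "multiplier_op (\<lambda>\<xi>. \<Sum>k\<in>I. m k \<xi>) u x = (\<Sum>k\<in>I. multiplier_op (m k) u x)"
proof -
  have "kernel (\<lambda>\<xi>. \<Sum>k\<in>I. m k \<xi>) x y = (\<Sum>k\<in>I. kernel (m k) x y)" for y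
    by (rule kernel_sum) (use assms(1,2) in auto)
  then have "multiplier_op (\<lambda>\<xi>. \<Sum>k\<in>I. m k \<xi>) u x = (LINT y|lborel. (\<Sum>k\<in>I. u y * kernel (m k) x y))"
    by (simp only: multiplier_op_def sum_distrib_left)
  also have "\<dots> = (\<Sum>k\<in>I. multiplier_op (m k) u x)"
    unfolding multiplier_op_def
    by (rule Bochner_Integration.integral_sum) (intro u schwartz_kernel assms(2))
  finally show ?thesis .
qed

lemma multiplier_op_cmult:
  "multiplier_op (\<lambda>\<xi>. c * m \<xi>) u x = c * multiplier_op m u x"
  unfolding multiplier_op_def kernel_cmult
  by (subst integral_mult_right_zero[symmetric], rule Bochner_Integration.integral_cong) auto

text \<open>Multiplication of the symbol by \<open>-\<i> \<xi>\<^sub>l\<close> differentiates the kernel in \<open>y\<close>, and testing the weak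
derivative with the kernel integrates by parts.\<close>
lemma multiplier_op_weak_partial:
  fixes u :: "real^'n::finite \<Rightarrow> complex"
  assumes p: "schwartz p" and v: "represents v (dist_partial l (regular_distribution u))"
  shows "multiplier_op (coord_symbol l p) u x = - multiplier_op p v x"
proof -
  have k: "schwartz (kernel p x)" by (rule schwartz_kernel[OF p])
  have "multiplier_op p v x = dist_partial l (regular_distribution u) (kernel p x)"
    using v k by (simp add: represents_def multiplier_op_def regular_distribution_def)
  also have "\<dots> = - multiplier_op (coord_symbol l p) u x"
    by (simp only: dist_partial_def regular_distribution_def partial_kernel[OF p] multiplier_op_def)
  finally show ?thesis by simp
qed

section \<open>Recovering a function from its frequency truncations\<close>

text \<open>Open boxes are closed under intersection and generate the Borel sets, so all set integrals of
\<open>f\<close> vanish by Dynkin's argument.\<close>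
lemma AE_zero_if_box_integrals_zero:
  fixes f :: "'a::euclidean_space \<Rightarrow> complex"
  assumes f: "integrable lborel f"
    and box: "\<And>a b. (LINT x:box a b|lborel. f x) = 0"
  shows "AE x in lborel. f x = 0"
proof (rule sigma_finite_measure.density_zero[OF sigma_finite_lborel f])
  fix A :: "'a set" assume A: "A \<in> sets lborel"
  let ?G = "range (\<lambda>(a, b). box a b :: 'a set)"
  have borel: "sets borel = sigma_sets UNIV ?G" by (simp add: borel_eq_box)
  have seti: "set_integrable lborel B f" if "B \<in> sets borel" for B
    unfolding set_integrable_def using that f by (intro integrable_mult_indicator) auto
  have UN: "(LINT x:UNIV|lborel. f x) = 0"
  proof -
    have "(\<lambda>i. LINT x:box (- (real i *\<^sub>R One)) (real i *\<^sub>R One)|lborel. f x) \<longlonglongrightarrow>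
        (LINT x:(\<Union>i. box (- (real i *\<^sub>R One)) (real i *\<^sub>R One))|lborel. f x)"
      by (rule set_integral_cont_up) (auto intro!: seti monoI simp: mem_box incseq_def, force+)
    then have "(\<lambda>i::nat. 0) \<longlonglongrightarrow> (LINT x:UNIV|lborel. f x)"
      unfolding box UN_box_eq_UNIV .
    from LIMSEQ_unique[OF this tendsto_const] show ?thesis .
  qed
  have "Int_stable ?G" unfolding Int_stable_def by (auto simp: box_Int_box)
  moreover have "?G \<subseteq> Pow UNIV" by simp
  moreover have "A \<in> sigma_sets UNIV ?G" using A borel by simp
  ultimately show "(LINT x:A|lborel. f x) = 0"
  proof (induction rule: sigma_sets_induct_disjoint)
    case (basic B)
    then show ?case using box by auto
  next
    case empty
    show ?case by (simp add: set_lebesgue_integral_def)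
  next
    case (compl B)
    have B: "B \<in> sets borel" using compl borel by simp
    have "(LINT x:(B \<union> (UNIV - B))|lborel. f x) = (LINT x:B|lborel. f x) + (LINT x:(UNIV - B)|lborel. f x)"
      by (rule set_integral_Un) (use B in \<open>auto intro!: seti\<close>)
    moreover have "B \<union> (UNIV - B) = UNIV" by auto
    ultimately show ?case using compl UN by simp
  next
    case (union B)
    have B: "B i \<in> sets borel" for i using union borel by auto
    have "(LINT x:(\<Union>i. B i)|lborel. f x) = (\<Sum>i. (LINT x:(B i)|lborel. f x))"
      by (rule lebesgue_integral_countable_add)
        (use union(1) B in \<open>auto intro!: seti sets.countable_UN simp: disjoint_family_on_def\<close>)
    then show ?case using union by simp
  qed
qed

lemma integrable_mult_L2:
  fixes f g :: "'a \<Rightarrow> complex"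
  assumes [measurable]: "f \<in> borel_measurable M" "g \<in> borel_measurable M"
    and f: "(\<integral>\<^sup>+x. ennreal (norm (f x)) ^ 2 \<partial>M) < \<infinity>" and g: "(\<integral>\<^sup>+x. ennreal (norm (g x)) ^ 2 \<partial>M) < \<infinity>"
  shows "integrable M (\<lambda>x. f x * g x)"
proof (rule integrableI_bounded)
  have "(\<integral>\<^sup>+x. ennreal (norm (f x * g x)) \<partial>M)\<^sup>2 = (\<integral>\<^sup>+x. ennreal (norm (f x)) * ennreal (norm (g x)) \<partial>M)\<^sup>2"
    by (simp add: norm_mult ennreal_mult)
  also have "\<dots> \<le> (\<integral>\<^sup>+x. ennreal (norm (f x)) ^ 2 \<partial>M) * (\<integral>\<^sup>+x. ennreal (norm (g x)) ^ 2 \<partial>M)"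
    by (rule Cauchy_Schwarz_nn_integral) measurable
  also have "\<dots> < \<infinity>" using f g by (simp add: ennreal_mult_less_top)
  finally show "(\<integral>\<^sup>+x. ennreal (norm (f x * g x)) \<partial>M) < \<infinity>"
    by (simp add: power_less_top_ennreal)
qed measurable

text \<open>A weight in both \<open>L\<^sup>1\<close> and \<open>L\<^sup>2\<close>: multiplying by it makes \<open>L\<^sup>2\<close> functions integrable, and it
changes under translation only by a polynomial factor, which a Schwartz kernel absorbs.\<close>
definition decay_weight :: "real^'n::finite \<Rightarrow> real" where
  "decay_weight x = 1 / (1 + norm x) ^ (2 * CARD('n))"

lemma decay_weight_pos: "0 < decay_weight x"
  unfolding decay_weight_def by (intro divide_pos_pos zero_less_power add_pos_nonneg) auto

lemma decay_weight_le_1: "decay_weight (x::real^'n::finite) \<le> 1"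
proof -
  have "1 \<le> (1 + norm x) ^ (2 * CARD('n))" by (rule one_le_power) simp
  from this divide_le_eq_1_pos[OF less_le_trans[OF zero_less_one this]]
  show ?thesis unfolding decay_weight_def by blast
qed

lemma isCont_decay_weight: "isCont decay_weight x"
proof -
  have "1 + norm x \<noteq> 0" using norm_ge_zero[of x] by linarith
  then show ?thesis unfolding decay_weight_def[abs_def] by (intro continuous_intros) simp
qed

lemma decay_weight_measurable [measurable]: "decay_weight \<in> borel_measurable borel"
  by (intro borel_measurable_continuous_onI) (auto simp: continuous_on_eq_continuous_at isCont_decay_weight)

lemma integrable_decay_weight: "integrable lborel (decay_weight :: real^'n::finite \<Rightarrow> real)"
  unfolding decay_weight_def[abs_def] by (rule integrable_polynomial_decay)

lemma decay_weight_L2: "(\<integral>\<^sup>+x. ennreal (decay_weight (x::real^'n::finite)) ^ 2 \<partial>lborel) < \<infinity>"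
proof -
  have "(\<integral>\<^sup>+x. ennreal (decay_weight (x::real^'n)) ^ 2 \<partial>lborel) \<le> (\<integral>\<^sup>+x. ennreal (decay_weight (x::real^'n)) \<partial>lborel)"
  proof (rule nn_integral_mono)
    fix x :: "real^'n"
    have "decay_weight x * decay_weight x \<le> decay_weight x * 1"
      using decay_weight_pos[of x] decay_weight_le_1[of x] by (intro mult_left_mono) auto
    then show "ennreal (decay_weight x) ^ 2 \<le> ennreal (decay_weight x)"
      using decay_weight_pos[of x] by (simp add: power2_eq_square ennreal_mult[symmetric] ennreal_leI)
  qed
  also have "\<dots> < \<infinity>"
    using integrable_decay_weight decay_weight_pos
    by (subst nn_integral_eq_integral) (auto intro: less_imp_le)
  finally show ?thesis .
qed

lemma decay_weight_shift:
  assumes "0 \<le> r" "r \<le> 1"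
  shows "decay_weight (y + r *\<^sub>R z) \<le> (1 + norm z) ^ (2 * CARD('n)) * decay_weight (y :: real^'n::finite)"
proof -
  let ?k = "2 * CARD('n)"
  have "norm y \<le> norm (y + r *\<^sub>R z) + norm (r *\<^sub>R z)"
    by (metis add_diff_cancel_right' norm_triangle_ineq4)
  moreover have "norm (r *\<^sub>R z) \<le> norm z" using assms by (simp add: mult_left_le_one_le)
  moreover have "0 \<le> norm (y + r *\<^sub>R z) * norm z" by simp
  moreover have "(1 + norm z) * (1 + norm (y + r *\<^sub>R z)) =
      1 + norm z + norm (y + r *\<^sub>R z) + norm (y + r *\<^sub>R z) * norm z"
    by (simp add: algebra_simps)
  ultimately have "1 + norm y \<le> (1 + norm z) * (1 + norm (y + r *\<^sub>R z))" by linarith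
  then have le: "(1 + norm y) ^ ?k \<le> (1 + norm z) ^ ?k * (1 + norm (y + r *\<^sub>R z)) ^ ?k"
    unfolding power_mult_distrib[symmetric] by (rule power_mono) simp
  have p: "0 < (1 + norm w) ^ ?k" for w :: "real^'n" by (intro zero_less_power add_pos_nonneg) auto
  show ?thesis unfolding decay_weight_def using le p[of y] p[of "y + r *\<^sub>R z"]
    by (simp add: divide_simps mult.commute)
qed

lemma lborel_reflect:
  fixes f :: "'a::euclidean_space \<Rightarrow> complex"
  assumes "f \<in> borel_measurable borel"
  shows "(LINT x|lborel. f (- x)) = integral\<^sup>L lborel f"
proof -
  have T: "uminus \<in> measurable lborel (borel :: 'a measure)" by measurable
  have "lborel = distr lborel borel (uminus :: 'a \<Rightarrow> 'a)"
  proof -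
    have "(\<lambda>x. 0 + (-1) *\<^sub>R x) = (uminus :: 'a \<Rightarrow> 'a)" by auto
    then show ?thesis using lborel_affine[of "-1" "0::'a"] by (simp add: density_1)
  qed
  then have "integral\<^sup>L lborel f = integral\<^sup>L (distr lborel borel uminus) f" by simp
  also have "\<dots> = (LINT x|lborel. f (- x))" by (rule integral_distr[OF T assms])
  finally show ?thesis by simp
qed

text \<open>Fourier inversion at the point \<open>0\<close>.\<close>
lemma integral_kernel:
  assumes m: "schwartz m"
  shows "integral\<^sup>L lborel (kernel m 0) = m (0 :: real^'n::finite)"
proof -
  have "of_real (1 / (2 * pi) ^ CARD('n)) * m (0::real^'n) = inverse_fourier (kernel m 0) 0"
    by (simp add: inverse_fourier_kernel[OF m])
  also have "\<dots> = integral\<^sup>L lborel (kernel m 0) / of_real ((2 * pi) ^ CARD('n))"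
    by (simp add: inverse_fourier_def)
  finally show ?thesis by (simp add: field_simps)
qed

text \<open>Transposed onto the test function, the operator averages \<open>b\<close> against an approximate identity.
These averages converge at every continuity point of \<open>b\<close> and inherit its decay, so they are dominated.\<close>
lemma multiplier_op_tendsto_weakly:
  fixes u :: "real^'n::finite \<Rightarrow> complex" and b :: "real^'n \<Rightarrow> real"
  assumes m: "schwartz m" and m0: "m 0 = 1"
    and u [measurable]: "u \<in> borel_measurable borel" and u2: "L2_sq u < \<infinity>"
    and b [measurable]: "b \<in> borel_measurable borel" and b_le: "\<And>x. \<bar>b x\<bar> \<le> decay_weight x"
    and b_cont: "AE x in lborel. isCont b x"
  shows "(\<lambda>N. LINT x|lborel. multiplier_op (dilate (2 ^ N) m) u x * of_real (b x))
    \<longlonglongrightarrow> (LINT x|lborel. u x * of_real (b x))"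
proof -
  define k where "k = kernel m 0"
  have ks: "schwartz k" unfolding k_def by (rule schwartz_kernel[OF m])
  have krs: "schwartz (\<lambda>z. k (- z))" using schwartz_dilation[OF ks, of "-1"] by simp
  note [measurable] = schwartz_measurable[OF ks] schwartz_measurable[OF krs]
  define K where "K N x y = kernel (dilate (2 ^ N) m) x y" for N x y
  have K: "K N x y = of_real ((2 ^ N) ^ CARD('n)) * k (2 ^ N *\<^sub>R (y - x))" for N x y
    unfolding K_def k_def by (rule kernel_dilation) (use schwartz_measurable[OF m] in auto)
  have Kmeas [measurable]: "(\<lambda>(x, y). K N x y) \<in> borel_measurable (borel \<Otimes>\<^sub>M borel)" for N
    unfolding K by measurable
  define c where "c N y = (LINT x|lborel. K N x y * of_real (b x))" for N y
  have c: "c N y = (LINT z|lborel. k (- z) * of_real (b (y + (1 / 2 ^ N) *\<^sub>R z)))" for N y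
  proof -
    have "c N y = (1 / 2 ^ N) ^ DIM(real^'n) *\<^sub>R (LINT z|lborel. K N (y + (1 / 2 ^ N) *\<^sub>R z) y * of_real (b (y + (1 / 2 ^ N) *\<^sub>R z)))"
      unfolding c_def by (rule lborel_affine_change(2)) (auto simp: K)
    also have "\<dots> = (LINT z|lborel. (1 / 2 ^ N) ^ DIM(real^'n) *\<^sub>R (K N (y + (1 / 2 ^ N) *\<^sub>R z) y * of_real (b (y + (1 / 2 ^ N) *\<^sub>R z))))"
      by (rule integral_scaleR_right[symmetric])
    also have "\<dots> = (LINT z|lborel. k (- z) * of_real (b (y + (1 / 2 ^ N) *\<^sub>R z)))"
    proof (rule Bochner_Integration.integral_cong[OF refl])
      fix z :: "real^'n"
      have "complex_of_real ((1 / 2 ^ N) ^ CARD('n)) * of_real ((2 ^ N) ^ CARD('n)) = 1"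
        unfolding of_real_mult[symmetric] power_mult_distrib[symmetric] by simp
      moreover have "2 ^ N *\<^sub>R (y - (y + (1 / 2 ^ N) *\<^sub>R z)) = - z" by simp
      ultimately show "(1 / 2 ^ N) ^ DIM(real^'n) *\<^sub>R (K N (y + (1 / 2 ^ N) *\<^sub>R z) y * of_real (b (y + (1 / 2 ^ N) *\<^sub>R z))) =
          k (- z) * of_real (b (y + (1 / 2 ^ N) *\<^sub>R z))"
        unfolding K scaleR_conv_of_real by (simp only: mult.assoc[symmetric] DIM_cart DIM_real mult_1_right mult_1_left)
    qed
    finally show ?thesis .
  qed
  have b1: "\<bar>b x\<bar> \<le> 1" for x using b_le[of x] decay_weight_le_1[of x] by linarith
  have step1: "(LINT x|lborel. multiplier_op (dilate (2 ^ N) m) u x * of_real (b x)) =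
      (LINT y|lborel. u y * c N y)" for N
  proof -
    let ?F = "\<lambda>x y. u y * K N x y * of_real (b x)"
    have "(LINT x|lborel. multiplier_op (dilate (2 ^ N) m) u x * of_real (b x)) =
        (LINT x|lborel. (LINT y|lborel. ?F x y))"
      by (simp add: multiplier_op_def K_def)
    also have "\<dots> = (LINT y|lborel. (LINT x|lborel. ?F x y))"
    proof (rule lborel_pair.Fubini_integral)
      define V where "V x = (\<integral>\<^sup>+y. ennreal (norm (u y)) * ennreal (norm (K N x y)) \<partial>lborel)" for x
      have [measurable]: "V \<in> borel_measurable borel" unfolding V_def by measurable
      have V2: "(\<integral>\<^sup>+x. V x ^ 2 \<partial>lborel) < \<infinity>"
      proof -
        have "(\<integral>\<^sup>+x. V x ^ 2 \<partial>lborel) \<le> ennreal ((kernel_L1 m)\<^sup>2) * L2_sq u"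
          unfolding V_def K_def by (rule young_L2[OF _ m u]) simp
        also have "\<dots> < \<infinity>" using u2 by (simp add: ennreal_mult_less_top)
        finally show ?thesis .
      qed
      have sw: "integrable (lborel \<Otimes>\<^sub>M lborel) (\<lambda>(x, y). ?F x y)"
      proof (rule integrableI_bounded)
        have "(\<integral>\<^sup>+p. ennreal (norm (case p of (x, y) \<Rightarrow> ?F x y)) \<partial>(lborel \<Otimes>\<^sub>M lborel)) =
          (\<integral>\<^sup>+x. (\<integral>\<^sup>+y. ennreal (norm (?F x y)) \<partial>lborel) \<partial>lborel)"
          by (subst lborel.nn_integral_fst[symmetric]) auto
        also have "\<dots> = (\<integral>\<^sup>+x. V x * ennreal \<bar>b x\<bar> \<partial>lborel)"
          unfolding V_def by (intro nn_integral_cong, subst nn_integral_multc[symmetric])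
            (auto simp: norm_mult ennreal_mult)
        also have "(\<dots>)\<^sup>2 \<le> (\<integral>\<^sup>+x. V x ^ 2 \<partial>lborel) * (\<integral>\<^sup>+x. ennreal \<bar>b x\<bar> ^ 2 \<partial>lborel)"
          by (rule Cauchy_Schwarz_nn_integral) measurable
        also have "(\<integral>\<^sup>+x. ennreal \<bar>b x\<bar> ^ 2 \<partial>lborel) \<le> (\<integral>\<^sup>+x. ennreal (decay_weight (x::real^'n)) ^ 2 \<partial>lborel)"
          by (intro nn_integral_mono power_mono ennreal_leI b_le) simp
        also have "(\<integral>\<^sup>+x. V x ^ 2 \<partial>lborel) * (\<integral>\<^sup>+x. ennreal (decay_weight (x::real^'n)) ^ 2 \<partial>lborel) < \<infinity>"
          using V2 decay_weight_L2[where 'n='n] by (simp add: ennreal_mult_less_top)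
        finally show "(\<integral>\<^sup>+p. ennreal (norm (case p of (x, y) \<Rightarrow> ?F x y)) \<partial>(lborel \<Otimes>\<^sub>M lborel)) < \<infinity>"
          by (simp add: power_less_top_ennreal mult_left_mono)
      qed measurable
      show "integrable (lborel \<Otimes>\<^sub>M lborel) (\<lambda>(y, x). ?F x y)"
        using lborel_pair.integrable_product_swap[OF sw] by simp
    qed
    also have "\<dots> = (LINT y|lborel. u y * c N y)"
      unfolding c_def by (simp add: mult.assoc)
    finally show ?thesis .
  qed
  let ?C = "LINT z|lborel. (1 + norm z) ^ (2 * CARD('n)) * norm (k (- z))"
  have wi: "integrable lborel (\<lambda>z. (1 + norm z) ^ (2 * CARD('n)) * norm (k (- z)))"
    by (rule schwartz_upto_0_weighted_integrable[OF schwartz_imp_upto[OF krs]])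
  have [measurable]: "c N \<in> borel_measurable borel" for N unfolding c by measurable
  have ki: "integrable lborel (\<lambda>z. k (- z) * of_real (b (y + (1 / 2 ^ N) *\<^sub>R z)))" for y N
    by (rule Bochner_Integration.integrable_bound[OF schwartz_integrable[OF krs]])
      (auto simp: norm_mult intro!: AE_I2 mult_right_le_one_le b1)
  have c_le: "norm (c N y) \<le> ?C * decay_weight y" for N y
  proof -
    have "norm (c N y) \<le> (LINT z|lborel. (1 + norm z) ^ (2 * CARD('n)) * norm (k (- z)) * decay_weight y)"
      unfolding c
    proof (rule Bochner_Integration.integral_norm_bound_integral[OF ki])
      show "integrable lborel (\<lambda>z. (1 + norm z) ^ (2 * CARD('n)) * norm (k (- z)) * decay_weight y)"
        by (intro integrable_mult_left wi)
      fix z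
      have "\<bar>b (y + (1 / 2 ^ N) *\<^sub>R z)\<bar> \<le> (1 + norm z) ^ (2 * CARD('n)) * decay_weight y"
        by (rule order_trans[OF b_le decay_weight_shift]) (auto simp: divide_le_eq_1)
      from mult_left_mono[OF this norm_ge_zero[of "k (- z)"]]
      show "norm (k (- z) * of_real (b (y + (1 / 2 ^ N) *\<^sub>R z))) \<le> (1 + norm z) ^ (2 * CARD('n)) * norm (k (- z)) * decay_weight y"
        by (simp add: norm_mult mult_ac)
    qed
    then show ?thesis by simp
  qed
  have c_lim: "(\<lambda>N. c N y) \<longlonglongrightarrow> of_real (b y)" if "isCont b y" for y
  proof -
    have "(\<lambda>N. c N y) \<longlonglongrightarrow> (LINT z|lborel. k (- z) * of_real (b y))"
      unfolding c
    proof (rule integral_dominated_convergence)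
      show "integrable lborel (\<lambda>z. norm (k (- z)))" by (intro integrable_norm schwartz_integrable krs)
      show "AE z in lborel. norm (k (- z) * of_real (b (y + (1 / 2 ^ N) *\<^sub>R z))) \<le> norm (k (- z))" for N
        by (auto simp: norm_mult intro!: AE_I2 mult_right_le_one_le b1)
      have "(\<lambda>N. (1 / 2 ^ N :: real)) \<longlonglongrightarrow> 0"
        using LIMSEQ_realpow_zero[of "1/2"] by (simp add: power_one_over)
      then have "(\<lambda>N. y + (1 / 2 ^ N) *\<^sub>R z) \<longlonglongrightarrow> y" for z
        using tendsto_add[OF tendsto_const[of y] tendsto_scaleR[OF _ tendsto_const[of z]]] by force
      then have "(\<lambda>N. b (y + (1 / 2 ^ N) *\<^sub>R z)) \<longlonglongrightarrow> b y" for z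
        by (rule isCont_tendsto_compose[OF that])
      then show "AE z in lborel. (\<lambda>N. k (- z) * of_real (b (y + (1 / 2 ^ N) *\<^sub>R z))) \<longlonglongrightarrow> k (- z) * of_real (b y)"
        by (intro AE_I2 tendsto_intros)
    qed measurable
    moreover have "(LINT z|lborel. k (- z) * of_real (b y)) = of_real (b y)"
    proof -
      have "(LINT z|lborel. k (- z)) = 1"
        using lborel_reflect[of k] integral_kernel[OF m] m0 schwartz_measurable[OF ks] by (simp add: k_def)
      then show ?thesis by simp
    qed
    ultimately show ?thesis by (simp only:)
  qed
  have "(\<lambda>N. LINT y|lborel. u y * c N y) \<longlonglongrightarrow> (LINT y|lborel. u y * of_real (b y))"
  proof (rule integral_dominated_convergence)
    have "integrable lborel (\<lambda>y. u y * of_real (decay_weight y))"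
      by (rule integrable_mult_L2) (use u2 decay_weight_L2[where 'n='n] in \<open>auto simp: abs_of_pos decay_weight_pos\<close>)
    then show "integrable lborel (\<lambda>y. ?C * norm (u y * of_real (decay_weight y)))"
      by (intro integrable_mult_right integrable_norm)
    show "AE y in lborel. norm (u y * c N y) \<le> ?C * norm (u y * of_real (decay_weight y))" for N
    proof (rule AE_I2)
      fix y
      from mult_left_mono[OF c_le norm_ge_zero[of "u y"]]
      show "norm (u y * c N y) \<le> ?C * norm (u y * of_real (decay_weight y))"
        using decay_weight_pos[of y] by (simp add: norm_mult mult_ac)
    qed
    show "AE y in lborel. (\<lambda>N. u y * c N y) \<longlonglongrightarrow> u y * of_real (b y)"
      using b_cont by eventually_elim (intro tendsto_intros c_lim)
  qed measurable
  then show ?thesis unfolding step1 .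
qed

text \<open>The discontinuities lie on the boundary of the box, a null set.\<close>
lemma weighted_box_indicator:
  fixes p q :: "real^'n::finite"
  defines "b \<equiv> \<lambda>x. indicator (box p q) x * decay_weight x"
  shows "b \<in> borel_measurable borel" "\<bar>b x\<bar> \<le> decay_weight x" "AE x in lborel. isCont b x"
proof -
  show "b \<in> borel_measurable borel" unfolding b_def by measurable
  show "\<bar>b x\<bar> \<le> decay_weight x"
    using decay_weight_pos[of x] by (auto simp: b_def indicator_def)
  have "AE x in lborel. x \<notin> cbox p q - box p q"
    by (rule AE_not_in[OF null_sets_cbox_Diff_box])
  then show "AE x in lborel. isCont b x"
  proof eventually_elim
    case (elim x)
    then consider "x \<in> box p q" | "x \<in> - cbox p q" by blast
    then show ?case
    proof cases
      case 1
      have "\<forall>\<^sub>F y in nhds x. b y = decay_weight y"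
        using eventually_nhds_in_open[OF open_box 1] by (rule eventually_mono) (simp add: b_def)
      then show ?thesis using isCont_cong isCont_decay_weight by blast
    next
      case 2
      have "\<forall>\<^sub>F y in nhds x. b y = 0"
        using eventually_nhds_in_open[OF open_Compl[OF closed_cbox] 2]
        by (rule eventually_mono) (use box_subset_cbox[of p q] in \<open>auto simp: b_def indicator_def\<close>)
      then show ?thesis using isCont_cong[of b "\<lambda>_. 0"] by simp
    qed
  qed
qed

text \<open>Tested against a weighted indicator of a box, the truncations of \<open>u\<close> converge to \<open>u\<close> by the
approximate identity property and to \<open>v\<close> by dominated convergence. Hence \<open>u - v\<close>, weighted, has
integral \<open>0\<close> over every box.\<close>
lemma multiplier_op_limit_unique:
  fixes u v :: "real^'n::finite \<Rightarrow> complex" and W :: "real^'n \<Rightarrow> real"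
  assumes m: "schwartz m" and m0: "m 0 = 1"
    and u [measurable]: "u \<in> borel_measurable borel" and u2: "L2_sq u < \<infinity>"
    and v [measurable]: "v \<in> borel_measurable borel"
    and W [measurable]: "W \<in> borel_measurable borel" and W2: "(\<integral>\<^sup>+x. ennreal \<bar>W x\<bar> ^ 2 \<partial>lborel) < \<infinity>"
    and le: "\<And>N. AE x in lborel. norm (multiplier_op (dilate (2 ^ N) m) u x) \<le> W x"
    and lim: "AE x in lborel. (\<lambda>N. multiplier_op (dilate (2 ^ N) m) u x) \<longlonglongrightarrow> v x"
  shows "AE x in lborel. u x = v x"
proof -
  let ?S = "\<lambda>N. multiplier_op (dilate (2 ^ N) m) u"
  have [measurable]: "?S N \<in> borel_measurable borel" for N
    by (rule multiplier_op_measurable[OF _ m u]) simp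
  have vW: "AE x in lborel. norm (v x) \<le> W x"
  proof -
    have "AE x in lborel. \<forall>N. norm (?S N x) \<le> W x" using le by (simp add: AE_all_countable)
    with lim show ?thesis
    proof eventually_elim
      case (elim x)
      from tendsto_norm[OF elim(1)] show ?case
        by (rule LIMSEQ_le_const2) (use elim(2) in blast)
    qed
  qed
  have wd: "(\<integral>\<^sup>+x. ennreal (norm (complex_of_real (decay_weight (x::real^'n)))) ^ 2 \<partial>lborel) < \<infinity>"
    using decay_weight_L2[where 'n='n] by (simp add: abs_of_pos decay_weight_pos)
  have Wd: "integrable lborel (\<lambda>x. norm (complex_of_real (W x) * of_real (decay_weight x)))"
    by (intro integrable_norm integrable_mult_L2 wd) (use W2 in auto)
  have ui: "integrable lborel (\<lambda>x. u x * of_real (decay_weight x))"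
    by (rule integrable_mult_L2[OF _ _ u2 wd]) auto
  have vi: "integrable lborel (\<lambda>x. v x * of_real (decay_weight x))"
  proof (rule Bochner_Integration.integrable_bound[OF Wd], measurable)
    show "AE x in lborel. norm (v x * of_real (decay_weight x)) \<le> norm (norm (complex_of_real (W x) * of_real (decay_weight x)))"
      using vW by eventually_elim (auto simp: norm_mult intro!: mult_right_mono)
  qed
  have "AE x in lborel. (u x - v x) * of_real (decay_weight x) = 0"
  proof (rule AE_zero_if_box_integrals_zero)
    show "integrable lborel (\<lambda>x. (u x - v x) * of_real (decay_weight x))"
      using Bochner_Integration.integrable_diff[OF ui vi] by (simp add: left_diff_distrib)
    fix p q :: "real^'n"
    define b where "b x = indicator (box p q) x * decay_weight x" for x
    note b = weighted_box_indicator[of p q, folded b_def]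
    note [measurable] = b(1)
    have ub: "integrable lborel (\<lambda>x. u x * of_real (b x))"
      by (rule Bochner_Integration.integrable_bound[OF ui])
        (auto simp: norm_mult intro!: AE_I2 mult_left_mono order_trans[OF b(2) abs_ge_self])
    have vb: "integrable lborel (\<lambda>x. v x * of_real (b x))"
      by (rule Bochner_Integration.integrable_bound[OF vi])
        (auto simp: norm_mult intro!: AE_I2 mult_left_mono order_trans[OF b(2) abs_ge_self])
    have 1: "(\<lambda>N. LINT x|lborel. ?S N x * of_real (b x)) \<longlonglongrightarrow> (LINT x|lborel. u x * of_real (b x))"
      by (rule multiplier_op_tendsto_weakly[OF m m0 u u2 b])
    have 2: "(\<lambda>N. LINT x|lborel. ?S N x * of_real (b x)) \<longlonglongrightarrow> (LINT x|lborel. v x * of_real (b x))"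
    proof (rule integral_dominated_convergence[OF _ _ Wd])
      show "AE x in lborel. (\<lambda>N. ?S N x * of_real (b x)) \<longlonglongrightarrow> v x * of_real (b x)"
        using lim by eventually_elim (intro tendsto_intros)
      show "AE x in lborel. norm (?S N x * of_real (b x)) \<le> norm (complex_of_real (W x) * of_real (decay_weight x))" for N
        using le[of N]
      proof eventually_elim
        case (elim x)
        have "norm (?S N x) * \<bar>b x\<bar> \<le> \<bar>W x\<bar> * decay_weight x"
          using elim b(2)[of x] by (intro mult_mono) auto
        then show ?case using decay_weight_pos[of x] by (simp add: norm_mult)
      qed
    qed measurable
    have "(LINT x:box p q|lborel. (u x - v x) * of_real (decay_weight x)) =
        (LINT x|lborel. u x * of_real (b x) - v x * of_real (b x))"
      unfolding set_lebesgue_integral_def b_def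
      by (intro Bochner_Integration.integral_cong refl) (auto simp: indicator_def left_diff_distrib)
    also have "\<dots> = 0"
      using LIMSEQ_unique[OF 1 2] by (simp add: Bochner_Integration.integral_diff[OF ub vb])
    finally show "(LINT x:box p q|lborel. (u x - v x) * of_real (decay_weight x)) = 0" .
  qed
  then show ?thesis
  proof eventually_elim
    case (elim x)
    then show ?case using decay_weight_pos[of x] by simp
  qed
qed

section \<open>Sums of functions in Lebesgue spaces\<close>

text \<open>Jensen's inequality on the closed half-line. The arguments are shifted into the open half-line,
where the power function is known to be convex, and the shift is removed in the limit.\<close>
lemma powr_sum_convex:
  fixes y \<mu> :: "'i \<Rightarrow> real"
  assumes I: "finite I" "I \<noteq> {}" and p: "p \<ge> 1" and \<mu>: "\<And>i. i \<in> I \<Longrightarrow> \<mu> i \<ge> 0" "(\<Sum>i\<in>I. \<mu> i) = 1"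
    and y: "\<And>i. i \<in> I \<Longrightarrow> y i \<ge> 0"
  shows "(\<Sum>i\<in>I. \<mu> i * y i) powr p \<le> (\<Sum>i\<in>I. \<mu> i * y i powr p)"
proof (rule LIMSEQ_le_const)
  let ?e = "\<lambda>n. 1 / real (Suc n)"
  show "(\<lambda>n. \<Sum>i\<in>I. \<mu> i * (y i + ?e n) powr p) \<longlonglongrightarrow> (\<Sum>i\<in>I. \<mu> i * y i powr p)"
  proof (intro tendsto_sum tendsto_mult tendsto_const)
    fix i assume i: "i \<in> I"
    have "(\<lambda>n. y i + ?e n) \<longlonglongrightarrow> y i + 0"
      by (intro tendsto_add tendsto_const LIMSEQ_Suc[OF lim_1_over_n])
    then show "(\<lambda>n. (y i + ?e n) powr p) \<longlonglongrightarrow> y i powr p"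
      using p y[OF i] by (intro tendsto_powr' tendsto_const) (auto intro!: always_eventually)
  qed
  show "\<exists>N. \<forall>n\<ge>N. (\<Sum>i\<in>I. \<mu> i * y i) powr p \<le> (\<Sum>i\<in>I. \<mu> i * (y i + ?e n) powr p)"
  proof (intro exI allI impI)
    fix n
    have e: "?e n > 0" by simp
    have "(\<Sum>i\<in>I. \<mu> i * y i) powr p \<le> (\<Sum>i\<in>I. \<mu> i *\<^sub>R (y i + ?e n)) powr p"
      unfolding real_scaleR_def
      by (intro powr_mono2 sum_mono mult_left_mono sum_nonneg mult_nonneg_nonneg \<mu> y) (use p in auto)
    also have "\<dots> \<le> (\<Sum>i\<in>I. \<mu> i * (y i + ?e n) powr p)"
      by (rule convex_on_sum[OF I powr_convex[OF p] \<mu>(2)]) (use \<mu> y e in \<open>auto intro: add_nonneg_pos\<close>)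
    finally show "(\<Sum>i\<in>I. \<mu> i * y i) powr p \<le> (\<Sum>i\<in>I. \<mu> i * (y i + ?e n) powr p)" .
  qed
qed

text \<open>Minkowski's inequality for given bounds \<open>M i\<close> on the norms: Jensen's inequality with weights
proportional to \<open>M i\<close>.\<close>
lemma nn_integral_sum_powr_le:
  fixes a :: "'i \<Rightarrow> 'a \<Rightarrow> real"
  assumes I: "finite I" and p: "p \<ge> 1"
    and a [measurable]: "\<And>i. i \<in> I \<Longrightarrow> a i \<in> borel_measurable \<Omega>" and a0: "\<And>i x. i \<in> I \<Longrightarrow> a i x \<ge> 0"
    and M: "\<And>i. i \<in> I \<Longrightarrow> M i > 0"
    and le: "\<And>i. i \<in> I \<Longrightarrow> (\<integral>\<^sup>+x. ennreal (a i x powr p) \<partial>\<Omega>) \<le> ennreal (M i powr p)"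
  shows "(\<integral>\<^sup>+x. ennreal ((\<Sum>i\<in>I. a i x) powr p) \<partial>\<Omega>) \<le> ennreal ((\<Sum>i\<in>I. M i) powr p)"
proof (cases "I = {}")
  case True
  then show ?thesis by simp
next
  case False
  define S where "S = (\<Sum>i\<in>I. M i)"
  have S: "S > 0" unfolding S_def by (rule sum_pos[OF I False M])
  define c where "c i = (M i / S) * (S / M i) powr p" for i
  have c0: "c i \<ge> 0" if "i \<in> I" for i using M[OF that] S by (simp add: c_def)
  have pt: "(\<Sum>i\<in>I. a i x) powr p \<le> (\<Sum>i\<in>I. c i * a i x powr p)" for x
  proof -
    have "(\<Sum>i\<in>I. a i x) = (\<Sum>i\<in>I. M i / S * (S / M i * a i x))"
    proof (intro sum.cong refl)
      fix i assume "i \<in> I"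
      from M[OF this] S show "a i x = M i / S * (S / M i * a i x)" by simp
    qed
    also have "(\<dots>) powr p \<le> (\<Sum>i\<in>I. M i / S * (S / M i * a i x) powr p)"
      using I False p M S a0
      by (intro powr_sum_convex) (auto simp: sum_divide_distrib[symmetric] S_def[symmetric] less_imp_le)
    also have "\<dots> = (\<Sum>i\<in>I. c i * a i x powr p)"
      unfolding c_def mult.assoc
      by (intro sum.cong refl arg_cong[where f="\<lambda>t. _ * t"] powr_mult)
    finally show ?thesis .
  qed
  have "(\<integral>\<^sup>+x. ennreal ((\<Sum>i\<in>I. a i x) powr p) \<partial>\<Omega>) \<le> (\<integral>\<^sup>+x. (\<Sum>i\<in>I. ennreal (c i) * ennreal (a i x powr p)) \<partial>\<Omega>)"
  proof (rule nn_integral_mono)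
    fix x
    have "ennreal ((\<Sum>i\<in>I. a i x) powr p) \<le> ennreal (\<Sum>i\<in>I. c i * a i x powr p)"
      by (rule ennreal_leI[OF pt])
    also have "\<dots> = (\<Sum>i\<in>I. ennreal (c i * a i x powr p))"
      using c0 by (subst sum_ennreal) auto
    also have "\<dots> = (\<Sum>i\<in>I. ennreal (c i) * ennreal (a i x powr p))"
      using c0 by (intro sum.cong refl ennreal_mult) auto
    finally show "ennreal ((\<Sum>i\<in>I. a i x) powr p) \<le> (\<Sum>i\<in>I. ennreal (c i) * ennreal (a i x powr p))" .
  qed
  also have "\<dots> = (\<Sum>i\<in>I. ennreal (c i) * (\<integral>\<^sup>+x. ennreal (a i x powr p) \<partial>\<Omega>))"
    by (subst nn_integral_sum) (auto intro!: sum.cong nn_integral_cmult)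
  also have "\<dots> \<le> (\<Sum>i\<in>I. ennreal (c i) * ennreal (M i powr p))"
    by (intro sum_mono mult_left_mono le) auto
  also have "\<dots> = (\<Sum>i\<in>I. ennreal (M i / S * S powr p))"
  proof (intro sum.cong refl)
    fix i assume i: "i \<in> I"
    have "(S / M i) powr p * M i powr p = S powr p"
      using M[OF i] S by (simp add: powr_divide)
    then have "c i * M i powr p = M i / S * S powr p" by (simp add: c_def mult.assoc)
    then show "ennreal (c i) * ennreal (M i powr p) = ennreal (M i / S * S powr p)"
      using c0[OF i] by (simp add: ennreal_mult[symmetric])
  qed
  also have "\<dots> = ennreal (\<Sum>i\<in>I. M i / S * S powr p)"
    using M S by (intro sum_ennreal) (auto simp: less_imp_le)
  also have "(\<Sum>i\<in>I. M i / S * S powr p) = S powr p"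
    unfolding sum_distrib_right[symmetric] sum_divide_distrib[symmetric] S_def[symmetric] using S by simp
  finally show ?thesis unfolding S_def .
qed

text \<open>Monotone convergence. Because the supremum of the powers of the partial sums is integrable, the
partial sums are almost everywhere bounded, so the series converge.\<close>
lemma nn_integral_series_powr_le:
  fixes a :: "'i \<Rightarrow> nat \<Rightarrow> 'a \<Rightarrow> real"
  assumes I: "finite I" and p: "p \<ge> 1"
    and a [measurable]: "\<And>i k. a i k \<in> borel_measurable \<Omega>" and a0: "\<And>i k x. a i k x \<ge> 0"
    and M: "\<And>i k. M i k > 0"
    and le: "\<And>i k. i \<in> I \<Longrightarrow> (\<integral>\<^sup>+x. ennreal (a i k x powr p) \<partial>\<Omega>) \<le> ennreal (M i k powr p)"
    and T: "\<And>K. (\<Sum>i\<in>I. \<Sum>k<K. M i k) \<le> T"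
  shows "AE x in \<Omega>. \<forall>i\<in>I. summable (\<lambda>k. a i k x)"
    and "(\<integral>\<^sup>+x. ennreal ((\<Sum>i\<in>I. \<Sum>k. a i k x) powr p) \<partial>\<Omega>) \<le> ennreal (T powr p)"
proof -
  define S where "S K x = (\<Sum>i\<in>I. \<Sum>k<K. a i k x)" for K x
  have [measurable]: "S K \<in> borel_measurable \<Omega>" for K unfolding S_def by measurable
  have S0: "S K x \<ge> 0" for K x unfolding S_def by (intro sum_nonneg a0)
  have mono: "S K x \<le> S L x" if "K \<le> L" for K L x
    unfolding S_def using that by (intro sum_mono sum_mono2) (auto simp: a0)
  have int: "(\<integral>\<^sup>+x. ennreal (S K x powr p) \<partial>\<Omega>) \<le> ennreal (T powr p)" for K
  proof -
    have "(\<integral>\<^sup>+x. ennreal ((\<Sum>j\<in>I \<times> {..<K}. a (fst j) (snd j) x) powr p) \<partial>\<Omega>) \<le>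
        ennreal ((\<Sum>j\<in>I \<times> {..<K}. M (fst j) (snd j)) powr p)"
      by (rule nn_integral_sum_powr_le) (use I p a0 M le in auto)
    also have "\<dots> \<le> ennreal (T powr p)"
    proof (intro ennreal_leI powr_mono2)
      show "0 \<le> (\<Sum>j\<in>I \<times> {..<K}. M (fst j) (snd j))" by (intro sum_nonneg less_imp_le M)
      show "(\<Sum>j\<in>I \<times> {..<K}. M (fst j) (snd j)) \<le> T"
        using T[of K] by (simp add: sum.cartesian_product case_prod_beta)
    qed (use p in simp)
    finally show ?thesis by (simp add: S_def sum.cartesian_product case_prod_beta)
  qed
  let ?G = "\<lambda>K x. ennreal (S K x powr p)"
  have "(\<integral>\<^sup>+x. (SUP K. ?G K x) \<partial>\<Omega>) = (SUP K. \<integral>\<^sup>+x. ?G K x \<partial>\<Omega>)"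
    by (intro nn_integral_monotone_convergence_SUP)
      (auto simp: incseq_def le_fun_def S0 p intro!: ennreal_leI powr_mono2 mono order_trans[OF zero_le_one p])
  also have "\<dots> \<le> ennreal (T powr p)" by (intro SUP_least int)
  finally have SUP: "(\<integral>\<^sup>+x. (SUP K. ?G K x) \<partial>\<Omega>) \<le> ennreal (T powr p)" .
  then have "(\<integral>\<^sup>+x. (SUP K. ?G K x) \<partial>\<Omega>) \<noteq> \<infinity>"
    by (metis ennreal_neq_top infinity_ennreal_def top.extremum_uniqueI)
  then have fin: "AE x in \<Omega>. (SUP K. ?G K x) \<noteq> \<infinity>"
    by (intro nn_integral_PInf_AE) measurable
  have sm: "summable (\<lambda>k. a i k x)" if x: "(SUP K. ?G K x) \<noteq> \<infinity>" and i: "i \<in> I" for x i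
  proof -
    obtain r where r: "r \<ge> 0" "(SUP K. ?G K x) = ennreal r"
      using x by (cases "SUP K. ?G K x") auto
    have "S K x \<le> r powr (1 / p)" for K
    proof -
      have "?G K x \<le> ennreal r" unfolding r(2)[symmetric] by (rule SUP_upper) simp
      then have "S K x powr p \<le> r" using r(1) by simp
      then have "(S K x powr p) powr (1 / p) \<le> r powr (1 / p)" using p by (intro powr_mono2) auto
      then show ?thesis using S0[of K x] p by (simp add: powr_powr)
    qed
    moreover have "(\<Sum>k<K. a i k x) \<le> S K x" for K
      unfolding S_def using i I by (intro member_le_sum) (auto intro: sum_nonneg a0)
    ultimately show ?thesis
      by (intro summableI_nonneg_bounded[where x="r powr (1 / p)"] a0) (rule order_trans)
  qed
  show "AE x in \<Omega>. \<forall>i\<in>I. summable (\<lambda>k. a i k x)"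
    using fin by eventually_elim (use sm in blast)
  have "(\<integral>\<^sup>+x. ennreal ((\<Sum>i\<in>I. \<Sum>k. a i k x) powr p) \<partial>\<Omega>) \<le> (\<integral>\<^sup>+x. (SUP K. ?G K x) \<partial>\<Omega>)"
  proof (rule nn_integral_mono_AE)
    show "AE x in \<Omega>. ennreal ((\<Sum>i\<in>I. \<Sum>k. a i k x) powr p) \<le> (SUP K. ?G K x)"
      using fin
    proof eventually_elim
      case (elim x)
      have "(\<lambda>K. S K x) \<longlonglongrightarrow> (\<Sum>i\<in>I. \<Sum>k. a i k x)"
        unfolding S_def by (intro tendsto_sum summable_LIMSEQ sm[OF elim])
      then have "(\<lambda>K. S K x powr p) \<longlonglongrightarrow> (\<Sum>i\<in>I. \<Sum>k. a i k x) powr p"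
        using p by (intro tendsto_powr' tendsto_const) (auto intro!: always_eventually S0)
      then have "(\<lambda>K. ?G K x) \<longlonglongrightarrow> ennreal ((\<Sum>i\<in>I. \<Sum>k. a i k x) powr p)"
        by (rule tendsto_ennrealI)
      then show ?case by (rule LIMSEQ_le_const2) (intro exI allI impI, rule SUP_upper, simp)
    qed
  qed
  with SUP show "(\<integral>\<^sup>+x. ennreal ((\<Sum>i\<in>I. \<Sum>k. a i k x) powr p) \<partial>\<Omega>) \<le> ennreal (T powr p)"
    by (rule order_trans[rotated])
qed

text \<open>Pointwise, \<open>|w|^q \<le> A^(q - 2) |w|\<^sup>2\<close>.\<close>
lemma nn_integral_powr_interpolation:
  fixes w :: "'a \<Rightarrow> 'b::real_normed_vector"
  assumes [measurable]: "(\<lambda>x. norm (w x)) \<in> borel_measurable \<Omega>"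
    and A: "\<And>x. norm (w x) \<le> A" and A0: "A \<ge> 0" and L: "L \<ge> 0" and q: "q > 2"
    and le: "(\<integral>\<^sup>+x. ennreal (norm (w x)) ^ 2 \<partial>\<Omega>) \<le> ennreal (L\<^sup>2)"
  shows "(\<integral>\<^sup>+x. ennreal (norm (w x) powr q) \<partial>\<Omega>) \<le> ennreal ((A powr (1 - 2/q) * L powr (2/q)) powr q)"
proof -
  have pt: "norm (w x) powr q \<le> A powr (q - 2) * (norm (w x))\<^sup>2" for x
  proof -
    have "norm (w x) powr q = norm (w x) powr (q - 2) * norm (w x) powr 2"
      using powr_add[of "norm (w x)" "q - 2" 2] by simp
    also have "\<dots> = norm (w x) powr (q - 2) * (norm (w x))\<^sup>2" by simp
    also have "\<dots> \<le> A powr (q - 2) * (norm (w x))\<^sup>2"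
      using A q by (intro mult_right_mono powr_mono2) auto
    finally show ?thesis .
  qed
  have "(\<integral>\<^sup>+x. ennreal (norm (w x) powr q) \<partial>\<Omega>) \<le> (\<integral>\<^sup>+x. ennreal (A powr (q - 2)) * ennreal (norm (w x)) ^ 2 \<partial>\<Omega>)"
    using pt by (intro nn_integral_mono) (simp add: ennreal_power ennreal_mult[symmetric] ennreal_leI)
  also have "\<dots> = ennreal (A powr (q - 2)) * (\<integral>\<^sup>+x. ennreal (norm (w x)) ^ 2 \<partial>\<Omega>)"
    by (rule nn_integral_cmult) measurable
  also have "\<dots> \<le> ennreal (A powr (q - 2)) * ennreal (L\<^sup>2)"
    by (intro mult_left_mono le) simp
  also have "\<dots> = ennreal (A powr (q - 2) * L\<^sup>2)" by (simp add: ennreal_mult)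
  also have "A powr (q - 2) * L\<^sup>2 = (A powr (1 - 2/q) * L powr (2/q)) powr q"
  proof -
    have "(1 - 2/q) * q = q - 2" "(2/q) * q = 2" using q by (auto simp: field_simps)
    then show ?thesis using L q by (simp add: powr_mult powr_powr)
  qed
  finally show ?thesis .
qed

section \<open>A two-sided geometric sum\<close>

text \<open>The index \<open>k\<close> stands for the frequency \<open>2^(k - 1)\<close>. The sum is split where this
frequency passes \<open>R = H / L\<close>; there the last increasing and the first decreasing term are both
comparable to the right-hand side. The factor \<open>3\<close> is \<open>2 + 1\<close>: the increasing part may overshoot \<open>R\<close>
by one dyadic step, costing \<open>2^a \<le> 2\<close>, the decreasing part costs nothing.\<close>
lemma dyadic_two_sided_sum:
  fixes L H a \<delta> :: real
  assumes L: "0 < L" "L \<le> H" and a: "a > 0" and \<delta>: "\<delta> > 0" and le1: "a + \<delta> \<le> 1"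
  obtains N :: nat where
    "\<And>K. (\<Sum>k<K. if k \<le> N then 2 powr ((real k - 1) * a) * L powr (a + \<delta>)
            else 2 powr (- (real k - 1) * \<delta>) * H powr (a + \<delta>)) \<le>
     3 * max (1 / (2 powr a - 1)) (1 / (1 - 2 powr (- \<delta>))) * L powr \<delta> * H powr a"
proof -
  define R where "R = H / L"
  have R1: "1 \<le> R" using L by (simp add: R_def)
  define n where "n = nat \<lfloor>log 2 R\<rfloor>"
  have lg: "0 \<le> log 2 R" using R1 by simp
  have n1: "real n \<le> log 2 R" and n2: "log 2 R < real n + 1"
    unfolding n_def using lg by (auto simp: of_nat_nat)
  have "2 powr real n \<le> 2 powr (log 2 R)" "2 powr (log 2 R) \<le> 2 powr (real n + 1)"
    using n1 n2 by (auto intro!: powr_mono)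
  then have Rn: "2 powr real n \<le> R" "R \<le> 2 powr (real n + 1)" using R1 by auto
  define x where "x = 2 powr a"
  define y where "y = 2 powr (- \<delta>)"
  have x1: "x > 1" unfolding x_def using powr_less_mono[of 0 a 2] a by simp
  have y01: "0 < y" "y < 1" unfolding y_def using powr_less_mono[of "- \<delta>" 0 2] \<delta> by auto
  have x2: "x \<le> 2" unfolding x_def using le1 \<delta> powr_mono[of a 1 2] by simp
  define m where "m k = (if k \<le> Suc n then 2 powr ((real k - 1) * a) * L powr (a + \<delta>)
            else 2 powr (- (real k - 1) * \<delta>) * H powr (a + \<delta>))" for k
  have xp: "2 powr ((real (Suc k) - 1) * a) = x ^ k" for k
    unfolding x_def by (simp add: powr_powr[symmetric] powr_realpow mult.commute[of _ a])
  have yp: "2 powr (- (real (Suc k) - 1) * \<delta>) = y ^ k" for k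
    unfolding y_def by (simp add: powr_power mult.commute)
  have x0: "2 powr ((real 0 - 1) * a) = 1 / x" unfolding x_def by (simp add: powr_minus divide_inverse)
  have low: "(\<Sum>k\<le>Suc n. 2 powr ((real k - 1) * a)) \<le> 2 * R powr a / (x - 1)"
  proof -
    have "(\<Sum>k\<le>Suc n. 2 powr ((real k - 1) * a)) = 1 / x + (\<Sum>k\<le>n. x ^ k)"
      unfolding sum.atMost_Suc_shift x0 xp ..
    also have "(\<Sum>k\<le>n. x ^ k) = (x ^ Suc n - 1) / (x - 1)"
      using x1 geometric_sum[of x "Suc n"] by (simp add: lessThan_Suc_atMost)
    also have "1 / x + (x ^ Suc n - 1) / (x - 1) \<le> x ^ Suc n / (x - 1)"
    proof -
      have "1 / x \<le> 1" "1 \<le> 1 / (x - 1)" using x1 x2 by auto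
      then have "1 / x \<le> 1 / (x - 1)" by linarith
      then show ?thesis by (simp add: diff_divide_distrib)
    qed
    also have "\<dots> \<le> 2 * R powr a / (x - 1)"
    proof (intro divide_right_mono)
      have "x ^ n = (2 powr real n) powr a"
        unfolding x_def by (simp add: powr_powr powr_realpow[symmetric] mult.commute)
      also have "\<dots> \<le> R powr a" using Rn(1) a by (intro powr_mono2) auto
      finally show "x ^ Suc n \<le> 2 * R powr a" using x1 x2 by (simp add: mult_mono)
    qed (use x1 in simp)
    finally show ?thesis .
  qed
  have high: "(\<Sum>k<K. y ^ (k + Suc n)) \<le> R powr (- \<delta>) / (1 - y)" for K
  proof -
    have "(\<Sum>k<K. y ^ (k + Suc n)) = y ^ Suc n * (\<Sum>k<K. y ^ k)"
      by (simp add: power_add sum_distrib_left mult_ac)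
    also have "(\<Sum>k<K. y ^ k) \<le> 1 / (1 - y)"
    proof -
      have "(\<Sum>k<K. y ^ k) = (1 - y ^ K) / (1 - y)"
        using y01 geometric_sum[of y K] by (simp add: divide_simps) (simp add: algebra_simps)?
      also have "\<dots> \<le> 1 / (1 - y)" using y01 by (intro divide_right_mono) auto
      finally show ?thesis .
    qed
    also have "y ^ Suc n * (1 / (1 - y)) \<le> R powr (- \<delta>) * (1 / (1 - y))"
    proof (intro mult_right_mono)
      have "y ^ Suc n = (2 powr (real n + 1)) powr (- \<delta>)"
        unfolding y_def by (simp add: powr_powr powr_realpow[symmetric] mult.commute algebra_simps flip: powr_add)
      also have "\<dots> \<le> R powr (- \<delta>)"
        using Rn(2) \<delta> R1 by (intro powr_mono2') auto
      finally show "y ^ Suc n \<le> R powr (- \<delta>)" .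
    qed (use y01 in simp)
    finally show ?thesis using y01 by (simp add: mult_left_mono)
  qed
  have m0: "m k \<ge> 0" for k by (simp add: m_def)
  show ?thesis
  proof (rule that[of "Suc n"], fold m_def)
    fix K
    have "(\<Sum>k<K. m k) \<le> (\<Sum>k<Suc (Suc n) + K. m k)"
      by (intro sum_mono2) (auto simp: m0)
    also have "\<dots> = (\<Sum>k\<le>Suc n. m k) + (\<Sum>k<K. m (Suc (Suc n) + k))"
    proof -
      have "(\<Sum>k<n + K. m k) = (\<Sum>k<n. m k) + (\<Sum>k<K. m (n + k))" for n
        by (induction K) (auto simp: add.assoc)
      then show ?thesis by (simp only: lessThan_Suc_atMost)
    qed
    also have "(\<Sum>k\<le>Suc n. m k) = (\<Sum>k\<le>Suc n. 2 powr ((real k - 1) * a)) * L powr (a + \<delta>)"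
      unfolding sum_distrib_right by (intro sum.cong refl) (simp add: m_def)
    also have "\<dots> \<le> (2 * R powr a / (x - 1)) * L powr (a + \<delta>)"
      by (intro mult_right_mono low) simp
    also have "\<dots> = 2 * (1 / (x - 1)) * L powr \<delta> * H powr a"
      using L by (simp add: R_def powr_divide powr_add)
    also have "(\<Sum>k<K. m (Suc (Suc n) + k)) = (\<Sum>k<K. y ^ (k + Suc n)) * H powr (a + \<delta>)"
      unfolding sum_distrib_right
    proof (intro sum.cong refl)
      fix k
      have "m (Suc (Suc n) + k) = 2 powr (- (real (Suc (k + Suc n)) - 1) * \<delta>) * H powr (a + \<delta>)"
        by (simp add: m_def add_ac)
      then show "m (Suc (Suc n) + k) = y ^ (k + Suc n) * H powr (a + \<delta>)" unfolding yp .
    qed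
    also have "\<dots> \<le> (R powr (- \<delta>) / (1 - y)) * H powr (a + \<delta>)"
      by (intro mult_right_mono high) simp
    also have "\<dots> = (1 / (1 - y)) * L powr \<delta> * H powr a"
      using L by (simp add: R_def powr_divide powr_add powr_minus divide_simps)
    also have "2 * (1 / (x - 1)) * L powr \<delta> * H powr a + (1 / (1 - y)) * L powr \<delta> * H powr a =
        (2 * (1 / (x - 1)) + 1 / (1 - y)) * (L powr \<delta> * H powr a)"
      by (simp add: algebra_simps)
    also have "\<dots> \<le> (3 * max (1 / (x - 1)) (1 / (1 - y))) * (L powr \<delta> * H powr a)"
      by (intro mult_right_mono) (auto simp: max_def)
    finally show "(\<Sum>k<K. m k) \<le> 3 * max (1 / (2 powr a - 1)) (1 / (1 - 2 powr (- \<delta>))) * L powr \<delta> * H powr a"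
      unfolding x_def y_def by (simp only: mult.assoc)
  qed
qed

section \<open>Estimates for dyadic blocks\<close>

text \<open>Symbols of the dyadic blocks, indexed from \<open>0\<close>: block \<open>k\<close> is \<open>\<Delta>\<^sub>j\<close> with \<open>j = k - 1\<close>.\<close>
definition block_symbol :: "(real^'n::finite \<Rightarrow> real) \<Rightarrow> (real^'n \<Rightarrow> real) \<Rightarrow> nat \<Rightarrow> real^'n \<Rightarrow> real" where
  "block_symbol chi phi k \<xi> = (case k of 0 \<Rightarrow> chi \<xi> | Suc j \<Rightarrow> phi ((1 / 2 ^ j) *\<^sub>R \<xi>))"

lemma two_powi_minus: "(2::real) powi (- int j) = 1 / 2 ^ j"
  by (simp add: power_int_minus divide_inverse)

lemma dyadic_block_eq:
  "dyadic_block chi phi (int k - 1) T = fourier_multiplier (block_symbol chi phi k) T"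
  by (cases k) (auto simp: dyadic_block_def block_symbol_def[abs_def] two_powi_minus)

lemma dyadic_partitionD:
  assumes "dyadic_partition chi phi"
  shows "schwartz chi" "schwartz phi"
    and "chi \<xi> \<noteq> 0 \<Longrightarrow> norm \<xi> \<le> 4/3"
    and "phi \<xi> \<noteq> 0 \<Longrightarrow> 3/4 \<le> norm \<xi>" "phi \<xi> \<noteq> 0 \<Longrightarrow> norm \<xi> \<le> 8/3"
    and "summable (\<lambda>j. phi ((1 / 2 ^ j) *\<^sub>R \<xi>))" "chi \<xi> + (\<Sum>j. phi ((1 / 2 ^ j) *\<^sub>R \<xi>)) = 1"
  using assms unfolding dyadic_partition_def two_powi_minus by blast+

lemma dyadic_chi_eq_1:
  assumes dp: "dyadic_partition chi phi" and \<xi>: "norm \<xi> < 3/4"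
  shows "chi \<xi> = 1"
proof -
  have "phi ((1 / 2 ^ j) *\<^sub>R \<xi>) = 0" for j :: nat
  proof (rule ccontr)
    assume "phi ((1 / 2 ^ j) *\<^sub>R \<xi>) \<noteq> 0"
    from dyadic_partitionD(4)[OF dp this] have "3/4 \<le> norm \<xi> / 2 ^ j" by simp
    also have "\<dots> \<le> norm \<xi> / 1" by (intro divide_left_mono) auto
    finally show False using \<xi> by simp
  qed
  then show ?thesis using dyadic_partitionD(7)[OF dp, of \<xi>] by simp
qed

text \<open>Compare the partition of unity at \<open>\<xi>\<close> and at \<open>\<xi> / 2\<close>: the two series differ by one term.\<close>
lemma dyadic_chi_half:
  assumes dp: "dyadic_partition chi phi"
  shows "chi ((1/2) *\<^sub>R \<xi>) = chi \<xi> + phi \<xi>"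
proof -
  let ?f = "\<lambda>j::nat. phi ((1 / 2 ^ j) *\<^sub>R \<xi>)"
  have "(\<Sum>j. phi ((1 / 2 ^ j) *\<^sub>R ((1/2) *\<^sub>R \<xi>))) = (\<Sum>j. ?f (Suc j))"
    by (intro suminf_cong) (simp add: mult.commute)
  also have "\<dots> = suminf ?f - ?f 0"
    by (rule suminf_split_head[OF dyadic_partitionD(6)[OF dp]])
  finally show ?thesis
    using dyadic_partitionD(7)[OF dp, of "(1/2) *\<^sub>R \<xi>"] dyadic_partitionD(7)[OF dp, of \<xi>] by simp
qed

text \<open>The partial sums telescope to a single dilated bump, so truncation to low frequencies is
convolution with an approximate identity.\<close>
lemma sum_block_symbol:
  assumes dp: "dyadic_partition chi phi"
  shows "(\<Sum>k<Suc N. block_symbol chi phi k \<xi>) = chi ((1 / 2 ^ N) *\<^sub>R \<xi>)"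
proof (induction N)
  case 0
  show ?case by (simp add: block_symbol_def)
next
  case (Suc N)
  have "(\<Sum>k<Suc (Suc N). block_symbol chi phi k \<xi>) = chi ((1 / 2 ^ N) *\<^sub>R \<xi>) + phi ((1 / 2 ^ N) *\<^sub>R \<xi>)"
    unfolding sum.lessThan_Suc[of _ "Suc N"] Suc by (simp add: block_symbol_def)
  also have "\<dots> = chi ((1/2) *\<^sub>R ((1 / 2 ^ N) *\<^sub>R \<xi>))" by (rule dyadic_chi_half[OF dp, symmetric])
  finally show ?case by simp
qed

text \<open>Block \<open>k\<close> lives in \<open>|\<xi>| \<le> (4/3) 2^k\<close>, where \<open>|\<xi>| / 2^(k+1) \<le> 2/3 < 3/4\<close>, and \<open>chi = 1\<close> on
\<open>|\<xi>| < 3/4\<close>.\<close>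
lemma block_symbol_mult_chi:
  assumes dp: "dyadic_partition chi phi"
  shows "block_symbol chi phi k \<xi> * chi ((1 / 2 ^ Suc k) *\<^sub>R \<xi>) = block_symbol chi phi k \<xi>"
proof (cases "block_symbol chi phi k \<xi> = 0")
  case False
  have "norm ((1 / 2 ^ Suc k) *\<^sub>R \<xi>) < 3/4"
  proof (cases k)
    case 0
    then show ?thesis using False dyadic_partitionD(3)[OF dp, of \<xi>] by (simp add: block_symbol_def)
  next
    case (Suc j)
    then have "norm \<xi> / 2 ^ j \<le> 8/3"
      using False dyadic_partitionD(5)[OF dp, of "(1 / 2 ^ j) *\<^sub>R \<xi>"] by (simp add: block_symbol_def)
    from divide_right_mono[OF this, of 4] have "norm \<xi> / 2 ^ j / 4 < 3/4"
      by (rule le_less_trans) simp_all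
    moreover have "norm ((1 / 2 ^ Suc k) *\<^sub>R \<xi>) = norm \<xi> / 2 ^ j / 4" using Suc by simp
    ultimately show ?thesis by (simp only:)
  qed
  from dyadic_chi_eq_1[OF dp this] show ?thesis by simp
qed simp

abbreviation cblock :: "(real^'n::finite \<Rightarrow> real) \<Rightarrow> (real^'n \<Rightarrow> real) \<Rightarrow> nat \<Rightarrow> real^'n \<Rightarrow> complex" where
  "cblock chi phi k \<equiv> \<lambda>\<xi>. complex_of_real (block_symbol chi phi k \<xi>)"

lemma cblock_0: "cblock chi phi 0 = (\<lambda>\<xi>. complex_of_real (chi ((1 / 1) *\<^sub>R \<xi>)))"
  by (simp add: block_symbol_def)

lemma cblock_Suc: "cblock chi phi (Suc j) = (\<lambda>\<xi>. complex_of_real (phi ((1 / 2 ^ j) *\<^sub>R \<xi>)))"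
  by (simp add: block_symbol_def)

lemma schwartz_cblock:
  assumes dp: "dyadic_partition chi phi"
  shows "schwartz (cblock chi phi k)"
proof (cases k)
  case 0
  show ?thesis unfolding 0 cblock_0 using schwartz_of_real[OF dyadic_partitionD(1)[OF dp]] by simp
next
  case (Suc j)
  show ?thesis unfolding Suc cblock_Suc
    by (rule schwartz_dilation[OF schwartz_of_real[OF dyadic_partitionD(2)[OF dp]]]) simp
qed

lemma cblock_op_measurable:
  assumes dp: "dyadic_partition chi phi" and u: "u \<in> borel_measurable borel"
  shows "multiplier_op (cblock chi phi k) u \<in> borel_measurable borel"
proof (cases k)
  case 0
  show ?thesis unfolding 0 cblock_0
    by (rule multiplier_op_measurable[OF _ schwartz_of_real[OF dyadic_partitionD(1)[OF dp]] u]) simp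
next
  case (Suc j)
  show ?thesis unfolding Suc cblock_Suc
    by (rule multiplier_op_measurable[OF _ schwartz_of_real[OF dyadic_partitionD(2)[OF dp]] u]) simp
qed

definition sup_const :: "(real^'n::finite \<Rightarrow> real) \<Rightarrow> real" where
  "sup_const chi = 1 + (\<Sum>i\<in>UNIV. kernel_L1 (coord_symbol i (\<lambda>\<xi>. complex_of_real (chi \<xi>))))"

text \<open>The symbols \<open>p\<^sub>l\<close> are chosen so that \<open>\<Sum>\<^sub>l (-\<i> \<xi>\<^sub>l) p\<^sub>l(\<xi>) = phi \<xi>\<close>; they are
smooth since \<open>phi\<close> vanishes near the origin.\<close>
definition antiderivative_symbol :: "(real^'n::finite \<Rightarrow> real) \<Rightarrow> 'n \<Rightarrow> real^'n \<Rightarrow> complex" where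
  "antiderivative_symbol phi l \<xi> = \<i> * (of_real (\<xi> $ l) * (of_real (1 / (norm \<xi>)\<^sup>2) * complex_of_real (phi \<xi>)))"

text \<open>The summand \<open>1\<close> here and in \<open>sup_const\<close> makes these constants at least \<open>1\<close>, so that their powers
with exponents in \<open>[0, 1]\<close> are bounded by the constants themselves, uniformly in \<open>s\<close> and \<open>q\<close>.\<close>
definition L2_const :: "(real^'n::finite \<Rightarrow> real) \<Rightarrow> (real^'n \<Rightarrow> real) \<Rightarrow> real" where
  "L2_const chi phi = 1 + kernel_L1 (\<lambda>\<xi>. complex_of_real (chi \<xi>)) + kernel_L1 (\<lambda>\<xi>. complex_of_real (phi \<xi>))
    + CARD('n) * (\<Sum>l\<in>UNIV. kernel_L1 (antiderivative_symbol phi l))"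

lemma sup_const_ge:
  "1 \<le> sup_const chi" "kernel_L1 (coord_symbol i (\<lambda>\<xi>. complex_of_real (chi \<xi>))) \<le> sup_const chi"
proof -
  have "kernel_L1 (coord_symbol i (\<lambda>\<xi>. complex_of_real (chi \<xi>))) \<le>
    (\<Sum>i\<in>UNIV. kernel_L1 (coord_symbol i (\<lambda>\<xi>. complex_of_real (chi \<xi>))))"
    by (rule member_le_sum[of i UNIV "\<lambda>i. kernel_L1 (coord_symbol i (\<lambda>\<xi>. complex_of_real (chi \<xi>)))"])
      (auto intro: kernel_L1_nonneg)
  then show "kernel_L1 (coord_symbol i (\<lambda>\<xi>. complex_of_real (chi \<xi>))) \<le> sup_const chi"
    unfolding sup_const_def by linarith
  show "1 \<le> sup_const chi"
    unfolding sup_const_def using sum_nonneg[of UNIV "\<lambda>i. kernel_L1 (coord_symbol i (\<lambda>\<xi>. complex_of_real (chi \<xi>)))"]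
      kernel_L1_nonneg by fastforce
qed

lemma L2_const_ge:
  fixes chi phi :: "real^'n::finite \<Rightarrow> real"
  shows "1 \<le> L2_const chi phi" "kernel_L1 (\<lambda>\<xi>. complex_of_real (chi \<xi>)) \<le> L2_const chi phi"
    "kernel_L1 (\<lambda>\<xi>. complex_of_real (phi \<xi>)) \<le> L2_const chi phi"
    "CARD('n) * (\<Sum>l\<in>UNIV. kernel_L1 (antiderivative_symbol phi l)) \<le> L2_const chi phi"
proof -
  have "0 \<le> CARD('n) * (\<Sum>l\<in>UNIV. kernel_L1 (antiderivative_symbol phi l))"
    by (intro mult_nonneg_nonneg sum_nonneg kernel_L1_nonneg) simp
  moreover have "0 \<le> kernel_L1 (\<lambda>\<xi>. complex_of_real (chi \<xi>))" "0 \<le> kernel_L1 (\<lambda>\<xi>. complex_of_real (phi \<xi>))"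
    by (rule kernel_L1_nonneg)+
  ultimately show "1 \<le> L2_const chi phi" "kernel_L1 (\<lambda>\<xi>. complex_of_real (chi \<xi>)) \<le> L2_const chi phi"
    "kernel_L1 (\<lambda>\<xi>. complex_of_real (phi \<xi>)) \<le> L2_const chi phi"
    "CARD('n) * (\<Sum>l\<in>UNIV. kernel_L1 (antiderivative_symbol phi l)) \<le> L2_const chi phi"
    unfolding L2_const_def by linarith+
qed

lemma schwartz_antiderivative_symbol:
  assumes dp: "dyadic_partition chi phi"
  shows "schwartz (antiderivative_symbol phi l)"
proof -
  have 0: "complex_of_real (phi x) = 0" if "norm x < 3/4" for x
    using dyadic_partitionD(4)[OF dp, of x] that by force
  have "schwartz (\<lambda>x. of_real (1 / (norm x)\<^sup>2) * complex_of_real (phi x))"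
    by (rule schwartz_div_norm_sq[of "3/4", OF _ schwartz_of_real[OF dyadic_partitionD(2)[OF dp]] 0]) simp_all
  then show ?thesis unfolding antiderivative_symbol_def[abs_def]
    by (intro schwartz_cmult schwartz_coord_mult)
qed

text \<open>The block of \<open>f\<close> is bounded by \<open>B 2^(-(k-1) s)\<close>, and Bernstein's inequality at scale
\<open>2^(k+1)\<close> adds one derivative; \<open>2^(k+1)\<close> is \<open>4\<close> times the nominal frequency. A strict upper bound \<open>B\<close> of the Besov norm
is used, because the infimum defining \<open>Linf_norm\<close> then provides an actual bounded function.\<close>
lemma block_sup_bound:
  assumes dp: "dyadic_partition chi phi" and f: "in_besov chi phi s f" and B: "besov_norm chi phi s f < B"
    and u: "represents u (dist_partial i f)"
  shows "norm (multiplier_op (cblock chi phi k) u x) \<le> 4 * sup_const chi * B * 2 powr ((real k - 1) * (1 - s))"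
proof -
  have B0: "B > 0"
    using B enn2real_nonneg unfolding besov_norm_def by (rule le_less_trans[rotated])
  define c where "c = 2 powr ((real k - 1) * s)"
  have c: "c > 0" by (simp add: c_def)
  have "ennreal c * Linf_norm (fourier_multiplier (block_symbol chi phi k) f) \<le> besov_ennorm chi phi s f"
  proof -
    have "ennreal (2 powr (of_int (int k - 1) * s)) * Linf_norm (dyadic_block chi phi (int k - 1) f) \<le> besov_ennorm chi phi s f"
      unfolding besov_ennorm_def by (rule SUP_upper) simp
    then show ?thesis unfolding dyadic_block_eq c_def by simp
  qed
  also have "\<dots> = ennreal (besov_norm chi phi s f)"
    using f by (simp add: in_besov_def besov_norm_def)
  also have "\<dots> < ennreal B" using B B0 by (rule ennreal_lessI[rotated])
  finally have lt: "ennreal c * Linf_norm (fourier_multiplier (block_symbol chi phi k) f) < ennreal B" .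
  have "Linf_norm (fourier_multiplier (block_symbol chi phi k) f) < ennreal (B / c)"
  proof (rule ccontr)
    assume "\<not> ?thesis"
    then have "ennreal c * ennreal (B / c) \<le> ennreal c * Linf_norm (fourier_multiplier (block_symbol chi phi k) f)"
      by (intro mult_left_mono) (auto simp: not_less)
    moreover have "ennreal c * ennreal (B / c) = ennreal B"
      using c B0 by (subst ennreal_mult[symmetric]) auto
    ultimately show False using lt by (simp add: not_less[symmetric])
  qed
  then obtain h where h: "represents h (fourier_multiplier (block_symbol chi phi k) f)"
    and ess: "esssup lborel (\<lambda>x. ennreal (norm (h x))) < ennreal (B / c)"
    unfolding Linf_norm_def INF_less_iff by blast
  have hB: "AE y in lborel. norm (h y) \<le> B / c"
    using esssup_AE[of "\<lambda>x. ennreal (norm (h x))" lborel]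
  proof eventually_elim
    case (elim y)
    then have "ennreal (norm (h y)) \<le> ennreal (B / c)" using ess by (meson le_less_trans less_imp_le)
    then show ?case using B0 c by simp
  qed
  let ?M = "coord_symbol i (\<lambda>\<xi>. complex_of_real (chi \<xi>))"
  have "norm (multiplier_op (cblock chi phi k) u x) \<le> (B / c) * 2 ^ Suc k * kernel_L1 ?M"
  proof (rule bernstein_bound[OF _ schwartz_cblock[OF dp] schwartz_of_real[OF dyadic_partitionD(1)[OF dp]] _ u h hB])
    show "complex_of_real (block_symbol chi phi k \<xi>) * of_real (chi ((1 / 2 ^ Suc k) *\<^sub>R \<xi>)) = of_real (block_symbol chi phi k \<xi>)" for \<xi>
      unfolding of_real_mult[symmetric] block_symbol_mult_chi[OF dp] ..
  qed simp
  also have "\<dots> \<le> (B / c) * 2 ^ Suc k * sup_const chi"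
    using B0 c by (intro mult_left_mono sup_const_ge) auto
  also have "(B / c) * 2 ^ Suc k = 4 * B * 2 powr ((real k - 1) * (1 - s))"
  proof -
    have "2 ^ Suc k = (2::real) powr (2 + (real k - 1))"
      by (subst powr_realpow[symmetric]) (simp_all add: algebra_simps)
    also have "\<dots> = 4 * 2 powr (real k - 1)" by (simp only: powr_add) simp
    finally have "2 ^ Suc k / c = 4 * (2 powr (real k - 1) / 2 powr ((real k - 1) * s))" by (simp add: c_def)
    also have "2 powr (real k - 1) / 2 powr ((real k - 1) * s) = (2::real) powr ((real k - 1) * (1 - s))"
      unfolding powr_diff[symmetric] by (simp add: algebra_simps)
    finally have "2 ^ Suc k / c = 4 * 2 powr ((real k - 1) * (1 - s))" .
    moreover have "(B / c) * 2 ^ Suc k = B * (2 ^ Suc k / c)" by simp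
    ultimately show ?thesis by (simp only: mult_ac)
  qed
  finally show ?thesis by (simp only: mult_ac)
qed

lemma block_L2_bound:
  fixes chi phi :: "real^'n::finite \<Rightarrow> real"
  assumes dp: "dyadic_partition chi phi" and u: "u \<in> borel_measurable borel"
  shows "L2_sq (multiplier_op (cblock chi phi k) u) \<le>
    ennreal ((L2_const chi phi)\<^sup>2) * L2_sq u"
proof (cases k)
  case 0
  show ?thesis unfolding 0 cblock_0
  proof (rule order_trans[OF multiplier_op_L2[OF _ schwartz_of_real[OF dyadic_partitionD(1)[OF dp]] u]])
    show "ennreal ((kernel_L1 (\<lambda>\<xi>. complex_of_real (chi \<xi>)))\<^sup>2) * L2_sq u \<le>
        ennreal ((L2_const chi phi)\<^sup>2) * L2_sq u"
      by (intro mult_right_mono ennreal_leI power_mono L2_const_ge kernel_L1_nonneg) simp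
  qed simp
next
  case (Suc j)
  show ?thesis unfolding Suc cblock_Suc
  proof (rule order_trans[OF multiplier_op_L2[OF _ schwartz_of_real[OF dyadic_partitionD(2)[OF dp]] u]])
    show "ennreal ((kernel_L1 (\<lambda>\<xi>. complex_of_real (phi \<xi>)))\<^sup>2) * L2_sq u \<le>
        ennreal ((L2_const chi phi)\<^sup>2) * L2_sq u"
      by (intro mult_right_mono ennreal_leI power_mono L2_const_ge kernel_L1_nonneg) simp
  qed simp
qed

lemma cblock_Suc_antiderivative:
  assumes dp: "dyadic_partition chi phi"
  shows "cblock chi phi (Suc j) \<xi> =
    (\<Sum>l\<in>UNIV. of_real (1 / 2 ^ j) * (- \<i> * (of_real (\<xi> $ l) * antiderivative_symbol phi l ((1 / 2 ^ j) *\<^sub>R \<xi>))))"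
proof -
  define \<zeta> where "\<zeta> = (1 / 2 ^ j) *\<^sub>R \<xi>"
  have \<xi>: "of_real (1 / 2 ^ j) * complex_of_real (\<xi> $ l) = of_real (\<zeta> $ l)" for l
    by (simp add: \<zeta>_def)
  have "(\<Sum>l\<in>UNIV. of_real (1 / 2 ^ j) * (- \<i> * (of_real (\<xi> $ l) * antiderivative_symbol phi l \<zeta>))) =
      (\<Sum>l\<in>UNIV. of_real (\<zeta> $ l) * (- \<i> * antiderivative_symbol phi l \<zeta>))"
    unfolding \<xi>[symmetric] by (intro sum.cong refl) (simp only: mult_ac)
  also have "\<dots> = (\<Sum>l\<in>UNIV. of_real ((\<zeta> $ l)\<^sup>2 * (1 / (norm \<zeta>)\<^sup>2 * phi \<zeta>)))"
  proof (intro sum.cong refl)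
    fix l
    have "of_real (\<zeta> $ l) * (- \<i> * antiderivative_symbol phi l \<zeta>) =
        (- \<i> * \<i>) * (of_real (\<zeta> $ l) * of_real (\<zeta> $ l) * (of_real (1 / (norm \<zeta>)\<^sup>2) * complex_of_real (phi \<zeta>)))"
      unfolding antiderivative_symbol_def by (simp only: mult_ac minus_mult_left minus_mult_right)
    then show "of_real (\<zeta> $ l) * (- \<i> * antiderivative_symbol phi l \<zeta>) = of_real ((\<zeta> $ l)\<^sup>2 * (1 / (norm \<zeta>)\<^sup>2 * phi \<zeta>))"
      unfolding of_real_mult power2_eq_square[of "\<zeta> $ l"] by simp
  qed
  also have "\<dots> = of_real ((\<Sum>l\<in>UNIV. (\<zeta> $ l)\<^sup>2) * (1 / (norm \<zeta>)\<^sup>2 * phi \<zeta>))"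
    unfolding sum_distrib_right of_real_sum ..
  also have "(\<Sum>l\<in>UNIV. (\<zeta> $ l)\<^sup>2) = (norm \<zeta>)\<^sup>2"
    unfolding power2_norm_eq_inner inner_vec_def by (simp add: power2_eq_square)
  also have "(norm \<zeta>)\<^sup>2 * (1 / (norm \<zeta>)\<^sup>2 * phi \<zeta>) = phi \<zeta>"
    using dyadic_partitionD(4)[OF dp, of \<zeta>] by (cases "phi \<zeta> = 0") auto
  finally show ?thesis by (simp only: block_symbol_def nat.case \<zeta>_def)
qed

text \<open>Writing the symbol as a divergence moves one derivative onto \<open>u\<close>; the dilation converts the
frequency of the block into the gain \<open>1 / 2^j\<close>.\<close>
lemma block_L2_bound_high:
  fixes chi phi :: "real^'n::finite \<Rightarrow> real" and u :: "real^'n \<Rightarrow> complex"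
  assumes dp: "dyadic_partition chi phi"
    and u: "\<And>\<psi>. schwartz \<psi> \<Longrightarrow> integrable lborel (\<lambda>x. u x * \<psi> x)"
    and v: "\<And>l. represents (v l) (dist_partial l (regular_distribution u))"
    and H: "(\<Sum>l\<in>UNIV. L2_sq (v l)) \<le> ennreal (H\<^sup>2)"
  shows "L2_sq (multiplier_op (cblock chi phi (Suc j)) u) \<le>
    ennreal ((L2_const chi phi * (1 / 2 ^ j) * H)\<^sup>2)"
proof -
  let ?p = "\<lambda>l \<xi>. antiderivative_symbol phi l ((1 / 2 ^ j) *\<^sub>R \<xi>)"
  note ps = schwartz_antiderivative_symbol[OF dp]
  have pj: "schwartz (?p l)" for l using schwartz_dilation[OF ps] by simp
  have vm [measurable]: "v l \<in> borel_measurable borel" for l using v[of l] by (simp add: represents_def)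
  let ?w = "\<lambda>l. multiplier_op (?p l) (v l)"
  have [measurable]: "?w l \<in> borel_measurable borel" for l
    by (rule multiplier_op_measurable[OF _ ps vm]) simp
  have op: "multiplier_op (cblock chi phi (Suc j)) u x = (\<Sum>l\<in>UNIV. of_real (1 / 2 ^ j) * - ?w l x)" for x
  proof -
    have "multiplier_op (cblock chi phi (Suc j)) u x =
      (\<Sum>l\<in>UNIV. multiplier_op (\<lambda>\<xi>. of_real (1 / 2 ^ j) * (- \<i> * (of_real (\<xi> $ l) * ?p l \<xi>))) u x)"
      unfolding cblock_Suc_antiderivative[OF dp]
      by (rule multiplier_op_sum) (intro finite schwartz_cmult schwartz_coord_mult pj u | assumption)+
    then show ?thesis unfolding multiplier_op_cmult[of "of_real (1 / 2 ^ j)"] multiplier_op_weak_partial[OF pj v] .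
  qed
  let ?n = "real CARD('n)" and ?K = "\<lambda>l. kernel_L1 (antiderivative_symbol phi l)"
  let ?D = "\<Sum>l\<in>UNIV. ?K l"
  have pt: "ennreal (norm (multiplier_op (cblock chi phi (Suc j)) u x)) ^ 2 \<le>
      (\<Sum>l\<in>UNIV. ennreal ((1 / 2 ^ j)\<^sup>2 * ?n) * ennreal (norm (?w l x)) ^ 2)" for x
  proof -
    have "norm (multiplier_op (cblock chi phi (Suc j)) u x) \<le> (\<Sum>l\<in>UNIV. (1 / 2 ^ j) * norm (?w l x))"
      unfolding op by (rule order_trans[OF norm_sum]) (simp add: norm_mult norm_divide norm_power)
    also have "\<dots> = (1 / 2 ^ j) * (\<Sum>l\<in>UNIV. norm (?w l x))" by (simp add: sum_distrib_left)
    finally have "(norm (multiplier_op (cblock chi phi (Suc j)) u x))\<^sup>2 \<le> ((1 / 2 ^ j) * (\<Sum>l\<in>UNIV. norm (?w l x)))\<^sup>2"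
      by (rule power_mono) simp
    also have "\<dots> = (1 / 2 ^ j)\<^sup>2 * (\<Sum>l\<in>UNIV. norm (?w l x))\<^sup>2" by (rule power_mult_distrib)
    also have "\<dots> \<le> (1 / 2 ^ j)\<^sup>2 * ((\<Sum>l\<in>UNIV. (norm (?w l x))\<^sup>2) * ?n)"
      by (intro mult_left_mono sum_squared_le_sum_of_squares) simp_all
    also have "\<dots> = (\<Sum>l\<in>UNIV. (1 / 2 ^ j)\<^sup>2 * ?n * (norm (?w l x))\<^sup>2)"
      by (simp add: sum_distrib_left sum_distrib_right mult_ac)
    finally have "ennreal ((norm (multiplier_op (cblock chi phi (Suc j)) u x))\<^sup>2) \<le>
      ennreal (\<Sum>l\<in>UNIV. (1 / 2 ^ j)\<^sup>2 * ?n * (norm (?w l x))\<^sup>2)" by (rule ennreal_leI)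
    also have "\<dots> = (\<Sum>l\<in>UNIV. ennreal ((1 / 2 ^ j)\<^sup>2 * ?n * (norm (?w l x))\<^sup>2))"
      by (rule sum_ennreal[symmetric]) simp
    also have "\<dots> = (\<Sum>l\<in>UNIV. ennreal ((1 / 2 ^ j)\<^sup>2 * ?n) * ennreal (norm (?w l x)) ^ 2)"
      by (intro sum.cong refl) (subst ennreal_mult, simp_all add: ennreal_power)
    finally show ?thesis by (simp add: ennreal_power)
  qed
  have "L2_sq (multiplier_op (cblock chi phi (Suc j)) u) \<le>
      (\<integral>\<^sup>+x. (\<Sum>l\<in>UNIV. ennreal ((1 / 2 ^ j)\<^sup>2 * ?n) * ennreal (norm (?w l x)) ^ 2) \<partial>lborel)"
    by (rule nn_integral_mono[OF pt])
  also have "\<dots> = (\<Sum>l\<in>UNIV. ennreal ((1 / 2 ^ j)\<^sup>2 * ?n) * L2_sq (?w l))"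
    by (subst nn_integral_sum) (auto intro!: sum.cong nn_integral_cmult)
  also have "\<dots> \<le> (\<Sum>l\<in>UNIV. ennreal ((1 / 2 ^ j)\<^sup>2 * ?n) * (ennreal (?D\<^sup>2) * L2_sq (v l)))"
  proof (intro sum_mono mult_left_mono)
    fix l
    have "L2_sq (?w l) \<le> ennreal ((?K l)\<^sup>2) * L2_sq (v l)"
      by (rule multiplier_op_L2[OF _ ps vm]) simp
    also have "\<dots> \<le> ennreal (?D\<^sup>2) * L2_sq (v l)"
      by (intro mult_right_mono ennreal_leI power_mono member_le_sum kernel_L1_nonneg) auto
    finally show "L2_sq (?w l) \<le> ennreal (?D\<^sup>2) * L2_sq (v l)" .
  qed simp
  also have "\<dots> = ennreal ((1 / 2 ^ j)\<^sup>2 * ?n) * (ennreal (?D\<^sup>2) * (\<Sum>l\<in>UNIV. L2_sq (v l)))"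
    by (simp only: sum_distrib_left)
  also have "\<dots> \<le> ennreal ((1 / 2 ^ j)\<^sup>2 * ?n) * (ennreal (?D\<^sup>2) * ennreal (H\<^sup>2))"
    by (intro mult_left_mono H) simp_all
  also have "\<dots> = ennreal ((1 / 2 ^ j)\<^sup>2 * ?n * (?D\<^sup>2 * H\<^sup>2))"
    by (simp add: ennreal_mult)
  also have "\<dots> \<le> ennreal ((L2_const chi phi * (1 / 2 ^ j) * H)\<^sup>2)"
  proof (rule ennreal_leI)
    have D0: "?D \<ge> 0" by (intro sum_nonneg kernel_L1_nonneg)
    have "?n * ?D\<^sup>2 \<le> (?n * ?D)\<^sup>2"
      unfolding power_mult_distrib by (intro mult_right_mono) (simp_all add: self_le_power Suc_le_eq)
    also have "\<dots> \<le> (L2_const chi phi)\<^sup>2"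
      using L2_const_ge(4)[of phi chi] D0 by (intro power_mono) auto
    finally have "(1 / 2 ^ j)\<^sup>2 * H\<^sup>2 * (?n * ?D\<^sup>2) \<le> (1 / 2 ^ j)\<^sup>2 * H\<^sup>2 * (L2_const chi phi)\<^sup>2"
      by (intro mult_left_mono) auto
    then show "(1 / 2 ^ j)\<^sup>2 * ?n * (?D\<^sup>2 * H\<^sup>2) \<le> (L2_const chi phi * (1 / 2 ^ j) * H)\<^sup>2"
      unfolding power_mult_distrib by (simp only: mult_ac)
  qed
  finally show ?thesis .
qed

section \<open>The gradient inequality\<close>

lemma Lp_norm_2_nn:
  assumes "in_Lp 2 f"
  shows "L2_sq f = ennreal ((Lp_norm 2 f)\<^sup>2)"
proof -
  have i: "integrable lborel (\<lambda>x. norm (f x) powr 2)" using assms by (simp add: in_Lp_def)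
  have "L2_sq f = (\<integral>\<^sup>+x. ennreal (norm (f x) powr 2) \<partial>lborel)"
    by (simp add: ennreal_power)
  also have "\<dots> = ennreal (LINT x|lborel. norm (f x) powr 2)"
    by (rule nn_integral_eq_integral[OF i]) simp
  also have "(LINT x|lborel. norm (f x) powr 2) = (Lp_norm 2 f)\<^sup>2"
  proof -
    have "0 \<le> (LINT x|lborel. norm (f x) powr 2)" by (rule integral_nonneg_AE) simp
    then show ?thesis unfolding Lp_norm_def by (simp only: powr_half_sqrt real_sqrt_pow2)
  qed
  finally show ?thesis .
qed

lemma Lp_norm_nonneg: "Lp_norm p f \<ge> 0"
  by (simp add: Lp_norm_def)

lemma in_LpI_nn:
  assumes m: "g \<in> borel_measurable lborel" and q: "q > 0" and T: "T \<ge> 0"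
    and le: "(\<integral>\<^sup>+x. ennreal (norm (g x) powr q) \<partial>lborel) \<le> ennreal (T powr q)"
  shows "in_Lp q g" "Lp_norm q g \<le> T"
proof -
  have i: "integrable lborel (\<lambda>x. norm (g x) powr q)"
  proof (rule integrableI_bounded)
    show "(\<integral>\<^sup>+x. ennreal (norm (norm (g x) powr q)) \<partial>lborel) < \<infinity>"
      using le by (simp add: le_less_trans)
  qed (use m in measurable)
  then show "in_Lp q g" using m by (simp add: in_Lp_def)
  have "ennreal (LINT x|lborel. norm (g x) powr q) \<le> ennreal (T powr q)"
    using le by (subst nn_integral_eq_integral[OF i, symmetric]) simp_all
  then have "(LINT x|lborel. norm (g x) powr q) \<le> T powr q" by simp
  moreover have "0 \<le> (LINT x|lborel. norm (g x) powr q)" by (rule integral_nonneg_AE) simp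
  ultimately have "Lp_norm q g \<le> (T powr q) powr (1 / q)"
    unfolding Lp_norm_def using q by (intro powr_mono2) auto
  then show "Lp_norm q g \<le> T" using q T by (simp add: powr_powr)
qed

lemma H1_norm_facts:
  fixes g :: "real^'n::finite \<Rightarrow> complex^'m::finite"
  assumes "in_H1 g"
  shows "Lp_norm 2 g \<le> H1_norm g"
    and "is_L2_weak_partial l (\<lambda>x. g x $ i) (weak_partial l (\<lambda>x. g x $ i))"
    and "(\<Sum>l\<in>UNIV. L2_sq (weak_partial l (\<lambda>x. g x $ i))) \<le> ennreal ((H1_norm g)\<^sup>2)"
proof -
  let ?N = "\<lambda>l i. (Lp_norm 2 (weak_partial l (\<lambda>x. g x $ i)))\<^sup>2"
  have sum0: "0 \<le> (\<Sum>l\<in>UNIV. \<Sum>i\<in>UNIV. ?N l i)" by (intro sum_nonneg) simp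
  have H: "(H1_norm g)\<^sup>2 = (Lp_norm 2 g)\<^sup>2 + (\<Sum>l\<in>UNIV. \<Sum>i\<in>UNIV. ?N l i)"
    unfolding H1_norm_def using sum0 by (intro real_sqrt_pow2 add_nonneg_nonneg) simp_all
  show "Lp_norm 2 g \<le> H1_norm g"
    unfolding H1_norm_def using sum0 Lp_norm_nonneg[of 2 g] by (intro real_le_rsqrt) simp
  have wp: "is_L2_weak_partial l (\<lambda>x. g x $ i) (weak_partial l (\<lambda>x. g x $ i))" for l i
    unfolding weak_partial_def
    by (rule someI_ex[of "is_L2_weak_partial l (\<lambda>x. g x $ i)"])
      (use assms in \<open>unfold in_H1_def, blast\<close>)
  then show "is_L2_weak_partial l (\<lambda>x. g x $ i) (weak_partial l (\<lambda>x. g x $ i))" .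
  have "(\<Sum>l\<in>UNIV. L2_sq (weak_partial l (\<lambda>x. g x $ i))) = (\<Sum>l\<in>UNIV. ennreal (?N l i))"
    by (intro sum.cong refl Lp_norm_2_nn) (use wp in \<open>simp add: is_L2_weak_partial_def\<close>)
  also have "\<dots> = ennreal (\<Sum>l\<in>UNIV. ?N l i)" by (rule sum_ennreal) simp
  also have "\<dots> \<le> ennreal ((H1_norm g)\<^sup>2)"
  proof (rule ennreal_leI)
    have "(\<Sum>l\<in>UNIV. ?N l i) \<le> (\<Sum>l\<in>UNIV. \<Sum>i\<in>UNIV. ?N l i)"
      by (intro sum_mono member_le_sum) auto
    then show "(\<Sum>l\<in>UNIV. ?N l i) \<le> (H1_norm g)\<^sup>2"
      unfolding H using zero_le_power2[of "Lp_norm 2 g"] by linarith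
  qed
  finally show "(\<Sum>l\<in>UNIV. L2_sq (weak_partial l (\<lambda>x. g x $ i))) \<le> ennreal ((H1_norm g)\<^sup>2)" .
qed

text \<open>Geometric decay of the \<open>L\<^sup>2\<close> norms yields an \<open>L\<^sup>2\<close> majorant of the partial sums and almost
everywhere convergence; the limit is identified by \<open>multiplier_op_limit_unique\<close>.\<close>
lemma littlewood_paley_AE:
  fixes chi phi :: "real^'n::finite \<Rightarrow> real" and u :: "real^'n \<Rightarrow> complex"
  assumes dp: "dyadic_partition chi phi"
    and u: "u \<in> borel_measurable borel" and u2: "L2_sq u < \<infinity>"
    and ui: "\<And>\<psi>. schwartz \<psi> \<Longrightarrow> integrable lborel (\<lambda>x. u x * \<psi> x)"
    and c: "c > 0"
    and le: "\<And>k. L2_sq (multiplier_op (cblock chi phi k) u) \<le> ennreal ((c * (1/2) ^ k)\<^sup>2)"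
  shows "AE x in lborel. norm (u x) \<le> (\<Sum>k. norm (multiplier_op (cblock chi phi k) u x))"
proof -
  let ?w = "\<lambda>k. multiplier_op (cblock chi phi k) u"
  let ?W = "\<lambda>x. \<Sum>k. norm (?w k x)"
  have [measurable]: "?w k \<in> borel_measurable borel" for k by (rule cblock_op_measurable[OF dp u])
  let ?a = "\<lambda>(_::unit) k x. norm (?w k x)" and ?M = "\<lambda>(_::unit) k. c * (1/2) ^ k"
  have am: "?a i k \<in> borel_measurable lborel" for i k by measurable
  have bd: "(\<integral>\<^sup>+x. ennreal (?a i k x powr 2) \<partial>lborel) \<le> ennreal (?M i k powr 2)" for i k
    using le[of k] c by (simp add: ennreal_power)
  have T: "(\<Sum>i\<in>UNIV. \<Sum>k<K. ?M i k) \<le> 2 * c" for K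
  proof -
    have "(\<Sum>k<K. (1/2::real) ^ k) \<le> 2"
      using geometric_sum[of "1/2::real" K] by simp
    then show ?thesis using c by (simp add: sum_distrib_left[symmetric] UNIV_unit)
  qed
  have AEs: "AE x in lborel. \<forall>i\<in>(UNIV::unit set). summable (\<lambda>k. ?a i k x)"
    and int: "(\<integral>\<^sup>+x. ennreal ((\<Sum>i\<in>(UNIV::unit set). \<Sum>k. ?a i k x) powr 2) \<partial>lborel) \<le> ennreal ((2 * c) powr 2)"
    by (rule nn_integral_series_powr_le[where M="?M", OF _ _ am _ _ bd T]; use c in simp)+
  have summ: "AE x in lborel. summable (\<lambda>k. norm (?w k x))" using AEs by simp
  have S: "multiplier_op (\<lambda>\<xi>. complex_of_real (chi ((1 / 2 ^ N) *\<^sub>R \<xi>))) u x = (\<Sum>k<Suc N. ?w k x)" for N x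
    unfolding sum_block_symbol[OF dp, symmetric] of_real_sum
    by (rule multiplier_op_sum) (auto intro: schwartz_cblock[OF dp] ui)
  have "AE x in lborel. u x = (\<Sum>k. ?w k x)"
  proof (rule multiplier_op_limit_unique[OF schwartz_of_real[OF dyadic_partitionD(1)[OF dp]] _ u u2, where W="?W"])
    show "complex_of_real (chi 0) = 1" using dyadic_chi_eq_1[OF dp, of 0] by simp
    have "(\<integral>\<^sup>+x. ennreal \<bar>?W x\<bar> ^ 2 \<partial>lborel) = (\<integral>\<^sup>+x. ennreal ((\<Sum>i\<in>(UNIV::unit set). \<Sum>k. ?a i k x) powr 2) \<partial>lborel)"
    proof (rule nn_integral_cong_AE, use summ in eventually_elim)
      case (elim x)
      have "0 \<le> ?W x" by (rule suminf_nonneg[OF elim]) simp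
      then show ?case by (simp add: UNIV_unit ennreal_power)
    qed
    also have "\<dots> < \<infinity>" by (rule le_less_trans[OF int]) simp
    finally show "(\<integral>\<^sup>+x. ennreal \<bar>?W x\<bar> ^ 2 \<partial>lborel) < \<infinity>" .
    show "AE x in lborel. norm (multiplier_op (\<lambda>\<xi>. complex_of_real (chi ((1 / 2 ^ N) *\<^sub>R \<xi>))) u x) \<le> ?W x" for N
      using summ
    proof eventually_elim
      case (elim x)
      have "norm (\<Sum>k<Suc N. ?w k x) \<le> (\<Sum>k<Suc N. norm (?w k x))" by (rule norm_sum)
      also have "\<dots> \<le> ?W x" by (rule sum_le_suminf[OF elim]) auto
      finally show ?case unfolding S .
    qed
    show "AE x in lborel. (\<lambda>N. multiplier_op (\<lambda>\<xi>. complex_of_real (chi ((1 / 2 ^ N) *\<^sub>R \<xi>))) u x) \<longlonglongrightarrow> (\<Sum>k. ?w k x)"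
      using summ unfolding S
    proof eventually_elim
      case (elim x)
      show ?case by (rule LIMSEQ_Suc[OF summable_LIMSEQ[OF summable_norm_cancel[OF elim]]])
    qed
  qed measurable
  then show ?thesis using summ
  proof eventually_elim
    case (elim x)
    show ?case unfolding elim(1) by (rule summable_norm[OF elim(2)])
  qed
qed

text \<open>The whole estimate for a strict upper bound \<open>B\<close> of the Besov norm. Strictness makes all block
bounds positive, as the weights in Minkowski's inequality have to be. The factor \<open>12\<close> is \<open>4\<close> from
Bernstein's inequality times \<open>3\<close> from the two-sided sum; the dimension counts the components of the
gradient.\<close>
lemma gradient_Lq_bound:
  fixes chi phi :: "real^'n::finite \<Rightarrow> real" and g :: "real^'n \<Rightarrow> complex^'n"
  assumes dp: "dyadic_partition chi phi" and s: "s < 1" and f: "in_besov chi phi s f"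
    and B: "besov_norm chi phi s f < B"
    and grad: "has_dist_gradient f g" and H1: "in_H1 g" and L0: "Lp_norm 2 g > 0"
    and q: "2 < q" "q < 2 + 2 / (1 - s)"
  defines "a \<equiv> (1 - s) * (1 - 2/q)"
  shows "in_Lp q g \<and> Lp_norm q g \<le> real CARD('n) * (12 * sup_const chi * L2_const chi phi)
      * max (1 / (2 powr a - 1)) (1 / (1 - 2 powr (- (2/q - a))))
      * B powr (1 - 2/q) * Lp_norm 2 g powr (2/q - a) * H1_norm g powr a"
proof -
  define L where "L = Lp_norm 2 g"
  define H where "H = H1_norm g"
  define \<theta> where "\<theta> = 1 - 2/q"
  define \<delta> where "\<delta> = 2/q - a"
  define A where "A = sup_const chi"
  define C where "C = L2_const chi phi"
  have A1: "A \<ge> 1" and C1: "C \<ge> 1" unfolding A_def C_def by (rule sup_const_ge L2_const_ge)+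
  have L: "0 < L" "L \<le> H" using L0 H1_norm_facts(1)[OF H1] by (auto simp: L_def H_def)
  have \<theta>: "0 < \<theta>" "\<theta> \<le> 1" using q by (auto simp: \<theta>_def)
  have a: "a = (1 - s) * \<theta>" by (simp add: a_def \<theta>_def)
  have a0: "a > 0" unfolding a using s \<theta> by simp
  have \<delta>0: "\<delta> > 0"
  proof -
    have "q - 2 < 2 / (1 - s)" using q by linarith
    then have "(1 - s) * (q - 2) < 2" using s by (simp add: pos_less_divide_eq mult.commute)
    then have "((1 - s) * (q - 2)) / q < 2 / q" using q by (intro divide_strict_right_mono) auto
    moreover have "((1 - s) * (q - 2)) / q = a" using q by (simp add: a_def field_simps)
    ultimately show ?thesis by (simp add: \<delta>_def)
  qed
  have t: "a + \<delta> = 2/q" by (simp add: \<delta>_def)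
  have t1: "a + \<delta> \<le> 1" "0 < a + \<delta>" unfolding t using q by auto
  have B0: "B > 0" using B enn2real_nonneg unfolding besov_norm_def by (rule le_less_trans[rotated])
  define w where "w i k = multiplier_op (cblock chi phi k) (\<lambda>x. g x $ i)" for i k
  define v where "v i l = weak_partial l (\<lambda>x. g x $ i)" for i l
  have rep: "represents (\<lambda>x. g x $ i) (dist_partial i f)" for i
    using grad by (simp add: has_dist_gradient_def)
  have gm: "(\<lambda>x. g x $ i) \<in> borel_measurable borel" for i using rep[of i] by (simp add: represents_def)
  have wm [measurable]: "w i k \<in> borel_measurable borel" for i k
    unfolding w_def by (rule cblock_op_measurable[OF dp gm])
  have gi: "integrable lborel (\<lambda>x. g x $ i * \<psi> x)" if "schwartz \<psi>" for i \<psi>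
    using rep[of i] that by (simp add: represents_def)
  have L2: "in_Lp 2 g" using H1 by (simp add: in_H1_def)
  have g2: "L2_sq (\<lambda>x. g x $ i) \<le> ennreal (L\<^sup>2)" for i
    unfolding L_def Lp_norm_2_nn[OF L2, symmetric]
    by (intro nn_integral_mono power_mono ennreal_leI Finite_Cartesian_Product.norm_nth_le) simp_all
  have vrep: "represents (v i l) (dist_partial l (regular_distribution (\<lambda>x. g x $ i)))" for i l
    using H1_norm_facts(2)[OF H1, of l i] by (simp add: v_def is_L2_weak_partial_def)
  have sup: "norm (w i k x) \<le> 4 * A * B * 2 powr ((real k - 1) * (1 - s))" for i k x
    unfolding w_def A_def by (rule block_sup_bound[OF dp f B rep])
  have low: "L2_sq (w i k) \<le> ennreal ((C * L)\<^sup>2)" for i k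
  proof -
    have "L2_sq (w i k) \<le> ennreal (C\<^sup>2) * L2_sq (\<lambda>x. g x $ i)"
      unfolding w_def C_def by (rule block_L2_bound[OF dp gm])
    also have "\<dots> \<le> ennreal (C\<^sup>2) * ennreal (L\<^sup>2)" by (intro mult_left_mono g2) simp
    finally show ?thesis by (simp add: ennreal_mult power_mult_distrib)
  qed
  have high: "L2_sq (w i k) \<le> ennreal ((C * 2 powr (- (real k - 1)) * H)\<^sup>2)" if k0: "k > 0" for i k
  proof -
    obtain j where k: "k = Suc j" using k0 by (cases k) auto
    have "2 powr (- (real k - 1)) = 1 / 2 ^ j"
      by (simp add: k powr_minus powr_realpow divide_inverse)
    moreover have "L2_sq (w i k) \<le> ennreal ((C * (1 / 2 ^ j) * H)\<^sup>2)"
      unfolding w_def k C_def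
      by (rule block_L2_bound_high[OF dp gi vrep])
        (use H1_norm_facts(3)[OF H1] in \<open>auto simp: v_def H_def\<close>)
    ultimately show ?thesis by (simp only:)
  qed
  have AEg: "AE x in lborel. norm (g x $ i) \<le> (\<Sum>k. norm (w i k x))" for i
    unfolding w_def
  proof (rule littlewood_paley_AE[OF dp gm _ gi])
    show "L2_sq (\<lambda>x. g x $ i) < \<infinity>"
      by (rule le_less_trans[OF g2]) simp
    \<comment> \<open>Since \<open>L \<le> H\<close>, one geometric bound \<open>2 C H / 2^k\<close> covers block \<open>0\<close> as well.\<close>
    show "0 < 2 * C * H" using C1 L by simp
    show "L2_sq (multiplier_op (cblock chi phi k) (\<lambda>x. g x $ i)) \<le> ennreal ((2 * C * H * (1/2) ^ k)\<^sup>2)" for k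
    proof (cases "k = 0")
      case True
      have "C * L \<le> 2 * C * H * (1/2) ^ k" using True L C1 mult_mono[of C "2 * C" L H] by simp
      then show ?thesis using low[of i k] L C1 unfolding w_def
        by (elim order_trans) (intro ennreal_leI power_mono, auto)
    next
      case False
      then obtain j where k: "k = Suc j" by (cases k) auto
      have "2 powr (- (real k - 1)) = 1 / 2 ^ j"
        by (simp add: k powr_minus powr_realpow divide_inverse)
      moreover have "2 * (1/2 :: real) ^ k = 1 / 2 ^ j" by (simp add: k power_one_over)
      ultimately have "C * 2 powr (- (real k - 1)) * H = C * (2 * (1/2) ^ k) * H" by (simp only:)
      also have "\<dots> = 2 * C * H * (1/2) ^ k" by (simp only: mult_ac)
      finally have eq: "C * 2 powr (- (real k - 1)) * H = 2 * C * H * (1/2) ^ k" .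
      have "0 < k" using False by simp
      from high[OF this, of i] show ?thesis unfolding w_def eq .
    qed
  qed
  obtain N :: nat where N: "\<And>K. (\<Sum>k<K. if k \<le> N then 2 powr ((real k - 1) * a) * L powr (a + \<delta>)
            else 2 powr (- (real k - 1) * \<delta>) * H powr (a + \<delta>)) \<le>
     3 * max (1 / (2 powr a - 1)) (1 / (1 - 2 powr (- \<delta>))) * L powr \<delta> * H powr a"
    by (rule dyadic_two_sided_sum[OF L a0 \<delta>0 t1(1)]) blast
  define m where "m k = (if k \<le> N then 2 powr ((real k - 1) * a) * L powr (a + \<delta>)
            else 2 powr (- (real k - 1) * \<delta>) * H powr (a + \<delta>))" for k
  have m0: "m k > 0" for k using L by (simp add: m_def)
  define M where "M k = 4 * A * C * B powr \<theta> * m k" for k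
  have M0: "M k > 0" for k using A1 C1 B0 m0 by (simp add: M_def)
  have pw: "r powr e \<le> r" if "1 \<le> r" "e \<le> 1" for r e :: real
    using powr_mono[OF that(2,1)] that by simp
  have wq: "(\<integral>\<^sup>+x. ennreal (norm (w i k x) powr q) \<partial>lborel) \<le> ennreal (M k powr q)" for i k
  proof -
    \<comment> \<open>Up to the critical index the plain \<open>L\<^sup>2\<close> bound is better, beyond it the one with a derivative.\<close>
    define Lk where "Lk = C * (if k \<le> N then L else 2 powr (- (real k - 1)) * H)"
    have Lk0: "Lk > 0" using C1 L by (simp add: Lk_def)
    have "L2_sq (w i k) \<le> ennreal (Lk\<^sup>2)"
      using low[of i k] high[of k i] by (auto simp: Lk_def mult.assoc)
    then have "(\<integral>\<^sup>+x. ennreal (norm (w i k x) powr q) \<partial>lborel) \<le>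
        ennreal (((4 * A * B * 2 powr ((real k - 1) * (1 - s))) powr (1 - 2/q) * Lk powr (2/q)) powr q)"
      by (intro nn_integral_powr_interpolation sup) (use A1 B0 Lk0 q in auto)
    also have "\<dots> \<le> ennreal (M k powr q)"
    proof (intro ennreal_leI powr_mono2)
      let ?e = "2 powr ((real k - 1) * (1 - s)) :: real"
      have "(4 * A * B * ?e) powr (1 - 2/q) = (4 * A) powr \<theta> * B powr \<theta> * 2 powr ((real k - 1) * a)"
        using A1 B0 by (simp add: \<theta>_def[symmetric] powr_mult powr_powr a mult.assoc)
      also have "\<dots> \<le> (4 * A) * B powr \<theta> * 2 powr ((real k - 1) * a)"
        using A1 \<theta> by (intro mult_right_mono pw) auto
      finally have 1: "(4 * A * B * ?e) powr (1 - 2/q) \<le> 4 * A * B powr \<theta> * 2 powr ((real k - 1) * a)" .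
      have "Lk powr (2/q) = C powr (a + \<delta>) * (if k \<le> N then L else 2 powr (- (real k - 1)) * H) powr (a + \<delta>)"
        unfolding Lk_def t using C1 L by (subst powr_mult) auto
      also have "\<dots> \<le> C * (if k \<le> N then L else 2 powr (- (real k - 1)) * H) powr (a + \<delta>)"
        using C1 t1 by (intro mult_right_mono pw) auto
      finally have 2: "Lk powr (2/q) \<le> C * (if k \<le> N then L else 2 powr (- (real k - 1)) * H) powr (a + \<delta>)" .
      have 3: "2 powr ((real k - 1) * a) * (if k \<le> N then L else 2 powr (- (real k - 1)) * H) powr (a + \<delta>) = m k"
      proof (cases "k \<le> N")
        case False
        have "(2 powr (- (real k - 1)) * H) powr (a + \<delta>) = 2 powr (- (real k - 1) * (a + \<delta>)) * H powr (a + \<delta>)"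
          using L by (simp add: powr_mult powr_powr)
        moreover have "2 powr ((real k - 1) * a) * 2 powr (- (real k - 1) * (a + \<delta>)) = (2::real) powr (- (real k - 1) * \<delta>)"
          unfolding powr_add[symmetric] by (simp add: algebra_simps)
        ultimately show ?thesis using False by (simp add: m_def mult.assoc[symmetric])
      qed (simp add: m_def)
      have "(4 * A * B * ?e) powr (1 - 2/q) * Lk powr (2/q) \<le>
          (4 * A * B powr \<theta> * 2 powr ((real k - 1) * a)) * (C * (if k \<le> N then L else 2 powr (- (real k - 1)) * H) powr (a + \<delta>))"
        using A1 by (intro mult_mono 1 2) auto
      also have "\<dots> = M k" unfolding M_def 3[symmetric] by (simp only: mult_ac)
      finally show "(4 * A * B * ?e) powr (1 - 2/q) * Lk powr (2/q) \<le> M k" .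
    qed (use q in auto)
    finally show ?thesis .
  qed
  define Q where "Q = 3 * max (1 / (2 powr a - 1)) (1 / (1 - 2 powr (- \<delta>))) * L powr \<delta> * H powr a"
  define T where "T = real CARD('n) * (4 * A * C * B powr \<theta> * Q)"
  have T: "(\<Sum>i\<in>(UNIV :: 'n set). \<Sum>k<K. M k) \<le> T" for K
  proof -
    have "(\<Sum>k<K. M k) = 4 * A * C * B powr \<theta> * (\<Sum>k<K. m k)"
      by (simp add: M_def sum_distrib_left)
    also have "\<dots> \<le> 4 * A * C * B powr \<theta> * Q"
      unfolding Q_def m_def using A1 C1 by (intro mult_left_mono N) auto
    finally show ?thesis by (simp add: T_def)
  qed
  have T0: "T \<ge> 0" using T[of 0] by simp
  have series: "(\<integral>\<^sup>+x. ennreal ((\<Sum>i\<in>(UNIV :: 'n set). \<Sum>k. norm (w i k x)) powr q) \<partial>lborel) \<le> ennreal (T powr q)"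
    by (rule nn_integral_series_powr_le(2)[where M="\<lambda>_. M", OF _ _ _ _ M0 wq T]) (use q in auto)
  have "(\<integral>\<^sup>+x. ennreal (norm (g x) powr q) \<partial>lborel) \<le> (\<integral>\<^sup>+x. ennreal ((\<Sum>i\<in>(UNIV :: 'n set). \<Sum>k. norm (w i k x)) powr q) \<partial>lborel)"
  proof (rule nn_integral_mono_AE)
    have "AE x in lborel. \<forall>i\<in>UNIV. norm (g x $ i) \<le> (\<Sum>k. norm (w i k x))"
      by (rule AE_finite_allI) (auto intro: AEg)
    then show "AE x in lborel. ennreal (norm (g x) powr q) \<le> ennreal ((\<Sum>i\<in>(UNIV :: 'n set). \<Sum>k. norm (w i k x)) powr q)"
    proof eventually_elim
      case (elim x)
      have "norm (g x) \<le> (\<Sum>i\<in>UNIV. norm (g x $ i))"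
        unfolding norm_vec_def by (rule L2_set_le_sum) simp
      also have "\<dots> \<le> (\<Sum>i\<in>(UNIV :: 'n set). \<Sum>k. norm (w i k x))" using elim by (intro sum_mono) auto
      finally show ?case using q by (intro ennreal_leI powr_mono2) auto
    qed
  qed
  with series have "(\<integral>\<^sup>+x. ennreal (norm (g x) powr q) \<partial>lborel) \<le> ennreal (T powr q)"
    by (rule order_trans[rotated])
  from in_LpI_nn[OF _ _ T0 this] have "in_Lp q g" "Lp_norm q g \<le> T"
    using L2 q by (auto simp: in_Lp_def)
  moreover have "T = real CARD('n) * (12 * A * C) * max (1 / (2 powr a - 1)) (1 / (1 - 2 powr (- \<delta>)))
      * B powr \<theta> * L powr \<delta> * H powr a"
    unfolding T_def Q_def by (simp only: mult_ac) simp
  ultimately show ?thesis unfolding A_def C_def L_def H_def \<delta>_def \<theta>_def by simp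
qed

lemma Lp_norm_zero_imp:
  fixes g :: "real^'n::finite \<Rightarrow> 'b::real_normed_vector"
  assumes "in_Lp 2 g" "Lp_norm 2 g = 0" "q > 0"
  shows "in_Lp q g" "Lp_norm q g = 0"
proof -
  have m [measurable]: "g \<in> borel_measurable lborel" using assms by (simp add: in_Lp_def)
  have "L2_sq g = 0"
    using Lp_norm_2_nn[OF assms(1)] assms(2) by simp
  then have "AE x in lborel. ennreal (norm (g x)) ^ 2 = 0"
    by (subst (asm) nn_integral_0_iff_AE) measurable
  then have "(\<integral>\<^sup>+x. ennreal (norm (g x) powr q) \<partial>lborel) = (\<integral>\<^sup>+x. 0 \<partial>(lborel :: (real^'n) measure))"
    by (intro nn_integral_cong_AE) (auto elim!: eventually_mono)
  then have "(\<integral>\<^sup>+x. ennreal (norm (g x) powr q) \<partial>lborel) \<le> ennreal (0 powr q)" by simp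
  from in_LpI_nn[OF m assms(3) _ this] show "in_Lp q g" "Lp_norm q g = 0"
    using Lp_norm_nonneg[of q g] by auto
qed

text \<open>Letting \<open>B\<close> decrease to the Besov norm removes the strictness. If \<open>\<parallel>\<nabla>f\<parallel>\<^sub>2 = 0\<close>, the critical
frequency is undefined, but then the gradient vanishes almost everywhere.\<close>
theorem lemma2p3:
  fixes chi phi :: "real^'n::finite \<Rightarrow> real"
  assumes "dyadic_partition chi phi"
  shows "\<exists>C>0. \<forall>(s::real) (f :: 'n distribution) (g :: real^'n \<Rightarrow> complex^'n) (q::real).
           s < 1 \<longrightarrow> in_besov chi phi s f \<longrightarrow> nonzero_distribution f \<longrightarrow>
           has_dist_gradient f g \<longrightarrow> in_H1 g \<longrightarrow>
           2 < q \<longrightarrow> q < 2 + 2 / (1 - s) \<longrightarrow>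
           in_Lp q g \<and>
           Lp_norm q g \<le>
             C * max (1 / (2 powr ((1 - s) * (1 - 2/q)) - 1))
                     (1 / (1 - 2 powr (- (2/q - (1 - s) * (1 - 2/q)))))
             * besov_norm chi phi s f powr (1 - 2/q)
             * Lp_norm 2 g powr (2/q - (1 - s) * (1 - 2/q))
             * H1_norm g powr ((1 - s) * (1 - 2/q))"
proof -
  define C where "C = real CARD('n) * (12 * sup_const chi * L2_const chi phi)"
  have C: "C > 0" unfolding C_def using sup_const_ge(1)[of chi] L2_const_ge(1)[of chi phi] by simp
  show ?thesis
  proof (intro exI[of _ C] conjI[OF C] allI impI)
    fix s q :: real and f :: "'n distribution" and g :: "real^'n \<Rightarrow> complex^'n"
    assume s: "s < 1" and f: "in_besov chi phi s f" and grad: "has_dist_gradient f g" and H1: "in_H1 g"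
      and q: "2 < q" "q < 2 + 2 / (1 - s)"
    define a where "a = (1 - s) * (1 - 2/q)"
    define m where "m = max (1 / (2 powr a - 1)) (1 / (1 - 2 powr (- (2/q - a))))"
    define R where "R B = C * m * B powr (1 - 2/q) * Lp_norm 2 g powr (2/q - a) * H1_norm g powr a" for B
    let ?B = "besov_norm chi phi s f"
    have L2: "in_Lp 2 g" using H1 by (simp add: in_H1_def)
    have "in_Lp q g \<and> Lp_norm q g \<le> R ?B"
    proof (cases "Lp_norm 2 g = 0")
      case True
      have "a > 0" unfolding a_def using s q by (intro mult_pos_pos) auto
      then have "1 / (2 powr a - 1) > 0" using powr_less_mono[of 0 a 2] by simp
      then have "m \<ge> 0" unfolding m_def by linarith
      then have "R ?B \<ge> 0" unfolding R_def using C by (intro mult_nonneg_nonneg) auto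
      then show ?thesis using Lp_norm_zero_imp[OF L2 True, of q] q by auto
    next
      case False
      then have L0: "Lp_norm 2 g > 0" using Lp_norm_nonneg[of 2 g] by linarith
      have bd: "in_Lp q g \<and> Lp_norm q g \<le> R B" if "?B < B" for B
        using gradient_Lq_bound[OF assms s f that grad H1 L0 q] unfolding R_def m_def a_def C_def .
      have "Lp_norm q g \<le> R ?B"
      proof (rule LIMSEQ_le_const)
        have B0: "?B \<ge> 0" by (simp add: besov_norm_def)
        have "(\<lambda>n. ?B + 1 / real (Suc n)) \<longlonglongrightarrow> ?B + 0"
          by (intro tendsto_add tendsto_const LIMSEQ_Suc[OF lim_1_over_n])
        then have "(\<lambda>n. (?B + 1 / real (Suc n)) powr (1 - 2/q)) \<longlonglongrightarrow> ?B powr (1 - 2/q)"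
          using B0 q by (intro tendsto_powr' tendsto_const) (auto intro!: always_eventually)
        then show "(\<lambda>n. R (?B + 1 / real (Suc n))) \<longlonglongrightarrow> R ?B"
          unfolding R_def by (intro tendsto_mult tendsto_const)
        show "\<exists>N. \<forall>n\<ge>N. Lp_norm q g \<le> R (?B + 1 / real (Suc n))"
          using bd[of "?B + 1 / real (Suc _)"] by auto
      qed
      then show ?thesis using bd[of "?B + 1"] by simp
    qed
    then show "in_Lp q g \<and> Lp_norm q g \<le>
             C * max (1 / (2 powr ((1 - s) * (1 - 2/q)) - 1))
                     (1 / (1 - 2 powr (- (2/q - (1 - s) * (1 - 2/q)))))
             * besov_norm chi phi s f powr (1 - 2/q)
             * Lp_norm 2 g powr (2/q - (1 - s) * (1 - 2/q))
             * H1_norm g powr ((1 - s) * (1 - 2/q))"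
      unfolding R_def m_def a_def .
  qed
qed

end
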